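(* Let $m \geq 3$, let $D \subset \mathbb{R}^m$ be a bounded Lipschitz domain, let $\mu$ be a real number with $\mu^2 > 0$, and let $\alpha \in (0,1)$. If $h \in C^{0,\alpha}(\overline D)$ is a real-valued function harmonic in $D$, then the unique solution $u \in L^2(D)$ of the integral equation \[ u(x) - \mu^2 \int_D E_m(x-y)\, u(y)\,dy = h(x), \quad x \in D, \] belongs to $C^{0,\alpha}(\overline D)$ and is $\mu$-panharmonic in $D$.
   Context: $E_m(x-y) = \left[(2-m)\,\omega_m |x-y|^{m-2}\right]^{-1}$ is the fundamental solution of the Laplace equation in $\mathbb{R}^m$, $m\geq 3$, where $\omega_m = 2\pi^{m/2}/\Gamma(m/2)$ is the area of the unit sphere. $C^{0,\alpha}(\overline D)$ is the Banach space of functions on $\overline D$ that are Hölder continuous with exponent $\alpha$. A real-valued function $u$ is called $\mu$-panharmonic in $D$ if $u \in C^2(D)$ and $\nabla^2 u - \mu^2 u = 0$ in $D$. For every right-hand side in $L^2(D)$ the integral equation has exactly one solution in $L^2(D)$ (standard fact: the integral operator with kernel $E_m(x-y)$ is compact, self-adjoint and negative in $L^2(D)$). *)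

theory Defs
  imports "HOL-Analysis.Analysis"
begin

definition unit_sphere_area :: "nat \<Rightarrow> real" where
  "unit_sphere_area m = 2 * pi powr (real m / 2) / Gamma (real m / 2)"

text \<open>
  The dimension \<open>m\<close> is \<open>DIM('a)\<close>; the truncated subtraction in the exponent is only
  meant for \<open>m \<ge> 2\<close>. The value at the origin is irrelevant, the function being used
  only as an integral kernel.
\<close>
definition fundamental_solution :: "'a::euclidean_space \<Rightarrow> real" where
  "fundamental_solution z =
     inverse ((2 - real DIM('a)) * unit_sphere_area DIM('a) * norm z ^ (DIM('a) - 2))"

definition hoelder_space :: "real \<Rightarrow> 'a::metric_space set \<Rightarrow> ('a \<Rightarrow> real) set" where
  "hoelder_space \<alpha> S = {f. \<exists>C. \<forall>x\<in>S. \<forall>y\<in>S. \<bar>f x - f y\<bar> \<le> C * dist x y powr \<alpha>}"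

text \<open>
  Near each boundary point \<open>D\<close> lies strictly above the graph of a Lipschitz function,
  after a rigid motion. Instead of a rotation we pick the direction \<open>e\<close> of the last axis;
  \<open>x - (x \<bullet> e) *\<^sub>R e\<close> is the orthogonal projection onto the hyperplane of the other coordinates.
\<close>
definition bounded_lipschitz_domain :: "'a::euclidean_space set \<Rightarrow> bool" where
  "bounded_lipschitz_domain D \<longleftrightarrow>
     open D \<and> connected D \<and> D \<noteq> {} \<and> bounded D \<and>
     (\<forall>p\<in>frontier D. \<exists>e r L \<phi>. norm e = 1 \<and> r > 0 \<and> L-lipschitz_on {z. z \<bullet> e = 0} \<phi> \<and>
        D \<inter> ball p r = {x \<in> ball p r. \<phi> (x - (x \<bullet> e) *\<^sub>R e) < x \<bullet> e})"

definition partial_deriv :: "'a::euclidean_space \<Rightarrow> ('a \<Rightarrow> real) \<Rightarrow> 'a \<Rightarrow> real" where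
  "partial_deriv b f x = frechet_derivative f (at x) b"

text \<open>Meant for open \<open>D\<close>.\<close>
definition C2_on :: "'a::euclidean_space set \<Rightarrow> ('a \<Rightarrow> real) \<Rightarrow> bool" where
  "C2_on D f \<longleftrightarrow>
     f differentiable_on D \<and>
     (\<forall>b\<in>Basis. partial_deriv b f differentiable_on D) \<and>
     (\<forall>b\<in>Basis. \<forall>c\<in>Basis. continuous_on D (partial_deriv c (partial_deriv b f)))"

definition laplacian :: "('a::euclidean_space \<Rightarrow> real) \<Rightarrow> 'a \<Rightarrow> real" where
  "laplacian f x = (\<Sum>b\<in>Basis. partial_deriv b (partial_deriv b f) x)"

definition harmonic_in :: "'a::euclidean_space set \<Rightarrow> ('a \<Rightarrow> real) \<Rightarrow> bool" where
  "harmonic_in D f \<longleftrightarrow> C2_on D f \<and> (\<forall>x\<in>D. laplacian f x = 0)"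

definition panharmonic_in :: "real \<Rightarrow> 'a::euclidean_space set \<Rightarrow> ('a \<Rightarrow> real) \<Rightarrow> bool" where
  "panharmonic_in \<mu> D f \<longleftrightarrow> C2_on D f \<and> (\<forall>x\<in>D. laplacian f x - \<mu>\<^sup>2 * f x = 0)"

text \<open>Representatives; equality in \<open>L\<^sup>2(D)\<close> is equality almost everywhere in \<open>D\<close>.\<close>
definition L2_space :: "'a::euclidean_space set \<Rightarrow> ('a \<Rightarrow> real) set" where
  "L2_space D = {f \<in> borel_measurable (lebesgue_on D). integrable (lebesgue_on D) (\<lambda>x. (f x)\<^sup>2)}"

text \<open>
  As an equation in \<open>L\<^sup>2(D)\<close> it is required almost everywhere: for \<open>m \<ge> 4\<close> the integral
  of an \<open>L\<^sup>2\<close> density may diverge on a null set.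
\<close>
definition L2_solution ::
  "real \<Rightarrow> 'a::euclidean_space set \<Rightarrow> ('a \<Rightarrow> real) \<Rightarrow> ('a \<Rightarrow> real) \<Rightarrow> bool" where
  "L2_solution \<mu> D h u \<longleftrightarrow> u \<in> L2_space D \<and>
     (AE x in lebesgue_on D.
        u x - \<mu>\<^sup>2 * (\<integral>y. fundamental_solution (x - y) * u y \<partial>lebesgue_on D) = h x)"

end

theory Submission
  imports Defs
begin

text \<open>
  Write \<open>K = - E\<^sub>m \<ge> 0\<close> for the Newtonian kernel and \<open>T f = K * f\<close> for the potential of a density
  \<open>f\<close> that vanishes outside \<open>D\<close>. The integral equation is \<open>u + \<mu>\<^sup>2 T u = h\<close> on \<open>D\<close>. All densities that
  have to be handled are bounded Borel functions with bounded support; for them \<open>T f\<close> is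
  continuously differentiable with gradient \<open>\<nabla>K * f\<close> (\<open>potential_C1\<close>).

  \<^bold>\<open>Existence.\<close> Testing \<open>\<nabla>(T f)\<close> with \<open>C\<^sup>1\<close> functions of compact support gives
  \<open>\<integral> \<nabla>(T f) \<bullet> \<nabla>\<zeta> = \<integral> f \<zeta>\<close> (\<open>potential_weak\<close>), and with \<open>\<zeta> \<rightarrow> T f\<close> this shows that
  \<open>\<integral> f T f\<close> is a Dirichlet energy, hence \<open>\<ge> 0\<close> (\<open>potential_energy_nonneg\<close>). Therefore the damped
  iteration \<open>\<psi> \<mapsto> (1 - \<epsilon>) \<psi> - \<epsilon> \<mu>\<^sup>2 T \<psi> + \<epsilon> t\<close> contracts the \<open>L\<^sup>2(D)\<close> norm for small \<open>\<epsilon>\<close>. Since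
  the singularity of \<open>K\<close> is integrable, \<open>|T \<psi>| \<le> \<delta> sup |\<psi>| + C\<^sub>\<delta> \<parallel>\<psi>\<parallel>\<close> for every \<open>\<delta> > 0\<close>, with
  the \<open>L\<^sup>2(D)\<close> norm on the right, so the same iteration contracts the sup norm plus a multiple of
  the \<open>L\<^sup>2(D)\<close> norm. Thus a Neumann series converges uniformly, to a continuous solution of
  \<open>\<psi> + \<mu>\<^sup>2 T \<psi> = t\<close> for bounded continuous \<open>t\<close> (\<open>resolvent_exists\<close>).
  With \<open>t = T g\<close>, the bounded function \<open>\<phi> = g - \<mu>\<^sup>2 \<psi>\<close> solves the equation with
  right-hand side \<open>g\<close> (\<open>integral_equation_solvable\<close>).

  \<^bold>\<open>Uniqueness.\<close> Let \<open>d\<close> be the difference of an arbitrary \<open>L\<^sup>2\<close> solution and the bounded solution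
  \<open>\<phi>\<close>. Solve \<open>\<theta> + \<mu>\<^sup>2 T \<theta> = sgn d\<close> with bounded \<open>\<theta>\<close>. As \<open>T\<close> is symmetric,
  \<open>\<integral> |d| = \<integral> d (\<theta> + \<mu>\<^sup>2 T \<theta>) = \<integral> (d + \<mu>\<^sup>2 T d) \<theta> = 0\<close> (\<open>L2_solution_unique\<close>). So every
  \<open>L\<^sup>2\<close> solution equals \<open>\<phi>\<close> almost everywhere, and in particular it is bounded.

  \<^bold>\<open>Regularity.\<close> The representative is \<open>v = h - \<mu>\<^sup>2 T \<phi>\<close>. The potential of a bounded density is
  Lipschitz, so \<open>v\<close> inherits the Hoelder condition of \<open>h\<close>. In \<open>D\<close> we have \<open>\<phi> = v\<close>, which is \<open>C\<^sup>1\<close>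
  because \<open>T \<phi>\<close> is; a potential whose density is \<open>C\<^sup>1\<close> near a point is \<open>C\<^sup>2\<close> there (\<open>potential_C2\<close>), and
  the weak identity above turns into \<open>\<nabla>\<^sup>2 (T \<phi>) = - \<phi>\<close> (\<open>poisson_equation\<close>). Hence
  \<open>\<nabla>\<^sup>2 v = \<mu>\<^sup>2 \<phi> = \<mu>\<^sup>2 v\<close>.
\<close>

section \<open>Lebesgue measure in Euclidean space and integrability of a power of the norm\<close>

lemma lborel_nn_integral_affine:
  fixes t :: "'a::euclidean_space" and c :: real
  assumes [measurable]: "f \<in> borel_measurable borel" and "c \<noteq> 0"
  shows "(\<integral>\<^sup>+x. f x \<partial>lborel) = \<bar>c\<bar> ^ DIM('a) * (\<integral>\<^sup>+x. f (t + c *\<^sub>R x) \<partial>lborel)"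
  by (subst lborel_affine[OF \<open>c \<noteq> 0\<close>, of t])
     (simp add: nn_integral_density nn_integral_distr nn_integral_cmult)

lemma lborel_integrable_affine:
  fixes t :: "'a::euclidean_space" and c :: real and f :: "'a \<Rightarrow> 'b::{banach, second_countable_topology}"
  assumes f: "integrable lborel f" and c: "c \<noteq> 0"
  shows "integrable lborel (\<lambda>x. f (t + c *\<^sub>R x))"
proof (rule integrableI_bounded)
  have [measurable]: "f \<in> borel_measurable borel" using f by auto
  then show "(\<lambda>x. f (t + c *\<^sub>R x)) \<in> borel_measurable lborel" by measurable
  have "(\<integral>\<^sup>+x. norm (f x) \<partial>lborel) < \<infinity>"
    using f by (simp add: integrable_iff_bounded)
  then have "\<bar>c\<bar> ^ DIM('a) * (\<integral>\<^sup>+x. norm (f (t + c *\<^sub>R x)) \<partial>lborel) < \<infinity>"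
    by (subst (asm) lborel_nn_integral_affine[of _ c t]) (use c in auto)
  then show "(\<integral>\<^sup>+x. norm (f (t + c *\<^sub>R x)) \<partial>lborel) < \<infinity>"
    using c by (auto simp: ennreal_mult_less_top)
qed

lemma lborel_integral_affine:
  fixes t :: "'a::euclidean_space" and c :: real and f :: "'a \<Rightarrow> 'b::{banach, second_countable_topology}"
  assumes c: "c \<noteq> 0"
  shows "(LBINT x. f x) = \<bar>c\<bar> ^ DIM('a) *\<^sub>R (LBINT x. f (t + c *\<^sub>R x))"
proof (cases "integrable lborel f")
  case True
  then have [measurable]: "f \<in> borel_measurable borel" by auto
  show ?thesis
    by (subst lborel_affine[OF c, of t]) (simp add: integral_density integral_distr)
next
  case False
  have "\<not> integrable lborel (\<lambda>x. f (t + c *\<^sub>R x))"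
  proof
    assume "integrable lborel (\<lambda>x. f (t + c *\<^sub>R x))"
    from lborel_integrable_affine[OF this, of "1/c" "- (1/c) *\<^sub>R t"] c False show False
      by (simp add: scaleR_diff_right)
  qed
  with False show ?thesis by (simp add: not_integrable_integral_eq)
qed

lemma lborel_integral_reflect:
  fixes x :: "'a::euclidean_space" and f :: "'a \<Rightarrow> 'b::{banach, second_countable_topology}"
  shows "(LBINT y. f (x - y)) = (LBINT y. f y)"
  using lborel_integral_affine[of "-1" f x] by simp

lemma lborel_integral_translate:
  fixes x :: "'a::euclidean_space" and f :: "'a \<Rightarrow> 'b::{banach, second_countable_topology}"
  shows "(LBINT y. f (x + y)) = (LBINT y. f y)"
  using lborel_integral_affine[of 1 f x] by simp

lemma lborel_integrable_reflect:
  fixes x :: "'a::euclidean_space" and f :: "'a \<Rightarrow> 'b::{banach, second_countable_topology}"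
  assumes "integrable lborel f"
  shows "integrable lborel (\<lambda>y. f (x - y))"
  using lborel_integrable_affine[OF assms, of "-1" x] by simp

text \<open>
  Layer-cake form of a negative power. It turns the integral of \<open>|z|\<^sup>1\<^sup>-\<^sup>m\<close> over a ball into an integral
  of volumes of balls, which replaces polar coordinates.
\<close>
lemma inverse_power_eq_layer_integral:
  fixes a r :: real
  assumes "0 < a" "a \<le> r"
  shows "ennreal (inverse (a ^ n)) = ennreal (inverse (r ^ n)) +
     (\<integral>\<^sup>+t. ennreal (real n * inverse (t ^ Suc n)) * indicator {a..r} t \<partial>lborel)"
proof -
  have "(\<integral>\<^sup>+t. ennreal (real n * inverse (t ^ Suc n)) * indicator {a..r} t \<partial>lborel)
      = ennreal (- inverse (r ^ n) - (- inverse (a ^ n)))"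
  proof (rule nn_integral_FTC_Icc)
    fix t assume t': "t \<in> {a..r}"
    then have t: "a \<le> t" "t \<le> r" by auto
    have "((\<lambda>t. - inverse (t ^ n)) has_real_derivative real n * inverse (t ^ Suc n)) (at t)"
    proof (cases n)
      case (Suc k)
      have "((\<lambda>t. t ^ Suc k) has_real_derivative real (Suc k) * t ^ k) (at t)"
        using DERIV_pow[of "Suc k" t] by simp
      from DERIV_minus[OF DERIV_inverse'[OF this]] have
        "((\<lambda>t. - inverse (t ^ Suc k)) has_real_derivative
           inverse (t ^ Suc k) * (real (Suc k) * t ^ k) * inverse (t ^ Suc k)) (at t)"
        using t assms by (simp del: power_Suc)
      moreover have "inverse (t ^ Suc k) * (real (Suc k) * t ^ k) * inverse (t ^ Suc k)
          = real n * inverse (t ^ Suc n)"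
        using t assms Suc by (simp add: field_simps del: of_nat_Suc)
      ultimately show ?thesis unfolding Suc by (simp only:)
    qed simp
    then show "((\<lambda>t. - inverse (t ^ n)) has_real_derivative real n * inverse (t ^ Suc n)) (at t)" .
    show "0 \<le> real n * inverse (t ^ Suc n)" using t assms by auto
  qed (use assms in auto)
  moreover have "inverse (r ^ n) \<le> inverse (a ^ n)"
    using assms by (simp add: power_mono le_imp_inverse_le)
  ultimately show ?thesis
    using assms by (simp add: ennreal_plus[symmetric] del: ennreal_plus)
qed

text \<open>
  After the exchange of the two integrations, the inner one is the volume of a ball of radius
  \<open>t\<close>, and its factor \<open>t ^ m\<close> cancels the singularity.
\<close>
lemma nn_integral_norm_power_ball_le:
  fixes r :: real
  assumes "r > 0"
  shows "(\<integral>\<^sup>+(z::'a::euclidean_space). ennreal (inverse (norm z ^ (DIM('a) - 1))) * indicator (ball 0 r) z \<partial>lborel)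
      \<le> ennreal (DIM('a) * unit_ball_vol DIM('a) * r)"
proof -
  define n where "n = DIM('a) - 1"
  have Suc_n: "Suc n = DIM('a)" by (simp add: n_def)
  define v where "v = unit_ball_vol DIM('a)"
  have v: "v \<ge> 0" by (simp add: v_def)
  have vol: "emeasure lborel (cball (0::'a) t) = ennreal (v * t ^ Suc n)" if "t \<ge> 0" for t
    unfolding Suc_n v_def using that by (rule emeasure_cball)
  have [measurable]: "cball (0::'a) r \<in> sets borel" by simp
  have "(\<integral>\<^sup>+(z::'a). ennreal (inverse (norm z ^ n)) * indicator (ball 0 r) z \<partial>lborel)
      \<le> (\<integral>\<^sup>+(z::'a). ennreal (inverse (r ^ n)) * indicator (cball 0 r) z +
           (\<integral>\<^sup>+t. ennreal (real n * inverse (t ^ Suc n)) * indicator {0..r} t * indicator {t. norm z \<le> t} t \<partial>lborel) \<partial>lborel)"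
  proof (rule nn_integral_mono_AE)
    have "AE z::'a in lborel. z \<noteq> 0" by (rule AE_lborel_singleton)
    then show "AE z::'a in lborel. ennreal (inverse (norm z ^ n)) * indicator (ball 0 r) z
       \<le> ennreal (inverse (r ^ n)) * indicator (cball 0 r) z +
           (\<integral>\<^sup>+t. ennreal (real n * inverse (t ^ Suc n)) * indicator {0..r} t * indicator {t. norm z \<le> t} t \<partial>lborel)"
    proof eventually_elim
      case (elim z)
      show ?case
      proof (cases "norm z < r")
        case True
        have "ennreal (inverse (norm z ^ n)) = ennreal (inverse (r ^ n)) +
           (\<integral>\<^sup>+t. ennreal (real n * inverse (t ^ Suc n)) * indicator {norm z..r} t \<partial>lborel)"
          using elim True by (intro inverse_power_eq_layer_integral) auto
        also have "\<dots> \<le> ennreal (inverse (r ^ n)) + (\<integral>\<^sup>+t. ennreal (real n * inverse (t ^ Suc n)) * indicator {0..r} t * indicator {t. norm z \<le> t} t \<partial>lborel)"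
          by (intro add_left_mono nn_integral_mono)
             (auto simp: indicator_def intro: order_trans[OF norm_ge_zero])
        finally show ?thesis using True by auto
      qed auto
    qed
  qed
  also have "\<dots> = ennreal (inverse (r ^ n)) * ennreal (v * r ^ Suc n) +
     (\<integral>\<^sup>+(z::'a). (\<integral>\<^sup>+t. ennreal (real n * inverse (t ^ Suc n)) * indicator {0..r} t * indicator {t. norm z \<le> t} t \<partial>lborel) \<partial>lborel)"
    using assms by (subst nn_integral_add; (measurable)?)
      (auto simp: nn_integral_cmult_indicator vol)
  also have "ennreal (inverse (r ^ n)) * ennreal (v * r ^ Suc n) = ennreal (v * r)"
    using assms by (subst ennreal_mult[symmetric]) (auto simp: v_def)
  also have "(\<integral>\<^sup>+(z::'a). (\<integral>\<^sup>+t. ennreal (real n * inverse (t ^ Suc n)) * indicator {0..r} t * indicator {t. norm z \<le> t} t \<partial>lborel) \<partial>lborel)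
     = (\<integral>\<^sup>+t. (\<integral>\<^sup>+(z::'a). ennreal (real n * inverse (t ^ Suc n)) * indicator {0..r} t * indicator {t. norm z \<le> t} t \<partial>lborel) \<partial>lborel)"
    by (rule lborel_pair.Fubini') measurable
  also have "\<dots> = (\<integral>\<^sup>+t. ennreal (real n * inverse (t ^ Suc n)) * indicator {0..r} t * ennreal (v * t ^ Suc n) \<partial>lborel)"
  proof (rule nn_integral_cong)
    fix t :: real
    have "(\<integral>\<^sup>+(z::'a). ennreal (real n * inverse (t ^ Suc n)) * indicator {0..r} t * indicator {t. norm z \<le> t} t \<partial>lborel)
      = (\<integral>\<^sup>+(z::'a). ennreal (real n * inverse (t ^ Suc n)) * indicator {0..r} t * indicator (cball 0 t) z \<partial>lborel)"
      by (intro nn_integral_cong) (auto simp: indicator_def)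
    also have "\<dots> = ennreal (real n * inverse (t ^ Suc n)) * indicator {0..r} t * emeasure lborel (cball (0::'a) t)"
      by (subst nn_integral_cmult_indicator) auto
    also have "\<dots> = ennreal (real n * inverse (t ^ Suc n)) * indicator {0..r} t * ennreal (v * t ^ Suc n)"
      by (cases "t \<ge> 0") (auto simp: vol)
    finally show "(\<integral>\<^sup>+(z::'a). ennreal (real n * inverse (t ^ Suc n)) * indicator {0..r} t * indicator {t. norm z \<le> t} t \<partial>lborel) = \<dots>" .
  qed
  also have "\<dots> \<le> (\<integral>\<^sup>+t. ennreal (real n * v) * indicator {0..r} t \<partial>lborel)"
  proof (rule nn_integral_mono)
    fix t :: real
    show "ennreal (real n * inverse (t ^ Suc n)) * indicator {0..r} t * ennreal (v * t ^ Suc n)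
      \<le> ennreal (real n * v) * indicator {0..r} t"
    proof (cases "t \<in> {0<..r}")
      case True
      then have "t ^ Suc n \<noteq> 0" by simp
      then have "real n * inverse (t ^ Suc n) * (v * t ^ Suc n) = real n * v"
        by (simp del: power_Suc)
      moreover have "0 \<le> v * t ^ Suc n" "0 \<le> real n * inverse (t ^ Suc n)"
        using True v by auto
      ultimately have "ennreal (real n * inverse (t ^ Suc n)) * ennreal (v * t ^ Suc n) = ennreal (real n * v)"
        by (metis ennreal_mult)
      then show ?thesis using True by auto
    qed (auto simp: indicator_def)
  qed
  also have "\<dots> = ennreal (real n * v * r)"
    using assms v by (subst nn_integral_cmult_indicator) (auto simp: ennreal_mult)
  also have "ennreal (v * r) + ennreal (real n * v * r) = ennreal (DIM('a) * v * r)"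
    using assms v by (subst ennreal_plus[symmetric]) (auto simp: Suc_n[symmetric] algebra_simps)
  finally show ?thesis
    unfolding n_def v_def by (simp add: add_left_mono)
qed

section \<open>Convolution with continuously differentiable functions\<close>

abbreviation conv :: "('a::euclidean_space \<Rightarrow> real) \<Rightarrow> ('a \<Rightarrow> 'b::{banach, second_countable_topology}) \<Rightarrow> 'a \<Rightarrow> 'b" where
  "conv g F x \<equiv> LBINT y. g y *\<^sub>R F (x - y)"

lemma gradient_bound_imp_lipschitz:
  fixes F :: "'a::euclidean_space \<Rightarrow> real"
  assumes "convex S" "\<And>x. x \<in> S \<Longrightarrow> (F has_derivative (\<lambda>h. G x \<bullet> h)) (at x)"
    and "\<And>x. x \<in> S \<Longrightarrow> norm (G x) \<le> B" and "x \<in> S" "y \<in> S"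
  shows "\<bar>F x - F y\<bar> \<le> B * norm (x - y)"
proof -
  have "norm (F x - F y) \<le> B * norm (x - y)"
  proof (rule differentiable_bound[where f' = "\<lambda>x h. G x \<bullet> h"])
    fix z assume z: "z \<in> S"
    show "(F has_derivative (\<lambda>h. G z \<bullet> h)) (at z within S)"
      using assms(2)[OF z] by (rule has_derivative_at_withinI)
    have "norm (G z \<bullet> h) \<le> B * norm h" for h
      using Cauchy_Schwarz_ineq2[of "G z" h] mult_right_mono[OF assms(3)[OF z] norm_ge_zero[of h]]
      by simp
    then show "onorm (\<lambda>h. G z \<bullet> h) \<le> B" by (rule onorm_le)
  qed (use assms in auto)
  then show ?thesis by simp
qed

lemma integrable_conv:
  fixes F :: "'a::euclidean_space \<Rightarrow> 'b::{banach, second_countable_topology}"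
  assumes g: "integrable lborel g" and F: "F \<in> borel_measurable borel"
    and supp: "\<And>y. norm y > \<rho> \<Longrightarrow> g y = 0"
    and B: "\<And>z. z \<in> ball c (s + \<rho>) \<Longrightarrow> norm (F z) \<le> B"
    and x: "x \<in> ball c s"
  shows "integrable lborel (\<lambda>y. g y *\<^sub>R F (x - y))"
proof (rule Bochner_Integration.integrable_bound)
  show "integrable lborel (\<lambda>y. B * g y)" using g by simp
  have [measurable]: "g \<in> borel_measurable borel" using g by auto
  note F[measurable]
  show "(\<lambda>y. g y *\<^sub>R F (x - y)) \<in> borel_measurable lborel" by measurable
  have "norm (g y *\<^sub>R F (x - y)) \<le> norm (B * g y)" for y
  proof (cases "norm y > \<rho>")
    case False
    have "x - y \<in> ball c (s + \<rho>)"
      using x False norm_triangle_ineq[of "c - x" y] by (auto simp: dist_norm algebra_simps)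
    from B[OF this] have "norm (F (x - y)) \<le> \<bar>B\<bar>" by simp
    then show ?thesis
      using mult_left_mono[of "norm (F (x - y))" "\<bar>B\<bar>" "\<bar>g y\<bar>"] by (simp add: abs_mult mult_ac)
  qed (simp add: supp)
  then show "AE y in lborel. norm (g y *\<^sub>R F (x - y)) \<le> norm (B * g y)" by simp
qed

lemma continuous_on_conv:
  fixes F :: "'a::euclidean_space \<Rightarrow> 'b::{banach, second_countable_topology}"
  assumes g: "integrable lborel g" and F: "F \<in> borel_measurable borel"
    and supp: "\<And>y. norm y > \<rho> \<Longrightarrow> g y = 0"
    and B: "\<And>z. z \<in> ball c (s + \<rho>) \<Longrightarrow> norm (F z) \<le> B"
    and cont: "continuous_on (ball c (s + \<rho>)) F"
  shows "continuous_on (ball c s) (conv g F)"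
  unfolding continuous_on_sequentially
proof (intro allI ballI impI)
  fix X :: "nat \<Rightarrow> 'a" and x
  assume x: "x \<in> ball c s" and X: "(\<forall>n. X n \<in> ball c s) \<and> X \<longlonglongrightarrow> x"
  have [measurable]: "g \<in> borel_measurable borel" using g by auto
  note F[measurable]
  have inb: "z - y \<in> ball c (s + \<rho>)" if "z \<in> ball c s" "\<not> norm y > \<rho>" for z y
    using that norm_triangle_ineq[of "c - z" y] by (auto simp: dist_norm algebra_simps)
  have "(\<lambda>n. conv g F (X n)) \<longlonglongrightarrow> (conv g F x)"
  proof (rule integral_dominated_convergence[where w = "\<lambda>y. \<bar>B\<bar> * \<bar>g y\<bar>"])
    show "integrable lborel (\<lambda>y. \<bar>B\<bar> * \<bar>g y\<bar>)" using g by simp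
    have "(\<lambda>n. g y *\<^sub>R F (X n - y)) \<longlonglongrightarrow> g y *\<^sub>R F (x - y)" for y
    proof (cases "norm y > \<rho>")
      case False
      have "(\<lambda>n. F (X n - y)) \<longlonglongrightarrow> F (x - y)"
      proof (rule continuous_on_tendsto_compose[OF cont])
        show "(\<lambda>n. X n - y) \<longlonglongrightarrow> x - y" using X by (intro tendsto_intros) auto
        show "\<forall>\<^sub>F n in sequentially. X n - y \<in> ball c (s + \<rho>)"
          using X False by (intro always_eventually allI inb) auto
      qed (use inb x False in auto)
      then show ?thesis by (intro tendsto_intros)
    qed (simp add: supp)
    then show "AE y in lborel. (\<lambda>n. g y *\<^sub>R F (X n - y)) \<longlonglongrightarrow> g y *\<^sub>R F (x - y)" by simp
    have "norm (g y *\<^sub>R F (X n - y)) \<le> \<bar>B\<bar> * \<bar>g y\<bar>" for n y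
    proof (cases "norm y > \<rho>")
      case False
      have "norm (F (X n - y)) \<le> \<bar>B\<bar>" using B[OF inb[of "X n" y]] X False by force
      then show ?thesis
        using mult_left_mono[of "norm (F (X n - y))" "\<bar>B\<bar>" "\<bar>g y\<bar>"] by (simp add: mult_ac)
    qed (simp add: supp)
    then show "\<And>n. AE y in lborel. norm (g y *\<^sub>R F (X n - y)) \<le> \<bar>B\<bar> * \<bar>g y\<bar>" by simp
  qed measurable
  then show "((conv g F) \<circ> X) \<longlonglongrightarrow> (conv g F x)"
    by (simp add: o_def)
qed

text \<open>
  The convolution is formed only on a small ball, so \<open>F\<close> needs to be smooth only on the ball of radius
  \<open>s + \<rho>\<close>. Both roles of the factors occur below: \<open>g\<close> a density and \<open>F\<close> a smooth kernel, or \<open>g\<close> a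
  kernel of small support and \<open>F\<close> a density that is differentiable near a point. The difference
  quotients are dominated by a multiple of \<open>|g|\<close>.
\<close>
lemma conv_has_gradient:
  fixes F :: "'a::euclidean_space \<Rightarrow> real" and G :: "'a \<Rightarrow> 'a"
  assumes g: "integrable lborel g" and F: "F \<in> borel_measurable borel" and G: "G \<in> borel_measurable borel"
    and supp: "\<And>y. norm y > \<rho> \<Longrightarrow> g y = 0"
    and der: "\<And>z. z \<in> ball c (s + \<rho>) \<Longrightarrow> (F has_derivative (\<lambda>h. G z \<bullet> h)) (at z)"
    and BF: "\<And>z. z \<in> ball c (s + \<rho>) \<Longrightarrow> \<bar>F z\<bar> \<le> B"
    and BG: "\<And>z. z \<in> ball c (s + \<rho>) \<Longrightarrow> norm (G z) \<le> B"
    and x: "x \<in> ball c s"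
  shows "((\<lambda>x. LBINT y. g y * F (x - y)) has_derivative
      (\<lambda>h. conv g G x \<bullet> h)) (at x)"
proof -
  have [measurable]: "g \<in> borel_measurable borel" using g by auto
  note F[measurable] G[measurable]
  have inb: "z - y \<in> ball c (s + \<rho>)" if "z \<in> ball c s" "\<not> norm y > \<rho>" for z y
    using that norm_triangle_ineq[of "c - z" y] by (auto simp: dist_norm algebra_simps)
  have iF: "integrable lborel (\<lambda>y. g y * F (z - y))" if "z \<in> ball c s" for z
    using integrable_conv[OF g F supp, of \<rho> c s B z] BF that by simp
  have iG: "integrable lborel (\<lambda>y. g y *\<^sub>R G (x - y))"
    using integrable_conv[OF g G supp, of \<rho> c s B x] BG x by simp
  let ?V = "conv g G x"
  let ?w = "\<lambda>x. LBINT y. g y * F (x - y)"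
  have "((\<lambda>z. norm (?w z - ?w x - ?V \<bullet> (z - x)) / norm (z - x)) \<longlongrightarrow> 0) (at x within ball c s)"
    unfolding tendsto_at_iff_sequentially
  proof (intro allI impI)
    fix X :: "nat \<Rightarrow> 'a" assume X0: "\<forall>i. X i \<in> ball c s - {x}" and Xx: "X \<longlonglongrightarrow> x"
    then have X: "X i \<in> ball c s" and Xne: "X i \<noteq> x" for i by auto
    define Q where "Q n y = (g y * F (X n - y) - g y * F (x - y) - (g y *\<^sub>R G (x - y)) \<bullet> (X n - x)) / norm (X n - x)" for n y
    have "(\<lambda>n. LBINT y. Q n y) \<longlonglongrightarrow> (\<integral>y. 0 \<partial>(lborel::'a measure))"
    proof (rule integral_dominated_convergence[where w = "\<lambda>y. 2 * \<bar>B\<bar> * \<bar>g y\<bar>"])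
      show "integrable lborel (\<lambda>y. 2 * \<bar>B\<bar> * \<bar>g y\<bar>)" using g by simp
      have "(\<lambda>n. Q n y) \<longlonglongrightarrow> 0" for y
      proof (cases "norm y > \<rho>")
        case False
        have "((\<lambda>z. norm (F z - F (x - y) - G (x - y) \<bullet> (z - (x - y))) / norm (z - (x - y))) \<longlongrightarrow> 0) (at (x - y))"
          using der[OF inb[OF x False]] by (simp add: has_derivative_iff_norm)
        then have "(\<lambda>n. norm (F (X n - y) - F (x - y) - G (x - y) \<bullet> ((X n - y) - (x - y))) / norm ((X n - y) - (x - y))) \<longlonglongrightarrow> 0"
        proof (rule filterlim_compose)
          show "filterlim (\<lambda>n. X n - y) (at (x - y)) sequentially"
            unfolding filterlim_at using Xx Xne by (auto intro!: tendsto_intros)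
        qed
        then have "(\<lambda>n. \<bar>g y\<bar> * (norm (F (X n - y) - F (x - y) - G (x - y) \<bullet> (X n - x)) / norm (X n - x))) \<longlonglongrightarrow> \<bar>g y\<bar> * 0"
          by (intro tendsto_intros) simp
        moreover have "\<bar>g y\<bar> * (norm (F (X n - y) - F (x - y) - G (x - y) \<bullet> (X n - x)) / norm (X n - x)) = \<bar>Q n y\<bar>" for n
          by (simp add: Q_def abs_mult[symmetric] right_diff_distrib)
        ultimately show ?thesis by (simp add: tendsto_rabs_zero_iff)
      qed (simp add: supp Q_def)
      then show "AE y in lborel. (\<lambda>n. Q n y) \<longlonglongrightarrow> 0" by simp
      have "norm (Q n y) \<le> 2 * \<bar>B\<bar> * \<bar>g y\<bar>" for n y
      proof (cases "norm y > \<rho>")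
        case False
        have "\<bar>F (X n - y) - F (x - y)\<bar> \<le> B * norm ((X n - y) - (x - y))"
          by (rule gradient_bound_imp_lipschitz[OF convex_ball der BG inb[OF X False] inb[OF x False]])
        then have 1: "\<bar>F (X n - y) - F (x - y)\<bar> \<le> \<bar>B\<bar> * norm (X n - x)"
          by (simp add: order_trans[OF _ mult_right_mono[of B "\<bar>B\<bar>"]])
        have "\<bar>G (x - y) \<bullet> (X n - x)\<bar> \<le> norm (G (x - y)) * norm (X n - x)"
          by (rule Cauchy_Schwarz_ineq2)
        also have "\<dots> \<le> \<bar>B\<bar> * norm (X n - x)"
          using BG[OF inb[OF x False]] by (intro mult_right_mono) auto
        finally have "\<bar>F (X n - y) - F (x - y) - G (x - y) \<bullet> (X n - x)\<bar> \<le> 2 * \<bar>B\<bar> * norm (X n - x)"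
          using 1 by simp
        then have "\<bar>g y\<bar> * \<bar>F (X n - y) - F (x - y) - G (x - y) \<bullet> (X n - x)\<bar> \<le> \<bar>g y\<bar> * (2 * \<bar>B\<bar> * norm (X n - x))"
          by (rule mult_left_mono) simp
        then have "\<bar>Q n y\<bar> * norm (X n - x) \<le> 2 * \<bar>B\<bar> * \<bar>g y\<bar> * norm (X n - x)"
          using Xne[of n] by (simp add: Q_def abs_mult[symmetric] right_diff_distrib algebra_simps)
        then show ?thesis using Xne[of n] by simp
      qed (simp add: supp Q_def)
      then show "\<And>n. AE y in lborel. norm (Q n y) \<le> 2 * \<bar>B\<bar> * \<bar>g y\<bar>" by simp
      show "\<And>n. Q n \<in> borel_measurable lborel" unfolding Q_def by measurable
    qed simp
    moreover have "(LBINT y. Q n y) = (?w (X n) - ?w x - ?V \<bullet> (X n - x)) / norm (X n - x)" for n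
    proof -
      have iC: "integrable lborel (\<lambda>y. (g y *\<^sub>R G (x - y)) \<bullet> (X n - x))"
        by (rule integrable_inner_left) (rule iG)
      have "(LBINT y. g y * F (X n - y) - g y * F (x - y) - (g y *\<^sub>R G (x - y)) \<bullet> (X n - x))
          = (LBINT y. g y * F (X n - y) - g y * F (x - y)) - (LBINT y. (g y *\<^sub>R G (x - y)) \<bullet> (X n - x))"
        by (rule Bochner_Integration.integral_diff[OF Bochner_Integration.integrable_diff[OF iF[OF X] iF[OF x]] iC])
      also have "(LBINT y. g y * F (X n - y) - g y * F (x - y)) = ?w (X n) - ?w x"
        by (rule Bochner_Integration.integral_diff[OF iF[OF X] iF[OF x]])
      also have "(LBINT y. (g y *\<^sub>R G (x - y)) \<bullet> (X n - x)) = ?V \<bullet> (X n - x)"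
        by (rule integral_inner_left) (rule iG)
      finally have E: "(LBINT y. g y * F (X n - y) - g y * F (x - y) - (g y *\<^sub>R G (x - y)) \<bullet> (X n - x))
          = ?w (X n) - ?w x - ?V \<bullet> (X n - x)" .
      show ?thesis
        unfolding Q_def by (subst integral_divide_zero, subst E) (rule refl)
    qed
    ultimately have lim: "(\<lambda>n. (?w (X n) - ?w x - ?V \<bullet> (X n - x)) / norm (X n - x)) \<longlonglongrightarrow> 0"
      by (simp only: integral_zero)
    have "(\<lambda>n. \<bar>(?w (X n) - ?w x - ?V \<bullet> (X n - x)) / norm (X n - x)\<bar>) \<longlonglongrightarrow> 0"
      using lim by (rule tendsto_rabs_zero)
    then show "((\<lambda>z. norm (?w z - ?w x - ?V \<bullet> (z - x)) / norm (z - x)) \<circ> X) \<longlonglongrightarrow> 0"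
      unfolding o_def abs_divide abs_norm_cancel real_norm_def .
  qed
  then have "(?w has_derivative (\<lambda>h. ?V \<bullet> h)) (at x within ball c s)"
    unfolding has_derivative_iff_norm using bounded_linear_inner_right by blast
  then show ?thesis using x at_within_open[OF x open_ball] by simp
qed

section \<open>Bounded densities and weakly singular kernels\<close>

lemma unit_sphere_area_eq: 
  assumes "n \<ge> 1" shows "unit_sphere_area n = real n * unit_ball_vol (real n)"
proof -
  have "Gamma (real n / 2 + 1) = real n / 2 * Gamma (real n / 2)"
    using assms by (intro Gamma_plus1) (auto elim!: nonpos_Ints_cases)
  moreover have "Gamma (real n / 2) > 0" using assms by (intro Gamma_real_pos) auto
  ultimately show ?thesis using assms
    unfolding unit_sphere_area_def unit_ball_vol_def
    by (simp only: of_nat_0_less_iff) (simp add: divide_simps)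
qed

lemma unit_sphere_area_pos: "n \<ge> 1 \<Longrightarrow> unit_sphere_area n > 0"
  by (simp add: unit_sphere_area_eq)

text \<open>
  The size of \<open>\<nabla>K\<close> up to a constant; its value at 0 is 0 as soon as \<open>m \<ge> 2\<close>.
\<close>
definition riesz :: "'a::euclidean_space \<Rightarrow> real" where
  "riesz z = inverse (norm z ^ (DIM('a) - 1))"

lemma riesz_nonneg [simp]: "riesz z \<ge> 0" by (simp add: riesz_def)

lemma riesz_uminus [simp]: "riesz (- z) = riesz z" by (simp add: riesz_def)

lemma borel_measurable_riesz [measurable]: "riesz \<in> borel_measurable borel"
  unfolding riesz_def by measurable

lemma nn_integral_riesz_ball:
  assumes "r > 0"
  shows "(\<integral>\<^sup>+(z::'a::euclidean_space). ennreal (riesz z * indicator (ball 0 r) z) \<partial>lborel)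
           \<le> ennreal (unit_sphere_area DIM('a) * r)"
  using nn_integral_norm_power_ball_le[OF assms, where 'a='a]
  by (simp add: unit_sphere_area_eq riesz_def ennreal_mult ennreal_indicator Suc_le_eq)

lemma integrable_riesz_ball:
  assumes "r > 0"
  shows "integrable lborel (\<lambda>z::'a::euclidean_space. riesz z * indicator (ball 0 r) z)"
proof (rule integrableI_nonneg)
  have [measurable]: "ball (0::'a) r \<in> sets borel" by simp
  show "(\<lambda>z::'a. riesz z * indicator (ball 0 r) z) \<in> borel_measurable lborel" by measurable
  show "(\<integral>\<^sup>+(z::'a). ennreal (riesz z * indicator (ball 0 r) z) \<partial>lborel) < \<infinity>"
    using nn_integral_riesz_ball[OF assms, where 'a='a] by (rule order.strict_trans1) simp
qed simp

lemma integral_riesz_ball_le: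
  assumes "r > 0"
  shows "(LBINT (z::'a::euclidean_space). riesz z * indicator (ball 0 r) z) \<le> unit_sphere_area DIM('a) * r"
proof -
  have "unit_sphere_area DIM('a) > 0" by (rule unit_sphere_area_pos) (simp add: Suc_le_eq)
  then show ?thesis
    using nn_integral_riesz_ball[OF assms, where 'a='a]
      nn_integral_eq_integral[OF integrable_riesz_ball[OF assms, where 'a='a]] assms
    by simp
qed

definition bounded_density :: "('a::euclidean_space \<Rightarrow> real) \<Rightarrow> bool" where
  "bounded_density f \<longleftrightarrow> f \<in> borel_measurable borel \<and> (\<exists>M. \<forall>x. \<bar>f x\<bar> \<le> M) \<and>
     (\<exists>\<rho>. \<forall>x. norm x > \<rho> \<longrightarrow> f x = 0)"

lemma bounded_density_measurable: "bounded_density f \<Longrightarrow> f \<in> borel_measurable borel"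
  by (simp add: bounded_density_def)

lemma bounded_densityE:
  assumes "bounded_density f"
  obtains M \<rho> where "f \<in> borel_measurable borel" "M > 0" "\<rho> > 0" "\<And>x. \<bar>f x\<bar> \<le> M" "\<And>x. norm x > \<rho> \<Longrightarrow> f x = 0"
proof -
  from assms obtain M \<rho> where *: "f \<in> borel_measurable borel" "\<And>x. \<bar>f x\<bar> \<le> M" "\<And>x. norm x > \<rho> \<Longrightarrow> f x = 0"
    unfolding bounded_density_def by blast
  show thesis
    by (rule that[of "max M 1" "max \<rho> 1"]) (use * in \<open>auto simp: le_max_iff_disj\<close>)
qed

lemma integrable_bounded_density:
  assumes "bounded_density f" shows "integrable lborel f"
proof -
  obtain M \<rho> where f: "f \<in> borel_measurable borel" "M > 0" "\<rho> > 0" "\<And>x. \<bar>f x\<bar> \<le> M" "\<And>x. norm x > \<rho> \<Longrightarrow> f x = 0"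
    using assms by (rule bounded_densityE) blast
  show ?thesis
  proof (rule Bochner_Integration.integrable_bound)
    show "integrable lborel (\<lambda>x. M * indicator (cball (0::'a) \<rho>) x)"
      by (intro integrable_mult_right integrable_real_indicator)
         (auto simp: emeasure_cball[OF less_imp_le[OF f(3)]])
    show "AE x in lborel. norm (f x) \<le> norm (M * indicator (cball 0 \<rho>) x)"
      using f(2,4,5) by (auto simp: indicator_def not_le)
  qed (use f(1) in simp)
qed

lemma bounded_density_mult:
  assumes "bounded_density f" "g \<in> borel_measurable borel" "\<And>x. f x \<noteq> 0 \<Longrightarrow> \<bar>g x\<bar> \<le> B"
  shows "bounded_density (\<lambda>x. f x * g x)"
proof -
  obtain M \<rho> where f: "f \<in> borel_measurable borel" "M > 0" "\<rho> > 0" "\<And>x. \<bar>f x\<bar> \<le> M" "\<And>x. norm x > \<rho> \<Longrightarrow> f x = 0"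
    using assms(1) by (rule bounded_densityE) blast
  have "\<bar>f x * g x\<bar> \<le> M * \<bar>B\<bar>" for x
    using f(2) f(4)[of x] assms(3)[of x] by (cases "f x = 0") (auto simp: abs_mult intro!: mult_mono)
  then show ?thesis
    using f assms(2) unfolding bounded_density_def by (auto intro!: exI)
qed

text \<open>
  Kernels with at most the singularity of \<open>\<nabla>K\<close> at the origin and bounded elsewhere.
\<close>
definition weakly_singular :: "('a::euclidean_space \<Rightarrow> 'b::{banach, second_countable_topology}) \<Rightarrow> bool" where
  "weakly_singular k \<longleftrightarrow> k \<in> borel_measurable borel \<and>
     (\<exists>C. \<forall>z. norm (k z) \<le> C * (riesz z * indicator (ball 0 1) z + 1))"

lemma weakly_singular_measurable: "weakly_singular k \<Longrightarrow> k \<in> borel_measurable borel"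
  by (simp add: weakly_singular_def)

text \<open>
  Near \<open>x\<close> the singularity is absorbed by the local integrability of \<open>riesz\<close> and the bound of \<open>f\<close>,
  away from \<open>x\<close> the kernel is bounded and \<open>f\<close> is integrable; neither part depends on \<open>x\<close>.
\<close>
lemma integrable_norm_conv_kernel:
  fixes k :: "'a::euclidean_space \<Rightarrow> 'b::{banach, second_countable_topology}"
  assumes f: "bounded_density f" and k: "weakly_singular k"
  shows "integrable lborel (\<lambda>y. f y *\<^sub>R k (x - y))"
    and "\<exists>B. \<forall>x. (LBINT y. norm (f y *\<^sub>R k (x - y))) \<le> B"
proof -
  obtain M \<rho> where fM: "f \<in> borel_measurable borel" "M > 0" "\<rho> > 0" "\<And>x. \<bar>f x\<bar> \<le> M" "\<And>x. norm x > \<rho> \<Longrightarrow> f x = 0"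
    using f by (rule bounded_densityE) blast
  obtain C where C: "norm (k z) \<le> C * (riesz z * indicator (ball 0 1) z + 1)" for z
    using k by (auto simp: weakly_singular_def)
  have "0 < riesz (0::'a) * indicator (ball 0 1) (0::'a) + 1" by (simp add: add_nonneg_pos)
  then have "0 \<le> C" using order_trans[OF norm_ge_zero C[of "0"]]
    by (meson zero_le_mult_iff not_le)
  note [measurable] = weakly_singular_measurable[OF k] fM(1)
  let ?R = "\<lambda>z::'a. riesz z * indicator (ball 0 1) z"
  let ?b = "\<lambda>x y. C * (M * ?R (x - y) + \<bar>f y\<bar>)"
  have iR: "integrable lborel (\<lambda>y. ?R (x - y))" for x
    by (rule lborel_integrable_reflect) (rule integrable_riesz_ball, simp)
  have ib: "integrable lborel (?b x)" for x
    using iR[of x] integrable_bounded_density[OF f] by (intro integrable_mult_right integrable_add) auto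
  have bd: "norm (f y *\<^sub>R k (x - y)) \<le> ?b x y" for x y
  proof -
    have "norm (f y *\<^sub>R k (x - y)) \<le> \<bar>f y\<bar> * (C * (?R (x - y) + 1))"
      using mult_left_mono[OF C abs_ge_zero[of "f y"]] by simp
    also have "\<dots> = C * (\<bar>f y\<bar> * ?R (x - y) + \<bar>f y\<bar>)" by (simp add: algebra_simps)
    also have "\<dots> \<le> ?b x y"
      using \<open>0 \<le> C\<close> fM(4)[of y] by (intro mult_left_mono add_right_mono mult_right_mono) auto
    finally show ?thesis .
  qed
  show *: "integrable lborel (\<lambda>y. f y *\<^sub>R k (x - y))" for x
  proof (rule Bochner_Integration.integrable_bound[OF ib[of x]])
    show "AE y in lborel. norm (f y *\<^sub>R k (x - y)) \<le> norm (?b x y)"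
      by (intro AE_I2) (subst real_norm_def, rule order_trans[OF bd abs_ge_self])
  qed measurable
  have "(LBINT y. norm (f y *\<^sub>R k (x - y))) \<le> (LBINT y. ?b x y)" for x
    by (intro integral_mono integrable_norm * ib bd)
  also have "(LBINT y. ?b x y) = C * (M * (LBINT y. ?R y) + (LBINT y. \<bar>f y\<bar>))" for x
    using iR[of x] integrable_bounded_density[OF f] lborel_integral_reflect[of ?R x] by simp
  finally show "\<exists>B. \<forall>x. (LBINT y. norm (f y *\<^sub>R k (x - y))) \<le> B" by blast
qed

lemma weakly_singular_reflect:
  assumes "weakly_singular k" shows "weakly_singular (\<lambda>z. k (- z))"
proof -
  have "(\<lambda>z. k (- z)) \<in> borel_measurable borel"
    using weakly_singular_measurable[OF assms] by measurable
  moreover obtain C where C: "\<And>z. norm (k z) \<le> C * (riesz z * indicator (ball 0 1) z + 1)"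
    using assms by (auto simp: weakly_singular_def)
  have "norm (k (- z)) \<le> C * (riesz z * indicator (ball 0 1) z + 1)" for z
    using C[of "- z"] by (simp add: indicator_def)
  ultimately show ?thesis by (auto simp: weakly_singular_def)
qed

text \<open>
  Licenses the exchange of integrations in double integrals with a kernel. One factor must be bounded with bounded support,
  but the other may be merely integrable: \<open>L\<^sup>2\<close> solutions enter in that place.
\<close>
lemma integrable_pair_kernel:
  fixes k :: "'a::euclidean_space \<Rightarrow> real"
  assumes p: "bounded_density p" and q: "integrable lborel q" and k: "weakly_singular k"
  shows "integrable (lborel \<Otimes>\<^sub>M lborel) (\<lambda>(y, x). q y * p x * k (x - y))"
proof -
  note [measurable] = weakly_singular_measurable[OF k] bounded_density_measurable[OF p]
  have [measurable]: "q \<in> borel_measurable borel" using q by auto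
  have k': "weakly_singular (\<lambda>z. k (- z))" by (rule weakly_singular_reflect[OF k])
  have ip: "integrable lborel (\<lambda>x. p x * k (x - y))" for y
    using integrable_norm_conv_kernel(1)[OF p k', of y] by simp
  obtain B where B: "(LBINT x. \<bar>p x * k (x - y)\<bar>) \<le> B" for y
    using integrable_norm_conv_kernel(2)[OF p k'] by auto
  show ?thesis
  proof (rule lborel_pair.Fubini_integrable)
    show "(\<lambda>(y, x). q y * p x * k (x - y)) \<in> borel_measurable (lborel \<Otimes>\<^sub>M lborel)" by measurable
    have "integrable lborel (\<lambda>y. LBINT x. \<bar>q y\<bar> * \<bar>p x * k (x - y)\<bar>)"
    proof (rule Bochner_Integration.integrable_bound)
      show "integrable lborel (\<lambda>y. B * q y)" using q by simp
      show "(\<lambda>y. LBINT x. \<bar>q y\<bar> * \<bar>p x * k (x - y)\<bar>) \<in> borel_measurable lborel" by measurable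
      have "norm (LBINT x. \<bar>q y\<bar> * \<bar>p x * k (x - y)\<bar>) \<le> norm (B * q y)" for y
      proof -
        have "0 \<le> (LBINT x. \<bar>p x * k (x - y)\<bar>)" by simp
        then show ?thesis using B[of y]
          by (auto simp: abs_mult mult.commute[of "\<bar>B\<bar>"] intro!: mult_left_mono)
      qed
      then show "AE y in lborel. norm (LBINT x. \<bar>q y\<bar> * \<bar>p x * k (x - y)\<bar>) \<le> norm (B * q y)" by simp
    qed
    then show "integrable lborel (\<lambda>y. LBINT x. norm (case (y, x) of (y, x) \<Rightarrow> q y * p x * k (x - y)))"
      by (simp add: abs_mult mult.assoc)
    have "integrable lborel (\<lambda>x. q y * (p x * k (x - y)))" for y
      by (rule integrable_mult_right[OF ip])
    then show "AE y in lborel. integrable lborel (\<lambda>x. case (y, x) of (y, x) \<Rightarrow> q y * p x * k (x - y))"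
      by (simp add: mult.assoc)
  qed
qed

text \<open>
  The bound is proportional to the radius \<open>r\<close> of the support of the kernel and uniform in \<open>x\<close>; this is
  the quantitative form of uniform convergence of the regularised potentials.
\<close>
lemma norm_conv_local_kernel_le:
  fixes k :: "'a::euclidean_space \<Rightarrow> 'b::{banach, second_countable_topology}"
  assumes f: "f \<in> borel_measurable borel" "\<And>x. \<bar>f x\<bar> \<le> M" and k: "k \<in> borel_measurable borel"
    and r: "r > 0" and bd: "\<And>z. z \<noteq> 0 \<Longrightarrow> norm (k z) \<le> C * (riesz z * indicator (ball 0 r) z)" 
  shows "norm (conv f k x) \<le> M * C * (unit_sphere_area DIM('a) * r)"
proof -
  note [measurable] = f(1) k
  have M: "M \<ge> 0" using f(2)[of undefined] by linarith
  obtain z0 :: 'a where z0: "z0 \<in> ball 0 r" "z0 \<noteq> 0"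
  proof -
    obtain b :: 'a where "b \<in> Basis" using nonempty_Basis by blast
    then show thesis using r by (intro that[of "(r/2) *\<^sub>R b"]) auto
  qed
  then have "riesz z0 * indicator (ball 0 r) z0 > 0" by (simp add: riesz_def)
  then have C: "C \<ge> 0" using order_trans[OF norm_ge_zero bd[OF z0(2)]] by (simp add: zero_le_mult_iff)
  let ?R = "\<lambda>z::'a. riesz z * indicator (ball 0 r) z"
  have iR: "integrable lborel (\<lambda>y. M * C * ?R (x - y))"
    by (intro integrable_mult_right lborel_integrable_reflect integrable_riesz_ball r)
  have "AE y in lborel. y \<noteq> x" by (rule AE_lborel_singleton)
  then have bd': "AE y in lborel. norm (f y *\<^sub>R k (x - y)) \<le> M * C * ?R (x - y)"
  proof eventually_elim
    case (elim y)
    then have "x - y \<noteq> 0" by simp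
    from mult_mono[OF f(2)[of y] bd[OF this]] show ?case using M by (simp add: mult.assoc)
  qed
  have "integrable lborel (\<lambda>y. f y *\<^sub>R k (x - y))"
  proof (rule Bochner_Integration.integrable_bound[OF iR])
    show "AE y in lborel. norm (f y *\<^sub>R k (x - y)) \<le> norm (M * C * ?R (x - y))"
      using bd' by eventually_elim (auto intro: order_trans[OF _ abs_ge_self])
  qed measurable
  then have "norm (conv f k x) \<le> (LBINT y. M * C * ?R (x - y))"
    by (intro order_trans[OF integral_norm_bound] integral_mono_AE integrable_norm iR bd')
  also have "\<dots> = M * C * (LBINT z. ?R z)"
    using lborel_integral_reflect[of ?R x] by simp
  also have "\<dots> \<le> M * C * (unit_sphere_area DIM('a) * r)"
    using M C by (intro mult_left_mono integral_riesz_ball_le r) auto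
  finally show ?thesis .
qed

section \<open>The Newtonian kernel and its regularisation\<close>

text \<open>
  The negative of the fundamental solution, in a form that shows its sign.
\<close>
definition newton :: "'a::euclidean_space \<Rightarrow> real" where
  "newton z = inverse ((real DIM('a) - 2) * unit_sphere_area DIM('a)) * inverse (norm z ^ (DIM('a) - 2))"

definition newton_grad :: "'a::euclidean_space \<Rightarrow> 'a" where
  "newton_grad z = (- inverse (unit_sphere_area DIM('a) * norm z ^ DIM('a))) *\<^sub>R z"

text \<open>
  A \<open>C\<^sup>2\<close> modification of \<open>s = |z|\<^sup>2\<close> that is unchanged for \<open>s \<ge> r\<^sup>2\<close> and stays positive at \<open>s = 0\<close>. The
  third power is the least one for which two derivatives are continuous.
\<close>
definition smooth_sq :: "real \<Rightarrow> real \<Rightarrow> real" where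
  "smooth_sq r s = s + (max 0 (r\<^sup>2 - s)) ^ 3"

definition smooth_sq' :: "real \<Rightarrow> real \<Rightarrow> real" where
  "smooth_sq' r s = 1 - 3 * (max 0 (r\<^sup>2 - s)) ^ 2"

text \<open>
  \<open>K\<close> with \<open>|z|\<^sup>2\<close> replaced by its modification.
\<close>
definition newton_reg :: "real \<Rightarrow> 'a::euclidean_space \<Rightarrow> real" where
  "newton_reg r z = inverse ((real DIM('a) - 2) * unit_sphere_area DIM('a)) *
     smooth_sq r (z \<bullet> z) powr (- (real DIM('a) - 2) / 2)"

definition newton_reg_coeff :: "nat \<Rightarrow> real \<Rightarrow> real \<Rightarrow> real" where
  "newton_reg_coeff m r s = - inverse (unit_sphere_area m) * smooth_sq' r s * smooth_sq r s powr (- real m / 2)"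

definition newton_reg_coeff' :: "nat \<Rightarrow> real \<Rightarrow> real \<Rightarrow> real" where
  "newton_reg_coeff' m r s = - inverse (unit_sphere_area m) *
     (6 * max 0 (r\<^sup>2 - s) * smooth_sq r s powr (- real m / 2)
      + smooth_sq' r s * ((- real m / 2) * smooth_sq r s powr (- real m / 2 - 1) * smooth_sq' r s))"

definition newton_reg_grad :: "real \<Rightarrow> 'a::euclidean_space \<Rightarrow> 'a" where
  "newton_reg_grad r z = newton_reg_coeff DIM('a) r (z \<bullet> z) *\<^sub>R z"

text \<open>
  The row of the Hessian matrix that belongs to the direction \<open>b\<close>: the gradient of
  \<open>newton_reg_grad r z \<bullet> b\<close>.
\<close>
definition newton_reg_hess :: "real \<Rightarrow> 'a::euclidean_space \<Rightarrow> 'a \<Rightarrow> 'a" where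
  "newton_reg_hess r b z = (2 * newton_reg_coeff' DIM('a) r (z \<bullet> z) * (z \<bullet> b)) *\<^sub>R z
      + newton_reg_coeff DIM('a) r (z \<bullet> z) *\<^sub>R b"

text \<open>
  Powers of the positive part serve as smooth cut-offs that can be differentiated explicitly.
\<close>
lemma DERIV_max_power:
  "((\<lambda>s::real. (max 0 s) ^ Suc (Suc k)) has_real_derivative real (Suc (Suc k)) * (max 0 s) ^ Suc k) (at s)"
proof (rule linorder_cases[of s 0])
  assume s: "s < 0"
  have "((\<lambda>s::real. 0) has_real_derivative 0) (at s)" by simp
  then have "((\<lambda>s::real. (max 0 s) ^ Suc (Suc k)) has_real_derivative 0) (at s)"
    by (rule has_field_derivative_transform_within_open[of _ _ _ "{..<0}"]) (use s in auto)
  then show ?thesis using s by simp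
next
  assume s: "s > 0"
  have "((\<lambda>s::real. s ^ Suc (Suc k)) has_real_derivative real (Suc (Suc k)) * s ^ Suc k) (at s)"
    using DERIV_pow[of "Suc (Suc k)" s] by simp
  then have "((\<lambda>s::real. (max 0 s) ^ Suc (Suc k)) has_real_derivative real (Suc (Suc k)) * s ^ Suc k) (at s)"
    by (rule has_field_derivative_transform_within_open[of _ _ _ "{0<..}"]) (use s in auto)
  then show ?thesis using s by simp
next
  assume s: "s = 0"
  have "((\<lambda>h::real. (max 0 h) ^ Suc k) \<longlongrightarrow> (max 0 0) ^ Suc k) (at 0)"
    by (intro tendsto_intros)
  then have "((\<lambda>h::real. (max 0 h) ^ Suc k) \<longlongrightarrow> 0) (at 0)" by simp
  then have "((\<lambda>h::real. ((max 0 h) ^ Suc (Suc k)) / h) \<longlongrightarrow> 0) (at 0)"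
    by (rule Lim_transform_eventually) (intro always_eventually allI, auto simp: max_def)
  then show ?thesis using s by (simp add: DERIV_def)
qed

lemma smooth_sq_ge: "s \<le> smooth_sq r s"
  by (simp add: smooth_sq_def)

lemma smooth_sq_pos: "0 \<le> s \<Longrightarrow> r > 0 \<Longrightarrow> 0 < smooth_sq r s"
  by (cases "s = 0") (auto simp: smooth_sq_def intro: add_pos_nonneg)

lemma smooth_sq_eq: "r\<^sup>2 \<le> s \<Longrightarrow> smooth_sq r s = s" "r\<^sup>2 \<le> s \<Longrightarrow> smooth_sq' r s = 1"
  by (simp_all add: smooth_sq_def smooth_sq'_def)

lemma smooth_sq'_bounds:
  assumes "0 \<le> s" "0 < r" "r \<le> 1/2"
  shows "\<bar>smooth_sq' r s\<bar> \<le> 1"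
proof -
  \<comment> \<open>a radius of at most 1/2 keeps the subtracted term below 2, hence the derivative above -1\<close>
  have "r\<^sup>2 \<le> (1/2)\<^sup>2" using assms by (intro power_mono) auto
  then have "max 0 (r\<^sup>2 - s) \<le> 1/2" using assms by (auto simp: power2_eq_square max_def)
  then have "(max 0 (r\<^sup>2 - s))\<^sup>2 \<le> (1/2)\<^sup>2" by (intro power_mono) auto
  then show ?thesis unfolding smooth_sq'_def by (auto simp: power2_eq_square abs_le_iff)
qed

lemma DERIV_smooth_sq: "(smooth_sq r has_real_derivative smooth_sq' r s) (at s)"
proof -
  have "((\<lambda>s. (max 0 (r\<^sup>2 - s)) ^ Suc (Suc 1)) has_real_derivative (real (Suc (Suc 1)) * (max 0 (r\<^sup>2 - s)) ^ Suc 1) * (- 1)) (at s)"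
    by (rule DERIV_chain2[OF DERIV_max_power]) (auto intro!: derivative_eq_intros)
  then have "((\<lambda>s. (max 0 (r\<^sup>2 - s)) ^ 3) has_real_derivative - (3 * (max 0 (r\<^sup>2 - s))\<^sup>2)) (at s)"
    by (simp add: numeral_eq_Suc)
  from DERIV_add[OF DERIV_ident this] show ?thesis
    unfolding smooth_sq_def[abs_def] smooth_sq'_def by simp
qed

lemma DERIV_smooth_sq': "(smooth_sq' r has_real_derivative 6 * max 0 (r\<^sup>2 - s)) (at s)"
proof -
  have "((\<lambda>s. (max 0 (r\<^sup>2 - s)) ^ Suc (Suc 0)) has_real_derivative (real (Suc (Suc 0)) * (max 0 (r\<^sup>2 - s)) ^ Suc 0) * (- 1)) (at s)"
    by (rule DERIV_chain2[OF DERIV_max_power]) (auto intro!: derivative_eq_intros)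
  then have "((\<lambda>s. (max 0 (r\<^sup>2 - s)) ^ 2) has_real_derivative - (2 * max 0 (r\<^sup>2 - s))) (at s)"
    by (simp add: numeral_eq_Suc)
  from DERIV_diff[OF DERIV_const DERIV_cmult[OF this, of 3], of 1] show ?thesis
    unfolding smooth_sq'_def[abs_def] by simp
qed

lemma DERIV_smooth_sq_powr:
  assumes "s \<ge> 0" "r > 0"
  shows "((\<lambda>s. smooth_sq r s powr p) has_real_derivative p * smooth_sq r s powr (p - 1) * smooth_sq' r s) (at s)"
  using DERIV_powr[OF DERIV_smooth_sq smooth_sq_pos[OF assms] DERIV_const] smooth_sq_pos[OF assms]
  by (simp add: powr_diff field_simps)

lemma DERIV_newton_reg_coeff:
  assumes "s \<ge> 0" "r > 0"
  shows "(newton_reg_coeff m r has_real_derivative newton_reg_coeff' m r s) (at s)"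
  unfolding newton_reg_coeff_def[abs_def] newton_reg_coeff'_def mult.assoc
  by (rule DERIV_cmult) (use DERIV_mult[OF DERIV_smooth_sq'[of r s] DERIV_smooth_sq_powr[OF assms, of "- real m / 2"]] in \<open>simp add: mult_ac\<close>)

lemma has_derivative_radial:
  fixes z :: "'a::euclidean_space"
  assumes "(g has_real_derivative g') (at (z \<bullet> z))"
  shows "((\<lambda>z. g (z \<bullet> z)) has_derivative (\<lambda>h. (2 * g') * (z \<bullet> h))) (at z)"
proof -
  have "((\<lambda>z::'a. z \<bullet> z) has_derivative (\<lambda>h. z \<bullet> h + h \<bullet> z)) (at z)"
    by (intro derivative_eq_intros) auto
  from has_derivative_compose[OF this assms[unfolded has_field_derivative_def]]
  show ?thesis by (simp add: inner_commute algebra_simps)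
qed

lemma powr_neg_half:
  fixes a :: real assumes "a > 0"
  shows "(a * a) powr (- real k / 2) = inverse (a ^ k)"
proof -
  have "(a * a) powr (- real k / 2) = (a powr 2) powr (- real k / 2)"
    using assms by (simp add: powr_numeral power2_eq_square)
  also have "\<dots> = a powr (2 * (- real k / 2))" by (rule powr_powr)
  also have "2 * (- real k / 2) = - real k" by simp
  also have "a powr (- real k) = inverse (a ^ k)"
    using assms by (simp add: powr_minus powr_realpow)
  finally show ?thesis .
qed

lemma continuous_on_newton_reg_coeff:
  assumes "r > 0"
  shows "continuous_on {0..} (newton_reg_coeff m r)" "continuous_on {0..} (newton_reg_coeff' m r)"
proof -
  have 1: "continuous_on {0..} (smooth_sq r)" "continuous_on {0..} (smooth_sq' r)"
    by (intro continuous_at_imp_continuous_on ballI DERIV_isCont[OF DERIV_smooth_sq] DERIV_isCont[OF DERIV_smooth_sq'])+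
  have 2: "continuous_on {0..} (\<lambda>s. smooth_sq r s powr p)" for p
    by (intro continuous_on_powr 1 continuous_on_const) (use smooth_sq_pos[OF _ assms] in \<open>force simp: less_le\<close>)
  have 3: "continuous_on {0..} (\<lambda>s. 6 * max 0 (r\<^sup>2 - s))"
    by (intro continuous_intros)
  show "continuous_on {0..} (newton_reg_coeff m r)"
    unfolding newton_reg_coeff_def[abs_def] by (intro continuous_on_mult continuous_on_const 1 2)
  show "continuous_on {0..} (newton_reg_coeff' m r)"
    unfolding newton_reg_coeff'_def[abs_def] 
    by (intro continuous_on_mult continuous_on_add continuous_on_const 1 2 3)
qed

lemma continuous_on_radial:
  "continuous_on {0..} g \<Longrightarrow> continuous_on UNIV (\<lambda>z::'a::euclidean_space. g (z \<bullet> z) :: real)"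
  by (rule continuous_on_compose2[of _ g]) (auto intro: continuous_on_inner continuous_on_id)

text \<open>
  The dimension enters through a type, which the argument of the locale names.
\<close>
locale dim_ge_3 =
  fixes ty :: "'a::euclidean_space itself"
  assumes dim: "DIM('a) \<ge> 3"

context dim_ge_3
begin

lemma sphere_area_pos: "unit_sphere_area DIM('a) > 0"
  using dim by (intro unit_sphere_area_pos) auto

lemma riesz_zero: "riesz (0::'a) = 0"
  using dim by (simp add: riesz_def)

lemma norm_newton_grad:
  "norm (newton_grad (z::'a)) = inverse (unit_sphere_area DIM('a)) * riesz z"
proof (cases "z = 0")
  case False
  obtain n where n: "DIM('a) = Suc n" using DIM_positive[where 'a='a] gr0_implies_Suc by blast
  then show ?thesis using False sphere_area_pos by (simp add: newton_grad_def riesz_def field_simps)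
qed (simp add: newton_grad_def riesz_zero)

lemma newton_nonneg: "0 \<le> newton (z::'a)"
  using dim sphere_area_pos by (simp add: newton_def)

lemma newton_zero: "newton (0::'a) = 0"
  using dim by (simp add: newton_def)

text \<open>
  On small balls the kernel is smaller than its gradient by a factor of the radius.
\<close>
lemma newton_le: "newton z \<le> inverse (unit_sphere_area DIM('a)) * (norm z * riesz (z::'a))"
proof (cases "z = 0")
  case False
  obtain n where n: "DIM('a) = Suc (Suc n)" "n \<ge> 1"
    using dim by (metis Suc_le_D Suc_le_mono numeral_3_eq_3 One_nat_def)
  have "inverse (real n) \<le> 1" using n by (simp add: field_simps)
  then have "inverse (real n) * (inverse (unit_sphere_area DIM('a)) * inverse (norm z ^ n))
      \<le> 1 * (inverse (unit_sphere_area DIM('a)) * inverse (norm z ^ n))"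
    using sphere_area_pos by (intro mult_right_mono) auto
  moreover have "norm z * riesz z = inverse (norm z ^ n)"
    using False by (simp add: riesz_def n)
  ultimately show ?thesis by (simp add: newton_def n)
qed (simp add: newton_zero)

lemma newton_reg_pos: "0 \<le> newton_reg r (z::'a)"
  using dim sphere_area_pos by (simp add: newton_reg_def)

lemma newton_powr: "z \<noteq> 0 \<Longrightarrow> newton (z::'a) = inverse ((real DIM('a) - 2) * unit_sphere_area DIM('a)) *
     (z \<bullet> z) powr (- (real DIM('a) - 2) / 2)"
  using powr_neg_half[of "norm z" "DIM('a) - 2"] dim
  by (simp add: newton_def norm_eq_sqrt_inner of_nat_diff)

lemma newton_grad_powr: "z \<noteq> 0 \<Longrightarrow> newton_grad (z::'a) =
    (- inverse (unit_sphere_area DIM('a)) * (z \<bullet> z) powr (- real DIM('a) / 2)) *\<^sub>R z"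
  using powr_neg_half[of "norm z" "DIM('a)"] dim
  by (simp add: newton_grad_def norm_eq_sqrt_inner)

text \<open>
  Exact equality away from the origin (and not mere closeness) makes the difference of the two kernels
  supported in a small ball, which \<open>potential_C2\<close> exploits.
\<close>
lemma newton_reg_eq:
  assumes "r > 0" "r \<le> norm (z::'a)"
  shows "newton_reg r z = newton z" "newton_reg_grad r z = newton_grad z"
proof -
  have z: "z \<noteq> 0" using assms by auto
  have "r\<^sup>2 \<le> z \<bullet> z" using assms by (simp add: power_mono power2_norm_eq_inner[symmetric])
  then show "newton_reg r z = newton z" "newton_reg_grad r z = newton_grad z"
    by (simp_all add: newton_reg_def newton_powr[OF z] newton_reg_grad_def newton_grad_powr[OF z]
       newton_reg_coeff_def smooth_sq_eq)
qed

lemma newton_reg_le: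
  assumes "z \<noteq> 0" "r > 0" shows "newton_reg r z \<le> newton (z::'a)"
  unfolding newton_reg_def newton_powr[OF assms(1)]
  using dim sphere_area_pos assms
  by (intro mult_left_mono powr_mono2' smooth_sq_ge) auto

text \<open>
  The regularised square dominates the square itself, and its derivative is at most 1 in absolute value.
\<close>
lemma norm_newton_reg_grad_le:
  assumes "0 < r" "r \<le> 1/2"
  shows "norm (newton_reg_grad r (z::'a)) \<le> norm (newton_grad z)"
proof (cases "z = 0")
  case False
  have "\<bar>smooth_sq' r (z \<bullet> z)\<bar> * smooth_sq r (z \<bullet> z) powr (- real DIM('a) / 2)
     \<le> 1 * (z \<bullet> z) powr (- real DIM('a) / 2)"
    using assms False
    by (intro mult_mono smooth_sq'_bounds powr_mono2' smooth_sq_ge) auto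
  then have "inverse (unit_sphere_area DIM('a)) * (\<bar>smooth_sq' r (z \<bullet> z)\<bar> * smooth_sq r (z \<bullet> z) powr (- real DIM('a) / 2)) * norm z
     \<le> inverse (unit_sphere_area DIM('a)) * (z \<bullet> z) powr (- real DIM('a) / 2) * norm z"
    using sphere_area_pos by (intro mult_right_mono mult_left_mono) auto
  then show ?thesis using sphere_area_pos
    by (simp add: newton_reg_grad_def newton_grad_powr[OF False] newton_reg_coeff_def abs_mult)
qed (simp add: newton_reg_grad_def)

lemma newton_reg_has_derivative:
  assumes "r > 0"
  shows "(newton_reg r has_derivative (\<lambda>h. newton_reg_grad r z \<bullet> h)) (at (z::'a))"
proof -
  let ?p = "- (real DIM('a) - 2) / 2"
  let ?c = "inverse ((real DIM('a) - 2) * unit_sphere_area DIM('a))"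
  have "((\<lambda>s. ?c * smooth_sq r s powr ?p) has_real_derivative
      ?c * (?p * smooth_sq r (z \<bullet> z) powr (?p - 1) * smooth_sq' r (z \<bullet> z))) (at (z \<bullet> z))"
    by (rule DERIV_cmult[OF DERIV_smooth_sq_powr]) (use assms in auto)
  from has_derivative_radial[OF this]
  have "(newton_reg r has_derivative
    (\<lambda>h. (2 * (?c * (?p * smooth_sq r (z \<bullet> z) powr (?p - 1) * smooth_sq' r (z \<bullet> z)))) * (z \<bullet> h))) (at z)"
    unfolding newton_reg_def[abs_def] .
  moreover have "2 * (?c * (?p * smooth_sq r (z \<bullet> z) powr (?p - 1) * smooth_sq' r (z \<bullet> z)))
      = newton_reg_coeff DIM('a) r (z \<bullet> z)"
  proof -
    have e: "?p - 1 = - real DIM('a) / 2" by (simp add: field_simps)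
    have X: "2 * (inverse (A * w) * (- A / 2 * X * Y)) = - inverse w * Y * X"
      if "A \<noteq> 0" "w \<noteq> 0" for A w X Y :: real
      using that by (simp add: field_simps)
    then show ?thesis unfolding newton_reg_coeff_def e by (intro X) (use dim sphere_area_pos in auto)
  qed
  ultimately show ?thesis unfolding newton_reg_grad_def inner_scaleR_left by (simp only:)
qed

lemma newton_reg_grad_has_derivative:
  assumes "r > 0"
  shows "((\<lambda>z. newton_reg_grad r z \<bullet> b) has_derivative (\<lambda>h. newton_reg_hess r b z \<bullet> h)) (at (z::'a))"
proof -
  let ?c = "newton_reg_coeff DIM('a) r (z \<bullet> z)" and ?c' = "newton_reg_coeff' DIM('a) r (z \<bullet> z)"
  have "(newton_reg_coeff DIM('a) r has_real_derivative ?c') (at (z \<bullet> z))"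
    by (rule DERIV_newton_reg_coeff) (use assms in auto)
  from has_derivative_radial[OF this]
  have "((\<lambda>z. newton_reg_coeff DIM('a) r (z \<bullet> z)) has_derivative (\<lambda>h. (2 * ?c') * (z \<bullet> h))) (at z)" .
  from has_derivative_mult[OF this bounded_linear_imp_has_derivative[OF bounded_linear_inner_left, of b]]
  have "((\<lambda>z. newton_reg_grad r z \<bullet> b) has_derivative (\<lambda>h. ?c * (h \<bullet> b) + (2 * ?c') * (z \<bullet> h) * (z \<bullet> b))) (at z)"
    unfolding newton_reg_grad_def inner_scaleR_left .
  moreover have "(\<lambda>h. ?c * (h \<bullet> b) + (2 * ?c') * (z \<bullet> h) * (z \<bullet> b)) = (\<lambda>h. newton_reg_hess r b z \<bullet> h)"
    by (rule ext) (simp add: newton_reg_hess_def inner_add_left inner_commute[of b] mult_ac)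
  ultimately show ?thesis by (simp only:)
qed

lemma continuous_on_newton_reg_grad: "r > 0 \<Longrightarrow> continuous_on UNIV (newton_reg_grad r :: 'a \<Rightarrow> 'a)"
  unfolding newton_reg_grad_def[abs_def]
  by (intro continuous_on_scaleR continuous_on_radial continuous_on_newton_reg_coeff continuous_on_id)

lemma continuous_on_newton_reg_hess: "r > 0 \<Longrightarrow> continuous_on UNIV (newton_reg_hess r b :: 'a \<Rightarrow> 'a)"
  unfolding newton_reg_hess_def[abs_def]
  by (intro continuous_on_add continuous_on_scaleR continuous_on_mult continuous_on_inner
       continuous_on_radial continuous_on_newton_reg_coeff continuous_on_id continuous_on_const)

lemma continuous_on_newton_reg: "r > 0 \<Longrightarrow> continuous_on UNIV (newton_reg r :: 'a \<Rightarrow> real)"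
  by (intro continuous_at_imp_continuous_on ballI has_derivative_continuous[OF newton_reg_has_derivative])

lemma borel_measurable_newton: "newton \<in> borel_measurable (borel :: 'a measure)"
  unfolding newton_def by measurable

lemma borel_measurable_newton_grad: "newton_grad \<in> borel_measurable (borel :: 'a measure)"
  unfolding newton_grad_def by measurable

lemma weakly_singular_newton: "weakly_singular (newton :: 'a \<Rightarrow> real)"
  unfolding weakly_singular_def
proof (intro conjI exI allI)
  show "newton \<in> borel_measurable (borel :: 'a measure)" by (rule borel_measurable_newton)
  fix z :: 'a
  let ?w = "inverse (unit_sphere_area DIM('a))"
  have w: "?w > 0" using sphere_area_pos by simp
  have "norm z * riesz z \<le> riesz z * indicator (ball 0 1) z + 1"
  proof (cases "norm z < 1")
    case True
    then have "norm z * riesz z \<le> 1 * riesz z" by (intro mult_right_mono) auto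
    then show ?thesis using True by simp
  next
    case False
    define n where "n = DIM('a) - 2"
    have n: "DIM('a) = Suc (Suc n)" using dim by (simp add: n_def)
    have "z \<noteq> 0" using False by auto
    then have "norm z * riesz z = inverse (norm z ^ n)"
      by (simp add: riesz_def n)
    also have "\<dots> \<le> 1" using False by (simp add: inverse_le_1_iff one_le_power)
    finally show ?thesis using False by simp
  qed
  then have "?w * (norm z * riesz z) \<le> ?w * (riesz z * indicator (ball 0 1) z + 1)"
    using w by (intro mult_left_mono) auto
  then show "norm (newton z) \<le> ?w * (riesz z * indicator (ball 0 1) z + 1)"
    using newton_le[of z] newton_nonneg[of z] by simp
qed

lemma weakly_singular_newton_grad: "weakly_singular (newton_grad :: 'a \<Rightarrow> 'a)"
  unfolding weakly_singular_def
proof (intro conjI exI allI)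
  show "newton_grad \<in> borel_measurable (borel :: 'a measure)" by (rule borel_measurable_newton_grad)
  fix z :: 'a
  let ?w = "inverse (unit_sphere_area DIM('a))"
  have "riesz z \<le> riesz z * indicator (ball 0 1) z + 1"
  proof (cases "norm z < 1")
    case False
    then have "1 \<le> norm z ^ (DIM('a) - 1)" by (intro one_le_power) simp
    then have "riesz z \<le> 1" unfolding riesz_def by (rule inverse_le_1_iff[THEN iffD2, OF disjI2])
    then show ?thesis using False by simp
  qed simp
  then show "norm (newton_grad z) \<le> ?w * (riesz z * indicator (ball 0 1) z + 1)"
    unfolding norm_newton_grad using sphere_area_pos by (intro mult_left_mono) auto
qed

end

section \<open>First derivatives of the Newtonian potential\<close>

definition potential :: "('a::euclidean_space \<Rightarrow> real) \<Rightarrow> 'a \<Rightarrow> real" where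
  "potential f x = (LBINT y. f y * newton (x - y))"

definition potential_grad :: "('a::euclidean_space \<Rightarrow> real) \<Rightarrow> 'a \<Rightarrow> 'a" where
  "potential_grad f x = conv f newton_grad x"

lemma continuous_bounded_on_ball:
  fixes F :: "'a::euclidean_space \<Rightarrow> 'b::real_normed_vector"
  assumes "continuous_on UNIV F"
  shows "\<exists>B. \<forall>z\<in>ball c R. norm (F z) \<le> B"
proof -
  have "compact (F ` cball c R)"
    using continuous_on_subset[OF assms] by (intro compact_continuous_image) auto
  then obtain B where "\<And>y. y \<in> F ` cball c R \<Longrightarrow> norm y \<le> B"
    using compact_imp_bounded bounded_iff by metis
  then show ?thesis by (intro exI[of _ B]) auto
qed

context dim_ge_3
begin

lemma newton_reg_diff_le:
  assumes "0 < r" "r \<le> 1/2" "z \<noteq> 0"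
  shows "\<bar>newton_reg r (z::'a) - newton z\<bar> \<le> inverse (unit_sphere_area DIM('a)) * (riesz z * indicator (ball 0 r) z)"
proof (cases "norm z < r")
  case True
  have "\<bar>newton_reg r z - newton z\<bar> \<le> newton z"
    using newton_reg_le[OF assms(3,1)] newton_reg_pos[of r z] by simp
  also have "\<dots> \<le> inverse (unit_sphere_area DIM('a)) * (norm z * riesz z)" by (rule newton_le)
  also have "\<dots> \<le> inverse (unit_sphere_area DIM('a)) * (1 * riesz z)"
    using True assms sphere_area_pos by (intro mult_left_mono mult_right_mono) auto
  finally show ?thesis using True by simp
qed (simp add: newton_reg_eq[OF assms(1)])

lemma newton_reg_grad_diff_le:
  assumes "0 < r" "r \<le> 1/2"
  shows "norm (newton_reg_grad r (z::'a) - newton_grad z) \<le> 2 * inverse (unit_sphere_area DIM('a)) * (riesz z * indicator (ball 0 r) z)"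
proof (cases "norm z < r")
  case True
  have "norm (newton_reg_grad r z - newton_grad z) \<le> norm (newton_reg_grad r z) + norm (newton_grad z)"
    by (rule norm_triangle_ineq4)
  also have "\<dots> \<le> 2 * norm (newton_grad z)" using norm_newton_reg_grad_le[OF assms, of z] by simp
  finally show ?thesis using True by (simp add: norm_newton_grad)
qed (simp add: newton_reg_eq[OF assms(1)])

lemma conv_newton_reg:
  assumes f: "bounded_density f" and r: "r > 0"
  shows "((\<lambda>x. LBINT y. f y * newton_reg r (x - y)) has_derivative
           (\<lambda>h. conv f (newton_reg_grad r) x \<bullet> h)) (at (x::'a))"
    and "((\<lambda>x. conv f (newton_reg_grad r) x \<bullet> b) has_derivative
           (\<lambda>h. conv f (newton_reg_hess r b) x \<bullet> h)) (at x)"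
    and "isCont (conv f (newton_reg_grad r)) x"
    and "isCont (conv f (newton_reg_hess r b)) x"
    and "integrable lborel (\<lambda>y. f y * newton_reg r (x - y))"
    and "integrable lborel (\<lambda>y. f y *\<^sub>R newton_reg_grad r (x - y))"
proof -
  obtain M \<rho> where fM: "f \<in> borel_measurable borel" "M > 0" "\<rho> > 0" "\<And>x. \<bar>f x\<bar> \<le> M" "\<And>x. norm x > \<rho> \<Longrightarrow> f x = 0"
    using f by (rule bounded_densityE) blast
  note int = integrable_bounded_density[OF f]
  note c = continuous_on_newton_reg[OF r] continuous_on_newton_reg_grad[OF r] continuous_on_newton_reg_hess[OF r, of b]
  note m = borel_measurable_continuous_onI[OF c(1)] borel_measurable_continuous_onI[OF c(2)] borel_measurable_continuous_onI[OF c(3)]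
  have x: "x \<in> ball x 1" by simp
  obtain B1 where B1: "\<And>z. z \<in> ball x (1 + \<rho>) \<Longrightarrow> norm (newton_reg r z) \<le> B1"
    using continuous_bounded_on_ball[OF c(1)] by metis
  obtain B2 where B2: "\<And>z. z \<in> ball x (1 + \<rho>) \<Longrightarrow> norm (newton_reg_grad r z) \<le> B2"
    using continuous_bounded_on_ball[OF c(2)] by metis
  obtain B3 where B3: "\<And>z. z \<in> ball x (1 + \<rho>) \<Longrightarrow> norm (newton_reg_hess r b z) \<le> B3"
    using continuous_bounded_on_ball[OF c(3)] by metis
  have cb: "continuous_on UNIV (\<lambda>z. newton_reg_grad r z \<bullet> b)"
    by (intro continuous_on_inner c continuous_on_const)
  obtain B4 where B4: "\<And>z. z \<in> ball x (1 + \<rho>) \<Longrightarrow> norm (newton_reg_grad r z \<bullet> b) \<le> B4"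
    using continuous_bounded_on_ball[OF cb] by metis
  define B where "B = max (max B1 B2) (max B3 B4)"
  show "((\<lambda>x. LBINT y. f y * newton_reg r (x - y)) has_derivative
           (\<lambda>h. conv f (newton_reg_grad r) x \<bullet> h)) (at x)"
    by (rule conv_has_gradient[OF int m(1,2) fM(5) newton_reg_has_derivative[OF r] _ _ x, of \<rho> B])
       (use B1 B2 in \<open>fastforce simp: B_def le_max_iff_disj\<close>)+
  show i: "integrable lborel (\<lambda>y. f y *\<^sub>R newton_reg_grad r (x - y))"
    by (rule integrable_conv[OF int m(2) fM(5) B2 x])
  have "((\<lambda>x. LBINT y. f y * (newton_reg_grad r (x - y) \<bullet> b)) has_derivative
           (\<lambda>h. conv f (newton_reg_hess r b) x \<bullet> h)) (at x)"
    by (rule conv_has_gradient[OF int borel_measurable_continuous_onI[OF cb] m(3) fM(5) newton_reg_grad_has_derivative[OF r] _ _ x, of \<rho> B])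
       (use B3 B4 in \<open>fastforce simp: B_def le_max_iff_disj\<close>)+
  moreover have "(\<lambda>x. LBINT y. f y * (newton_reg_grad r (x - y) \<bullet> b)) = (\<lambda>x. conv f (newton_reg_grad r) x \<bullet> b)"
  proof
    fix x :: 'a
    obtain B5 where B5: "\<And>z. z \<in> ball x (1 + \<rho>) \<Longrightarrow> norm (newton_reg_grad r z) \<le> B5"
      using continuous_bounded_on_ball[OF c(2)] by metis
    have "integrable lborel (\<lambda>y. f y *\<^sub>R newton_reg_grad r (x - y))"
      by (rule integrable_conv[OF int m(2) fM(5) B5]) auto
    from integral_inner_left[OF this, of b]
    show "(LBINT y. f y * (newton_reg_grad r (x - y) \<bullet> b)) = conv f (newton_reg_grad r) x \<bullet> b"
      by simp
  qed
  ultimately show "((\<lambda>x. conv f (newton_reg_grad r) x \<bullet> b) has_derivative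
           (\<lambda>h. conv f (newton_reg_hess r b) x \<bullet> h)) (at x)"
    by (simp only:)
  show "isCont (conv f (newton_reg_grad r)) x"
    using continuous_on_conv[OF int m(2) fM(5) B2 continuous_on_subset[OF c(2) subset_UNIV]]
      continuous_on_eq_continuous_at[OF open_ball] x by blast
  show "isCont (conv f (newton_reg_hess r b)) x"
    using continuous_on_conv[OF int m(3) fM(5) B3 continuous_on_subset[OF c(3) subset_UNIV]]
      continuous_on_eq_continuous_at[OF open_ball] x by blast
  show "integrable lborel (\<lambda>y. f y * newton_reg r (x - y))"
    using integrable_conv[OF int m(1) fM(5) B1 x] by simp
qed

lemma integrable_potential: "bounded_density f \<Longrightarrow> integrable lborel (\<lambda>y. f y * newton ((x::'a) - y))"
  using integrable_norm_conv_kernel(1)[OF _ weakly_singular_newton, of f x] by simp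

lemma integrable_potential_grad: "bounded_density f \<Longrightarrow> integrable lborel (\<lambda>y. f y *\<^sub>R newton_grad ((x::'a) - y))"
  using integrable_norm_conv_kernel(1)[OF _ weakly_singular_newton_grad, of f x] by simp

text \<open>
  Both kernels agree outside the ball of radius \<open>r\<close>.
\<close>
lemma potential_reg_diff:
  assumes f: "bounded_density f" and M: "\<And>x. \<bar>f x\<bar> \<le> M" and r: "0 < r" "r \<le> 1/2"
  shows "\<bar>(LBINT y. f y * newton_reg r (x - y)) - potential f (x::'a)\<bar> \<le> M * r"
    and "norm (conv f (newton_reg_grad r) x - potential_grad f x) \<le> 2 * M * r"
proof -
  have w: "unit_sphere_area DIM('a) > 0" by (rule sphere_area_pos)
  note c = continuous_on_newton_reg[OF r(1)] continuous_on_newton_reg_grad[OF r(1)]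
  note [measurable] = borel_measurable_continuous_onI[OF c(1)] borel_measurable_continuous_onI[OF c(2)]
    borel_measurable_newton borel_measurable_newton_grad
  have "(LBINT y. f y * newton_reg r (x - y)) - potential f x = (LBINT y. f y * newton_reg r (x - y) - f y * newton (x - y))"
    unfolding potential_def
    by (rule Bochner_Integration.integral_diff[symmetric, OF conv_newton_reg(5)[OF f r(1)] integrable_potential[OF f]])
  also have "\<dots> = (LBINT y. f y *\<^sub>R (newton_reg r (x - y) - newton (x - y)))"
    by (simp add: right_diff_distrib)
  finally have e: "(LBINT y. f y * newton_reg r (x - y)) - potential f x = \<dots>" .
  have "norm (LBINT y. f y *\<^sub>R (newton_reg r (x - y) - newton (x - y)))
      \<le> M * inverse (unit_sphere_area DIM('a)) * (unit_sphere_area DIM('a) * r)"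
    by (rule norm_conv_local_kernel_le[where k = "\<lambda>z. newton_reg r z - newton z"])
       (use newton_reg_diff_le[OF r] in \<open>auto simp: bounded_density_measurable[OF f] M r\<close>)
  then show "\<bar>(LBINT y. f y * newton_reg r (x - y)) - potential f x\<bar> \<le> M * r"
    unfolding e using w by (simp add: field_simps)
  have "conv f (newton_reg_grad r) x - potential_grad f x = (LBINT y. f y *\<^sub>R newton_reg_grad r (x - y) - f y *\<^sub>R newton_grad (x - y))"
    unfolding potential_grad_def
    by (rule Bochner_Integration.integral_diff[symmetric, OF conv_newton_reg(6)[OF f r(1)] integrable_potential_grad[OF f]])
  also have "\<dots> = (LBINT y. f y *\<^sub>R (newton_reg_grad r (x - y) - newton_grad (x - y)))"
    by (simp add: scaleR_diff_right)
  finally have e: "conv f (newton_reg_grad r) x - potential_grad f x = \<dots>" .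
  have "norm (LBINT y. f y *\<^sub>R (newton_reg_grad r (x - y) - newton_grad (x - y)))
      \<le> M * (2 * inverse (unit_sphere_area DIM('a))) * (unit_sphere_area DIM('a) * r)"
    by (rule norm_conv_local_kernel_le[where k = "\<lambda>z. newton_reg_grad r z - newton_grad z"])
       (use newton_reg_grad_diff_le[OF r] in \<open>auto simp: bounded_density_measurable[OF f] M r\<close>)
  then show "norm (conv f (newton_reg_grad r) x - potential_grad f x) \<le> 2 * M * r"
    unfolding e using w by (simp add: field_simps)
qed

text \<open>
  The regularised potentials are differentiable and converge, together with their gradients,
  uniformly as the radius of regularisation tends to 0.
\<close>
lemma potential_C1:
  assumes f: "bounded_density f"
  shows "(potential f has_derivative (\<lambda>h. potential_grad f x \<bullet> h)) (at (x::'a))"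
    and "continuous_on UNIV (potential_grad f :: 'a \<Rightarrow> 'a)"
proof -
  obtain M \<rho> where fM: "f \<in> borel_measurable borel" "M > 0" "\<rho> > 0" "\<And>x. \<bar>f x\<bar> \<le> M" "\<And>x. norm x > \<rho> \<Longrightarrow> f x = 0"
    using f by (rule bounded_densityE) blast
  \<comment> \<open>the shift by 2 keeps the radii below 1/2\<close>
  define r where "r n = 1 / (real n + 2)" for n :: nat
  have r: "0 < r n" "r n \<le> 1/2" for n by (auto simp: r_def field_simps)
  have r0: "r \<longlonglongrightarrow> 0" unfolding r_def
    by real_asymp
  define W where "W n x = (LBINT y. f y * newton_reg (r n) (x - y))" for n x
  define V where "V n x = (LBINT y. f y *\<^sub>R newton_reg_grad (r n) (x - y))" for n x
  have W: "\<bar>W n x - potential f x\<bar> \<le> M * r n" for n x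
    unfolding W_def by (rule potential_reg_diff(1)[OF f fM(4) r])
  have V: "norm (V n x - potential_grad f x) \<le> 2 * M * r n" for n x
    unfolding V_def by (rule potential_reg_diff(2)[OF f fM(4) r])
  have lim: "(\<lambda>n. C * r n) \<longlonglongrightarrow> 0" for C
    using tendsto_mult_left[OF r0, of C] by simp
  have Wl: "(\<lambda>n. W n x) \<longlonglongrightarrow> potential f x" for x
    by (rule LIM_zero_cancel, rule Lim_null_comparison[OF _ lim[of M]]) (use W in auto)
  have small: "\<forall>\<^sub>F n in sequentially. 2 * M * r n < e" if "e > 0" for e
    using order_tendstoD(2)[OF lim[of "2 * M"] that] .
  have "\<exists>g. \<forall>x\<in>UNIV. (\<lambda>n. W n x) \<longlonglongrightarrow> g x \<and> (g has_derivative (\<lambda>h. potential_grad f x \<bullet> h)) (at x within UNIV)"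
  proof (rule has_derivative_sequence[where f' = "\<lambda>n x h. V n x \<bullet> h" and ?x0.0 = 0 and l = "potential f 0"])
    show "(W n has_derivative (\<lambda>h. V n x \<bullet> h)) (at x within UNIV)" for n x
      unfolding W_def V_def using conv_newton_reg(1)[OF f r(1)] by simp
    show "\<forall>\<^sub>F n in sequentially. \<forall>x\<in>UNIV. \<forall>h. norm (V n x \<bullet> h - potential_grad f x \<bullet> h) \<le> e * norm h" if "e > 0" for e
      using small[OF that]
    proof eventually_elim
      case (elim n)
      have "norm (V n x \<bullet> h - potential_grad f x \<bullet> h) \<le> e * norm h" for x h
      proof -
        have "norm (V n x \<bullet> h - potential_grad f x \<bullet> h) = \<bar>(V n x - potential_grad f x) \<bullet> h\<bar>"
          by (simp add: inner_diff_left)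
        also have "\<dots> \<le> norm (V n x - potential_grad f x) * norm h" by (rule Cauchy_Schwarz_ineq2)
        also have "\<dots> \<le> e * norm h" using V[of n x] elim by (intro mult_right_mono) auto
        finally show ?thesis .
      qed
      then show ?case by blast
    qed
  qed (use Wl in auto)
  then obtain g where g: "\<And>x. (\<lambda>n. W n x) \<longlonglongrightarrow> g x" "\<And>x. (g has_derivative (\<lambda>h. potential_grad f x \<bullet> h)) (at x)"
    by auto
  have "g = potential f" using LIMSEQ_unique[OF g(1) Wl] by auto
  with g(2) show "(potential f has_derivative (\<lambda>h. potential_grad f x \<bullet> h)) (at x)" by simp
  show "continuous_on UNIV (potential_grad f :: 'a \<Rightarrow> 'a)"
  proof (rule uniform_limit_theorem[where F = sequentially and f = V])
    show "\<forall>\<^sub>F n in sequentially. continuous_on UNIV (V n)"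
      unfolding V_def[abs_def]
      by (intro always_eventually allI continuous_at_imp_continuous_on ballI conv_newton_reg(3)[OF f r(1)])
    show "uniform_limit UNIV V (potential_grad f) sequentially"
      unfolding uniform_limit_iff dist_norm
    proof (intro allI impI)
      fix e :: real assume "e > 0"
      from small[OF this] show "\<forall>\<^sub>F n in sequentially. \<forall>x\<in>UNIV. norm (V n x - potential_grad f x) < e"
        by eventually_elim (use V in \<open>blast intro: order.strict_trans1\<close>)
    qed
  qed auto
qed

lemma potential_bounded:
  assumes f: "bounded_density f"
  shows "\<exists>B. \<forall>x::'a. \<bar>potential f x\<bar> \<le> B \<and> norm (potential_grad f x) \<le> B"
proof -
  obtain B1 where B1: "\<And>x::'a. (LBINT y. norm (f y *\<^sub>R newton (x - y))) \<le> B1"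
    using integrable_norm_conv_kernel(2)[OF f weakly_singular_newton] by blast
  obtain B2 where B2: "\<And>x::'a. (LBINT y. norm (f y *\<^sub>R newton_grad (x - y))) \<le> B2"
    using integrable_norm_conv_kernel(2)[OF f weakly_singular_newton_grad] by blast
  have "norm (potential f x) \<le> B1" "norm (potential_grad f x) \<le> B2" for x :: 'a
    unfolding potential_def potential_grad_def real_scaleR_def[symmetric]
    by (rule order_trans[OF integral_norm_bound B1], rule order_trans[OF integral_norm_bound B2])
  then have "\<bar>potential f x\<bar> \<le> max B1 B2 \<and> norm (potential_grad f x) \<le> max B1 B2" for x :: 'a
    by (auto simp: le_max_iff_disj)
  then show ?thesis by blast
qed

lemma continuous_on_potential: "bounded_density f \<Longrightarrow> continuous_on UNIV (potential f :: 'a \<Rightarrow> real)"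
  by (intro continuous_at_imp_continuous_on ballI has_derivative_continuous[OF potential_C1(1)])

lemma potential_lipschitz:
  assumes f: "bounded_density f"
  shows "\<exists>B\<ge>0. \<forall>x y::'a. \<bar>potential f x - potential f y\<bar> \<le> B * norm (x - y)"
proof -
  obtain B where B: "\<And>x::'a. norm (potential_grad f x) \<le> B" using potential_bounded[OF f] by blast
  have "\<bar>potential f x - potential f y\<bar> \<le> B * norm (x - y)" for x y :: 'a
    by (rule gradient_bound_imp_lipschitz[OF convex_UNIV potential_C1(1)[OF f] B]) auto
  moreover have "B \<ge> 0" using order_trans[OF norm_ge_zero B[of 0]] .
  ultimately show ?thesis by blast
qed

end

section \<open>Integrals of gradients of compactly supported functions\<close>

lemma bounded_density_continuous:
  assumes "continuous_on UNIV F" "\<And>x. norm x > R \<Longrightarrow> F x = 0"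
  shows "bounded_density F"
proof -
  obtain B where B: "\<And>z. z \<in> ball 0 (R + 1) \<Longrightarrow> norm (F z) \<le> B"
    using continuous_bounded_on_ball[OF assms(1)] by metis
  have "\<bar>F x\<bar> \<le> max B 0" for x
    using B[of x] assms(2)[of x] by (cases "norm x > R") auto
  then show ?thesis
    unfolding bounded_density_def using assms borel_measurable_continuous_onI[OF assms(1)] by blast
qed

lemma has_bochner_integral_inverse_power_tail:
  fixes a :: real
  assumes "a > 0" "n \<ge> 1"
  shows "has_bochner_integral lborel (\<lambda>t. inverse (t ^ Suc n) * indicator {a..} t) (inverse (real n * a ^ n))"
proof (rule has_bochner_integral_nn_integral)
  show "(\<lambda>t. inverse (t ^ Suc n) * indicator {a..} t) \<in> borel_measurable lborel" by measurable
  show "AE t in lborel. 0 \<le> inverse (t ^ Suc n) * indicator {a..} t"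
    using assms by (auto simp: indicator_def)
  have "(\<integral>\<^sup>+t. ennreal (inverse (t ^ Suc n)) * indicator {a..} t \<partial>lborel) = ennreal (0 - (- inverse (real n * a ^ n)))"
  proof (rule nn_integral_FTC_atLeast)
    fix t assume t: "a \<le> t"
    obtain k where k: "n = Suc k" using assms by (cases n) auto
    have "((\<lambda>t. real n * t ^ n) has_real_derivative real n * (real n * t ^ k)) (at t)"
      using DERIV_cmult[OF DERIV_pow[of n t]] by (simp add: k)
    from DERIV_minus[OF DERIV_inverse'[OF this]]
    have "((\<lambda>t. - inverse (real n * t ^ n)) has_real_derivative
        inverse (real n * t ^ n) * (real n * (real n * t ^ k)) * inverse (real n * t ^ n)) (at t)"
      using t assms by simp
    moreover have "inverse (real n * t ^ n) * (real n * (real n * t ^ k)) * inverse (real n * t ^ n) = inverse (t ^ Suc n)"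
      using t assms by (simp add: k field_simps del: of_nat_Suc)
    ultimately show "((\<lambda>t. - inverse (real n * t ^ n)) has_real_derivative inverse (t ^ Suc n)) (at t)"
      by (simp only:)
    show "0 \<le> inverse (t ^ Suc n)" using t assms by auto
  next
    have "filterlim (\<lambda>t. real n * t ^ n) at_top at_top"
      using assms by (intro filterlim_tendsto_pos_mult_at_top[OF tendsto_const] filterlim_pow_at_top filterlim_ident) auto
    then have "((\<lambda>t. inverse (real n * t ^ n)) \<longlongrightarrow> 0) at_top"
      by (rule tendsto_inverse_0_at_top)
    from tendsto_minus[OF this] show "((\<lambda>t. - inverse (real n * t ^ n)) \<longlongrightarrow> 0) at_top" by simp
  qed measurable
  moreover have "(\<integral>\<^sup>+t. ennreal (inverse (t ^ Suc n) * indicator {a..} t) \<partial>lborel)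
      = (\<integral>\<^sup>+t. ennreal (inverse (t ^ Suc n)) * indicator {a..} t \<partial>lborel)"
    by (intro nn_integral_cong) (simp add: indicator_def)
  ultimately show "(\<integral>\<^sup>+t. ennreal (inverse (t ^ Suc n) * indicator {a..} t) \<partial>lborel) = ennreal (inverse (real n * a ^ n))"
    by (simp only: diff_minus_eq_add add_0)
qed (use assms in auto)

text \<open>
  By translation invariance the integral of \<open>F (x - y)\<close> over \<open>y\<close> does not depend on \<open>x\<close>; differentiate
  under the integral sign.
\<close>
lemma integral_gradient_eq_0:
  fixes F :: "'a::euclidean_space \<Rightarrow> real"
  assumes der: "\<And>z. (F has_derivative (\<lambda>h. G z \<bullet> h)) (at z)" and G: "continuous_on UNIV G"
    and F0: "\<And>z. norm z > R \<Longrightarrow> F z = 0" and G0: "\<And>z. norm z > R \<Longrightarrow> G z = 0" and R: "R > 0"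
  shows "(LBINT y. G y) = 0"
proof -
  define \<rho> where "\<rho> = R + 2"
  define g where "g = (indicator (cball (0::'a) \<rho>) :: 'a \<Rightarrow> real)"
  have F: "continuous_on UNIV F"
    by (intro continuous_at_imp_continuous_on ballI has_derivative_continuous[OF der])
  obtain B1 where B1: "\<And>z. z \<in> ball 0 (1 + \<rho>) \<Longrightarrow> norm (F z) \<le> B1"
    using continuous_bounded_on_ball[OF F] by metis
  obtain B2 where B2: "\<And>z. z \<in> ball 0 (1 + \<rho>) \<Longrightarrow> norm (G z) \<le> B2"
    using continuous_bounded_on_ball[OF G] by metis
  have far: "norm (x - y) > R" if "x \<in> ball 0 1" "norm y > \<rho>" for x y :: 'a
    using that norm_triangle_ineq2[of y x] by (simp add: \<rho>_def norm_minus_commute)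
  have gi: "integrable lborel g" unfolding g_def \<rho>_def
    using R by (intro integrable_real_indicator) (auto simp: emeasure_cball)
  have "((\<lambda>x. LBINT y. g y * F (x - y)) has_derivative
      (\<lambda>h. conv g G 0 \<bullet> h)) (at 0)"
  proof (rule conv_has_gradient[OF gi borel_measurable_continuous_onI[OF F] borel_measurable_continuous_onI[OF G] _ der])
    show "g y = 0" if "norm y > \<rho>" for y using that by (simp add: g_def)
    show "\<bar>F z\<bar> \<le> max B1 B2" "norm (G z) \<le> max B1 B2" if "z \<in> ball 0 (1 + \<rho>)" for z
      using B1[OF that] B2[OF that] by (simp_all add: le_max_iff_disj)
  qed simp
  moreover have "((\<lambda>x. LBINT y. g y * F (x - y)) has_derivative (\<lambda>h. 0)) (at 0)"
  proof (rule has_derivative_transform_within_open[OF has_derivative_const[of "LBINT y. F y"]])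
    fix x :: 'a assume x: "x \<in> ball 0 1"
    have "g y * F (x - y) = F (x - y)" for y
      using F0[OF far[OF x]] by (cases "norm y > \<rho>") (auto simp: g_def)
    then show "(LBINT y. F y) = (LBINT y. g y * F (x - y))"
      by (simp only: lborel_integral_reflect)
  qed auto
  ultimately have eq: "(\<lambda>h. conv g G 0 \<bullet> h) = (\<lambda>h. 0)"
    by (rule has_derivative_unique)
  have "g y *\<^sub>R G (0 - y) = G (0 - y)" for y
    using G0[OF far[of 0 y]] by (cases "norm y > \<rho>") (auto simp: g_def)
  then have "conv g G 0 = (LBINT y. G y)"
    using lborel_integral_reflect[of G 0] by simp
  with fun_cong[OF eq, of "LBINT y. G y"] show ?thesis by simp
qed

text \<open>
  Fundamental theorem of calculus from the origin to a point beyond the support.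
\<close>
lemma integral_along_ray:
  fixes g :: "'a::euclidean_space \<Rightarrow> real"
  assumes der: "\<And>z. (g has_derivative (\<lambda>h. G z \<bullet> h)) (at z)" and G: "continuous_on UNIV G"
    and g0: "\<And>z. norm z > R \<Longrightarrow> g z = 0" and G0: "\<And>z. norm z > R \<Longrightarrow> G z = 0" and R: "R > 0"
    and z: "z \<noteq> 0"
  shows "has_bochner_integral lborel (\<lambda>t. indicator {0..} t * (z \<bullet> G (t *\<^sub>R z))) (- g 0)"
proof -
  define T where "T = R / norm z + 1"
  have T: "T \<ge> 0" using R by (simp add: T_def)
  have far: "norm (t *\<^sub>R z) > R" if "t \<ge> T" for t
  proof -
    have "R < T * norm z" using z by (simp add: T_def field_simps)
    also have "\<dots> \<le> t * norm z" using that by (intro mult_right_mono) auto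
    finally show ?thesis using that T by simp
  qed
  have cont: "continuous_on UNIV (\<lambda>t. z \<bullet> G (t *\<^sub>R z))"
    by (intro continuous_on_inner continuous_on_const continuous_on_compose2[OF G]) (auto intro!: continuous_intros)
  have "has_bochner_integral lborel (\<lambda>t. (z \<bullet> G (t *\<^sub>R z)) * indicator {0..T} t) (g (T *\<^sub>R z) - g (0 *\<^sub>R z))"
  proof (rule has_bochner_integral_FTC_Icc_real[OF T])
    fix t :: real
    have "((\<lambda>t. t *\<^sub>R z) has_derivative (\<lambda>h. h *\<^sub>R z)) (at t)"
      by (intro derivative_eq_intros) auto
    from has_derivative_compose[OF this der]
    show "((\<lambda>t. g (t *\<^sub>R z)) has_real_derivative z \<bullet> G (t *\<^sub>R z)) (at t)"
      by (simp add: has_field_derivative_def inner_commute mult.commute[of _ "z \<bullet> G (t *\<^sub>R z)"] cong: if_cong)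
    show "isCont (\<lambda>t. z \<bullet> G (t *\<^sub>R z)) t"
      using cont continuous_on_eq_continuous_at by blast
  qed
  moreover have "(\<lambda>t. (z \<bullet> G (t *\<^sub>R z)) * indicator {0..T} t) = (\<lambda>t. indicator {0..} t * (z \<bullet> G (t *\<^sub>R z)))"
    using G0[OF far] by (auto simp: indicator_def fun_eq_iff)
  ultimately show ?thesis using g0[OF far[OF order_refl]] by simp
qed

text \<open>
  The divergence theorem for the field \<open>y / |y|\<^sup>m\<close>, proved without surface integrals. The integral of
  \<open>z \<bullet> G (t z)\<close> over \<open>|z| \<le> 1\<close> and \<open>t \<ge> 0\<close> is evaluated in two ways: along rays, where it gives
  \<open>- g 0\<close>, and after the substitution \<open>y = t z\<close>, where the integral over \<open>t \<ge> |y|\<close> of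
  \<open>t\<^sup>-\<^sup>m\<^sup>-\<^sup>1\<close> produces the weight \<open>|y|\<^sup>-\<^sup>m / m\<close>.
\<close>
lemma integral_gradient_against_radial:
  fixes g :: "'a::euclidean_space \<Rightarrow> real"
  assumes der: "\<And>z. (g has_derivative (\<lambda>h. G z \<bullet> h)) (at z)" and G: "continuous_on UNIV G"
    and g0: "\<And>z. norm z > R \<Longrightarrow> g z = 0" and G0: "\<And>z. norm z > R \<Longrightarrow> G z = 0" and R: "R > 0"
  shows "(LBINT y. inverse (real DIM('a) * norm y ^ DIM('a)) * (y \<bullet> G y)) = - g 0 * unit_ball_vol (real DIM('a))"
proof -
  note [measurable] = borel_measurable_continuous_onI[OF G]
  have [measurable]: "cball (0::'a) 1 \<in> sets borel" by simp
  let ?m = "DIM('a)"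
  have m1: "?m \<ge> 1" by (simp add: Suc_le_eq)
  obtain B where B: "\<And>z. norm (G z) \<le> B" and "B \<ge> 0"
  proof -
    obtain B where B: "\<And>z. z \<in> ball 0 (R + 1) \<Longrightarrow> norm (G z) \<le> B"
      using continuous_bounded_on_ball[OF G] by metis
    have "norm (G z) \<le> max B 0" for z
      using B[of z] G0[of z] by (cases "norm z > R") auto
    then show thesis by (intro that[of "max B 0"]) auto
  qed
  \<comment> \<open>P and Q are the integrand before and after the substitution y = t z\<close>
  define P where "P z t = indicator (cball (0::'a) 1) z * (indicator {0..} t * (z \<bullet> G (t *\<^sub>R z)))" for z and t :: real
  define Q where "Q y t = inverse (t ^ Suc ?m) * indicator {norm y..} t * (y \<bullet> G y)" for y :: 'a and t :: real
  have ray: "has_bochner_integral lborel (\<lambda>t. indicator {0..} t * (z \<bullet> G (t *\<^sub>R z))) (- g 0)" if "z \<noteq> 0" for z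
    by (rule integral_along_ray[OF der G g0 G0 R that])
  have P_int: "integrable lborel (P z)" if "z \<noteq> 0" for z
    unfolding P_def using ray[OF that] by (intro integrable_mult_right) (auto simp: has_bochner_integral_iff)
  have P_norm: "(LBINT t. \<bar>P z t\<bar>) \<le> B * R * indicator (cball 0 1) z" if z: "z \<noteq> 0" for z
  proof -
    have "(LBINT t. \<bar>P z t\<bar>) \<le> (LBINT t. indicator (cball 0 1) z * (B * norm z) * indicator {0..R / norm z} t)"
    proof (rule integral_mono)
      show "integrable lborel (\<lambda>t. indicator (cball 0 1) z * (B * norm z) * indicator {0..R / norm z} t)"
        by (intro integrable_mult_right integrable_real_indicator) (auto simp: emeasure_lborel_Icc_eq)
      show "integrable lborel (\<lambda>t. \<bar>P z t\<bar>)" using P_int[OF z] by simp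
      fix t :: real
      show "\<bar>P z t\<bar> \<le> indicator (cball 0 1) z * (B * norm z) * indicator {0..R / norm z} t"
      proof (cases "0 \<le> t \<and> t \<le> R / norm z")
        case True
        have "\<bar>z \<bullet> G (t *\<^sub>R z)\<bar> \<le> norm z * norm (G (t *\<^sub>R z))" by (rule Cauchy_Schwarz_ineq2)
        also have "\<dots> \<le> norm z * B" by (intro mult_left_mono B) auto
        finally show ?thesis using True by (auto simp: P_def indicator_def mult.commute)
      next
        case False
        have "P z t = 0"
        proof (cases "t < 0")
          case False
          with \<open>\<not> (0 \<le> t \<and> t \<le> R / norm z)\<close> have "R < t * norm z" using z by (simp add: field_simps)
          then have "norm (t *\<^sub>R z) > R" using False by simp
          from G0[OF this] show ?thesis by (simp add: P_def)
        qed (simp add: P_def)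
        then show ?thesis using \<open>B \<ge> 0\<close> by simp
      qed
    qed
    also have "\<dots> = B * R * indicator (cball 0 1) z" using z R by simp
    finally show ?thesis .
  qed
  have ne: "AE z in lborel. z \<noteq> (0::'a)" by (rule AE_lborel_singleton)
  have ne1: "AE t in lborel. t \<noteq> (0::real)" by (rule AE_lborel_singleton)
  have iP: "integrable (lborel \<Otimes>\<^sub>M lborel) (case_prod P)"
  proof (rule lborel_pair.Fubini_integrable)
    show "case_prod P \<in> borel_measurable (lborel \<Otimes>\<^sub>M lborel)"
      unfolding P_def by measurable
    show "integrable lborel (\<lambda>z. LBINT t. norm (case (z, t) of (x, xa) \<Rightarrow> P x xa))"
    proof (rule Bochner_Integration.integrable_bound)
      show "integrable lborel (\<lambda>z::'a. B * R * indicator (cball 0 1) z)"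
        by (intro integrable_mult_right integrable_real_indicator) (auto simp: emeasure_cball)
      show "(\<lambda>z. LBINT t. norm (case (z, t) of (x, xa) \<Rightarrow> P x xa)) \<in> borel_measurable lborel"
        unfolding P_def by measurable
      show "AE z in lborel. norm (LBINT t. norm (case (z, t) of (x, xa) \<Rightarrow> P x xa)) \<le> norm (B * R * indicator (cball 0 1) z)"
        using ne by eventually_elim (use P_norm \<open>B \<ge> 0\<close> R in simp)
    qed
    show "AE z in lborel. integrable lborel (\<lambda>t. case (z, t) of (x, xa) \<Rightarrow> P x xa)"
      using ne by eventually_elim (use P_int in simp)
  qed
  have tail: "has_bochner_integral lborel (\<lambda>t. inverse (t ^ Suc ?m) * indicator {norm y..} t) (inverse (real ?m * norm y ^ ?m))" if "y \<noteq> 0" for y :: 'a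
    by (rule has_bochner_integral_inverse_power_tail) (use that m1 in auto)
  have Q_int: "has_bochner_integral lborel (Q y) (inverse (real ?m * norm y ^ ?m) * (y \<bullet> G y))" if "y \<noteq> 0" for y
    unfolding Q_def by (rule has_bochner_integral_mult_left[OF tail[OF that]])
  have Q_norm: "(LBINT t. \<bar>Q y t\<bar>) \<le> B * (riesz y * indicator (ball 0 (R + 1)) y)" if y: "y \<noteq> 0" for y
  proof -
    have "(LBINT t. \<bar>Q y t\<bar>) = (LBINT t. inverse (t ^ Suc ?m) * indicator {norm y..} t * \<bar>y \<bullet> G y\<bar>)"
    proof (rule Bochner_Integration.integral_cong)
      fix t :: real
      have "0 \<le> t" if "norm y \<le> t" using that norm_ge_zero[of y] by linarith
      then show "\<bar>Q y t\<bar> = inverse (t ^ Suc ?m) * indicator {norm y..} t * \<bar>y \<bullet> G y\<bar>"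
        by (auto simp: Q_def abs_mult indicator_def)
    qed simp
    also have "\<dots> = inverse (real ?m * norm y ^ ?m) * \<bar>y \<bullet> G y\<bar>"
      using has_bochner_integral_mult_left[OF tail[OF y], of "\<bar>y \<bullet> G y\<bar>"] by (simp add: has_bochner_integral_iff)
    also have "\<dots> \<le> B * (riesz y * indicator (ball 0 (R + 1)) y)"
    proof (cases "norm y > R")
      case False
      obtain n where n: "?m = Suc n" using m1 by (cases ?m) auto
      have "inverse (real ?m) \<le> 1" using m1 by (simp add: inverse_le_1_iff)
      have "\<bar>y \<bullet> G y\<bar> \<le> norm y * B"
        using Cauchy_Schwarz_ineq2[of y "G y"] mult_left_mono[OF B norm_ge_zero[of y], of y] by linarith
      then have "inverse (real ?m * norm y ^ ?m) * \<bar>y \<bullet> G y\<bar> \<le> inverse (real ?m * norm y ^ ?m) * (norm y * B)"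
        by (intro mult_left_mono) auto
      also have "\<dots> = inverse (real ?m) * (inverse (norm y ^ ?m) * norm y * B)" by simp
      also have "\<dots> \<le> 1 * (inverse (norm y ^ ?m) * norm y * B)"
        using \<open>inverse (real ?m) \<le> 1\<close> \<open>B \<ge> 0\<close> by (intro mult_right_mono) auto
      also have "\<dots> = B * riesz y" using y by (simp add: riesz_def n field_simps)
      finally show ?thesis using False by simp
    qed (use G0 \<open>B \<ge> 0\<close> in \<open>simp add: riesz_nonneg\<close>)
    finally show ?thesis .
  qed
  have iQ: "integrable (lborel \<Otimes>\<^sub>M lborel) (case_prod Q)"
  proof (rule lborel_pair.Fubini_integrable)
    have "case_prod Q = (\<lambda>(y, t). inverse (t ^ Suc ?m) * indicator {0..} (t - norm y) * (y \<bullet> G y))"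
      by (auto simp: Q_def indicator_def fun_eq_iff)
    then show mQ: "case_prod Q \<in> borel_measurable (lborel \<Otimes>\<^sub>M lborel)"
      by simp measurable
    show "integrable lborel (\<lambda>y. LBINT t. norm (case (y, t) of (x, xa) \<Rightarrow> Q x xa))"
    proof (rule Bochner_Integration.integrable_bound)
      show "integrable lborel (\<lambda>y::'a. B * (riesz y * indicator (ball 0 (R + 1)) y))"
        using R by (intro integrable_mult_right integrable_riesz_ball) auto
      show "(\<lambda>y. LBINT t. norm (case (y, t) of (x, xa) \<Rightarrow> Q x xa)) \<in> borel_measurable lborel"
        using measurable_compose[OF mQ borel_measurable_norm]
        by (intro lborel.borel_measurable_lebesgue_integral) (simp add: split_def)
      show "AE y in lborel. norm (LBINT t. norm (case (y, t) of (x, xa) \<Rightarrow> Q x xa)) \<le> norm (B * (riesz y * indicator (ball 0 (R + 1)) y))"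
        using ne by eventually_elim (use Q_norm \<open>B \<ge> 0\<close> in simp)
    qed
    show "AE y in lborel. integrable lborel (\<lambda>t. case (y, t) of (x, xa) \<Rightarrow> Q x xa)"
      using ne by eventually_elim (use Q_int in \<open>simp add: has_bochner_integral_iff\<close>)
  qed
  have slice: "(LBINT z. P z t) = (LBINT y. Q y t)" if t: "t \<noteq> 0" for t
  proof (cases "t > 0")
    case True
    have "(LBINT z. P z t) = \<bar>1/t\<bar> ^ ?m *\<^sub>R (LBINT y. P (0 + (1/t) *\<^sub>R y) t)"
      by (rule lborel_integral_affine) (use t in simp)
    also have "\<dots> = (LBINT y. \<bar>1/t\<bar> ^ ?m * P (0 + (1/t) *\<^sub>R y) t)" by simp
    also have "\<dots> = (LBINT y. Q y t)"
    proof (rule Bochner_Integration.integral_cong)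
      fix y :: 'a
      have "norm ((1/t) *\<^sub>R y) \<le> 1 \<longleftrightarrow> norm y \<le> t" using True by (simp add: field_simps)
      then show "\<bar>1/t\<bar> ^ ?m * P (0 + (1/t) *\<^sub>R y) t = Q y t"
        using True by (auto simp: P_def Q_def indicator_def field_simps power_divide)
    qed simp
    finally show ?thesis .
  next
    case False
    then have "P z t = 0" "Q y t = 0" for z y
      using t norm_ge_zero[of y] by (auto simp: P_def Q_def indicator_def simp del: norm_ge_zero)
    then show ?thesis by simp
  qed
  have "(LBINT z. (LBINT t. P z t)) = (LBINT z. - g 0 * indicator (cball (0::'a) 1) z)"
  proof (rule integral_cong_AE)
    show "(\<lambda>z. LBINT t. P z t) \<in> borel_measurable lborel" unfolding P_def by measurable
    show "AE z in lborel. (LBINT t. P z t) = - g 0 * indicator (cball 0 1) z"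
      using ne
    proof eventually_elim
      case (elim z)
      from ray[OF elim] have "(LBINT t. indicator {0..} t * (z \<bullet> G (t *\<^sub>R z))) = - g 0"
        by (simp add: has_bochner_integral_iff)
      then show ?case unfolding P_def by simp
    qed
  qed measurable
  also have "\<dots> = - g 0 * unit_ball_vol (real ?m)"
    using content_cball[of 1 "0::'a"] by simp
  finally have 1: "(LBINT z. (LBINT t. P z t)) = - g 0 * unit_ball_vol (real ?m)" .
  have "(LBINT y. inverse (real ?m * norm y ^ ?m) * (y \<bullet> G y)) = (LBINT y. (LBINT t. Q y t))"
  proof (rule integral_cong_AE)
    show "(\<lambda>y. LBINT t. Q y t) \<in> borel_measurable lborel"
      using lborel_pair.integrable_fst[OF iQ] by auto
    show "AE y in lborel. inverse (real ?m * norm y ^ ?m) * (y \<bullet> G y) = (LBINT t. Q y t)"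
      using ne by eventually_elim (use Q_int in \<open>simp add: has_bochner_integral_iff\<close>)
  qed measurable
  also have "\<dots> = (LBINT t. (LBINT y. Q y t))"
    by (rule lborel_pair.Fubini_integral[OF iQ, symmetric])
  also have "\<dots> = (LBINT t. (LBINT z. P z t))"
  proof (rule integral_cong_AE)
    show "(\<lambda>t. LBINT y. Q y t) \<in> borel_measurable lborel"
      using lborel_pair.integrable_snd[OF iQ] by auto
    show "(\<lambda>t. LBINT z. P z t) \<in> borel_measurable lborel"
      using lborel_pair.integrable_snd[OF iP] by auto
    show "AE t in lborel. (LBINT y. Q y t) = (LBINT z. P z t)"
      using ne1 by eventually_elim (use slice in simp)
  qed
  also have "\<dots> = (LBINT z. (LBINT t. P z t))"
    by (rule lborel_pair.Fubini_integral[OF iP])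
  finally show ?thesis using 1 by simp
qed

section \<open>Weak form of the Poisson equation and decay at infinity\<close>

lemma weakly_singular_inner:
  assumes "weakly_singular k" "norm b \<le> 1"
  shows "weakly_singular (\<lambda>z::'a::euclidean_space. (k z :: 'a) \<bullet> b)"
proof -
  note [measurable] = weakly_singular_measurable[OF assms(1)]
  obtain C where C: "\<And>z. norm (k z) \<le> C * (riesz z * indicator (ball 0 1) z + 1)"
    using assms by (auto simp: weakly_singular_def)
  have "norm (k z \<bullet> b) \<le> C * (riesz z * indicator (ball 0 1) z + 1)" for z
  proof -
    have "norm (k z \<bullet> b) \<le> norm (k z) * norm b" using Cauchy_Schwarz_ineq2 by simp
    also have "\<dots> \<le> norm (k z) * 1" using assms by (intro mult_left_mono) auto
    finally show ?thesis using C[of z] by simp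
  qed
  then show ?thesis unfolding weakly_singular_def by (auto intro!: exI[of _ C])
qed

text \<open>
  A \<open>C\<^sup>1\<close> function supported in the ball of radius \<open>R\<close>. As \<open>R\<close> grows it tends to 1 at every point, so it
  also serves as a cut-off at infinity, although it is 1 at the origin only.
\<close>
definition bump :: "real \<Rightarrow> 'a::euclidean_space \<Rightarrow> real" where
  "bump R x = (max 0 (1 - (x \<bullet> x) / R\<^sup>2))\<^sup>2"

definition bump_grad :: "real \<Rightarrow> 'a::euclidean_space \<Rightarrow> 'a" where
  "bump_grad R x = (- 4 / R\<^sup>2 * max 0 (1 - (x \<bullet> x) / R\<^sup>2)) *\<^sub>R x"

lemma bump_has_derivative:
  "(bump R has_derivative (\<lambda>h. bump_grad R x \<bullet> h)) (at (x::'a::euclidean_space))"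
proof -
  have "((\<lambda>s. (max 0 (1 - s / R\<^sup>2)) ^ Suc (Suc 0)) has_real_derivative
      (real (Suc (Suc 0)) * (max 0 (1 - (x \<bullet> x) / R\<^sup>2)) ^ Suc 0) * (- 1 / R\<^sup>2)) (at (x \<bullet> x))"
    using DERIV_diff[OF DERIV_const[of 1] DERIV_cdivide[OF DERIV_ident, of "R\<^sup>2"]]
    by (intro DERIV_chain2[OF DERIV_max_power]) simp
  from has_derivative_radial[OF this] show ?thesis
    unfolding bump_def[abs_def] bump_grad_def by (simp add: numeral_2_eq_2)
qed

lemma bump_bounds: "0 \<le> bump R x" "bump R x \<le> 1"
proof -
  have "max 0 (1 - (x \<bullet> x) / R\<^sup>2) \<le> 1" by simp
  then have "(max 0 (1 - (x \<bullet> x) / R\<^sup>2))\<^sup>2 \<le> 1\<^sup>2" by (intro power_mono) auto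
  then show "0 \<le> bump R x" "bump R x \<le> 1" by (simp_all add: bump_def)
qed

lemma bump_outside:
  assumes "R > 0" "norm x \<ge> R" shows "bump R x = 0" "bump_grad R x = 0"
proof -
  have "R\<^sup>2 \<le> x \<bullet> x" using assms by (simp add: power_mono power2_norm_eq_inner[symmetric])
  then have "1 - (x \<bullet> x) / R\<^sup>2 \<le> 0" using assms by (simp add: field_simps)
  then show "bump R x = 0" "bump_grad R x = 0" by (simp_all add: bump_def bump_grad_def)
qed

lemma bump_pos: "R > 0 \<Longrightarrow> norm x < R \<Longrightarrow> bump R x > 0"
proof -
  assume "R > 0" "norm x < R"
  then have "x \<bullet> x < R\<^sup>2" by (simp add: power_strict_mono power2_norm_eq_inner[symmetric])
  then show ?thesis using \<open>R > 0\<close> by (simp add: bump_def field_simps)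
qed

lemma norm_bump_grad_le: "norm (bump_grad R x) \<le> 4 / R\<^sup>2 * norm x"
proof -
  have "4 / R\<^sup>2 * max 0 (1 - (x \<bullet> x) / R\<^sup>2) \<le> 4 / R\<^sup>2 * 1" by (intro mult_left_mono) auto
  then have "4 / R\<^sup>2 * max 0 (1 - (x \<bullet> x) / R\<^sup>2) * norm x \<le> 4 / R\<^sup>2 * 1 * norm x"
    by (rule mult_right_mono) simp
  then show ?thesis by (simp add: bump_grad_def abs_mult)
qed

lemma continuous_on_bump: "continuous_on S (bump R)" "continuous_on S (bump_grad R)"
  unfolding bump_def[abs_def] bump_grad_def[abs_def] divide_inverse
  by (intro continuous_on_power continuous_on_max continuous_on_diff continuous_on_inner
    continuous_on_scaleR continuous_on_mult continuous_on_const continuous_on_id)+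

context dim_ge_3
begin

text \<open>
  \<open>K\<close> is a fundamental solution of \<open>- \<nabla>\<^sup>2\<close>. The normalisation is right because the area of the unit
  sphere is \<open>m\<close> times the volume of the unit ball.
\<close>
lemma newton_grad_reproduces:
  fixes g :: "'a \<Rightarrow> real"
  assumes der: "\<And>z. (g has_derivative (\<lambda>h. G z \<bullet> h)) (at z)" and G: "continuous_on UNIV G"
    and g0: "\<And>z. norm z > R \<Longrightarrow> g z = 0" and G0: "\<And>z. norm z > R \<Longrightarrow> G z = 0" and R: "R > 0"
  shows "(LBINT y. newton_grad y \<bullet> G y) = g 0"
proof -
  let ?v = "unit_ball_vol (real DIM('a))"
  have v: "?v \<noteq> 0" using unit_ball_vol_pos[of "real DIM('a)"] by (metis of_nat_0_le_iff order_less_irrefl)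
  have w: "unit_sphere_area DIM('a) = real DIM('a) * ?v" using dim by (intro unit_sphere_area_eq) auto
  have "(LBINT y. newton_grad y \<bullet> G y) = (LBINT y. (- inverse ?v) * (inverse (real DIM('a) * norm y ^ DIM('a)) * (y \<bullet> G y)))"
    by (intro Bochner_Integration.integral_cong refl) (simp add: newton_grad_def w mult_ac)
  also have "\<dots> = (- inverse ?v) * (LBINT y. inverse (real DIM('a) * norm y ^ DIM('a)) * (y \<bullet> G y))"
    by (rule integral_mult_right_zero)
  also have "(LBINT y. inverse (real DIM('a) * norm y ^ DIM('a)) * (y \<bullet> G y)) = - g 0 * ?v"
    by (rule integral_gradient_against_radial[OF der G g0 G0 R])
  also have "(- inverse ?v) * (- g 0 * ?v) = g 0" using v by (simp add: field_simps)
  finally show ?thesis .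
qed

text \<open>
  Exchange the integrations; the inner one is the reproducing property of \<open>\<nabla>K\<close> at the point \<open>y\<close>.
\<close>
lemma potential_weak:
  fixes \<zeta> :: "'a \<Rightarrow> real"
  assumes f: "bounded_density f"
    and der: "\<And>z. (\<zeta> has_derivative (\<lambda>h. Z z \<bullet> h)) (at z)" and Z: "continuous_on UNIV Z"
    and z0: "\<And>z. norm z > R \<Longrightarrow> \<zeta> z = 0" and Z0: "\<And>z. norm z > R \<Longrightarrow> Z z = 0" and R: "R > 0"
  shows "(LBINT x. potential_grad f x \<bullet> Z x) = (LBINT y. f y * \<zeta> y)"
proof -
  define H where "H y x = f y * (newton_grad (x - y) \<bullet> Z x)" for y x
  have comp: "integrable (lborel \<Otimes>\<^sub>M lborel) (\<lambda>(y, x). f y * (Z x \<bullet> b) * (newton_grad (x - y) \<bullet> b))" if "b \<in> Basis" for b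
  proof (rule integrable_pair_kernel[where k = "\<lambda>z. newton_grad z \<bullet> b"])
    show "bounded_density (\<lambda>x. Z x \<bullet> b)"
      using Z0 by (intro bounded_density_continuous[of _ R] continuous_on_inner Z continuous_on_const) auto
    show "integrable lborel f" by (rule integrable_bounded_density[OF f])
    show "weakly_singular (\<lambda>z. newton_grad z \<bullet> b)"
      using that by (intro weakly_singular_inner weakly_singular_newton_grad) auto
  qed
  have "case_prod H = (\<lambda>p. \<Sum>b\<in>Basis. case p of (y, x) \<Rightarrow> f y * (Z x \<bullet> b) * (newton_grad (x - y) \<bullet> b))"
  proof (rule ext, clarify)
    fix y x :: 'a
    have "newton_grad (x - y) \<bullet> Z x = (\<Sum>b\<in>Basis. (newton_grad (x - y) \<bullet> b) * (Z x \<bullet> b))"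
      by (rule euclidean_inner)
    then show "H y x = (\<Sum>b\<in>Basis. f y * (Z x \<bullet> b) * (newton_grad (x - y) \<bullet> b))"
      by (simp add: H_def sum_distrib_left mult_ac)
  qed
  then have iH: "integrable (lborel \<Otimes>\<^sub>M lborel) (case_prod H)"
    using comp by simp
  have "(LBINT x. potential_grad f x \<bullet> Z x) = (LBINT x. (LBINT y. H y x))"
  proof (rule Bochner_Integration.integral_cong[OF refl])
    fix x :: 'a
    from integral_inner_left[OF integrable_potential_grad[OF f], of x "Z x"]
    show "potential_grad f x \<bullet> Z x = (LBINT y. H y x)"
      by (simp add: potential_grad_def H_def)
  qed
  also have "\<dots> = (LBINT y. (LBINT x. H y x))"
    by (rule lborel_pair.Fubini_integral[OF iH])
  also have "\<dots> = (LBINT y. f y * \<zeta> y)"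
  proof (rule Bochner_Integration.integral_cong[OF refl])
    fix y :: 'a
    have far: "norm (y + z) > R" if "norm z > R + norm y" for z
      using that norm_triangle_ineq4[of "y + z" y] by simp
    have "(LBINT x. newton_grad (x - y) \<bullet> Z x) = (LBINT z. newton_grad z \<bullet> Z (y + z))"
      using lborel_integral_translate[of "\<lambda>x. newton_grad (x - y) \<bullet> Z x" y] by simp
    also have "\<dots> = \<zeta> (y + 0)"
    proof (rule newton_grad_reproduces[where R = "R + norm y"])
      fix z
      have "((\<lambda>z. y + z) has_derivative (\<lambda>h. h)) (at z)" by (intro derivative_eq_intros) auto
      from has_derivative_compose[OF this der]
      show "((\<lambda>z. \<zeta> (y + z)) has_derivative (\<lambda>h. Z (y + z) \<bullet> h)) (at z)" .
      show "continuous_on UNIV (\<lambda>z. Z (y + z))"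
        by (rule continuous_on_compose2[OF Z]) (auto intro!: continuous_intros)
      show "R + norm y > 0" using R by (simp add: add_pos_nonneg)
    qed (use far z0 Z0 in auto)
    finally show "(LBINT x. H y x) = f y * \<zeta> y"
      by (simp add: H_def)
  qed
  finally show ?thesis .
qed

text \<open>
  For \<open>x\<close> at distance at least \<open>2 \<rho>\<close> from the origin and \<open>y\<close> in the support, \<open>|x - y| \<ge> |x| / 2\<close>.
  These crude rates suffice to discard the boundary term in the energy identity.
\<close>
lemma potential_decay:
  assumes f: "bounded_density f"
  shows "\<exists>C. \<forall>x::'a. \<bar>potential f x\<bar> * norm x \<le> C"
    and "\<exists>C. \<forall>x::'a. x \<noteq> 0 \<longrightarrow> norm (potential_grad f x) \<le> C * riesz x"
proof -
  obtain M \<rho>0 where fM0: "f \<in> borel_measurable borel" "M > 0" "\<rho>0 > 0" "\<And>x. \<bar>f x\<bar> \<le> M" "\<And>x. norm x > \<rho>0 \<Longrightarrow> f x = 0"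
    using f by (rule bounded_densityE) blast
  \<comment> \<open>at least 1, so that |x - y| >= 1 for x far away\<close>
  define \<rho> where "\<rho> = max \<rho>0 1"
  have \<rho>: "\<rho> \<ge> 1" and f0: "f y = 0" if "norm y > \<rho>" for y using fM0 that by (auto simp: \<rho>_def)
  have \<rho>1: "\<rho> \<ge> 1" by (simp add: \<rho>_def)
  let ?w = "inverse (unit_sphere_area DIM('a))"
  have w: "?w > 0" using sphere_area_pos by simp
  note fi = integrable_bounded_density[OF f]
  obtain B where B: "\<And>x::'a. \<bar>potential f x\<bar> \<le> B" "\<And>x::'a. norm (potential_grad f x) \<le> B"
    using potential_bounded[OF f] by blast
  have B0: "B \<ge> 0" using order_trans[OF abs_ge_zero B(1)] .
  let ?I = "LBINT y. \<bar>f y\<bar>"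
  have I0: "?I \<ge> 0" by simp
  define n where "n = DIM('a) - 3"
  have n: "DIM('a) = Suc (Suc (Suc n))" using dim by (simp add: n_def)
  have near: "norm (x - y) \<ge> norm x / 2 \<and> norm (x - y) \<ge> 1" if "norm x \<ge> 2 * \<rho>" "norm y \<le> \<rho>" for x y :: 'a
    using that \<rho>1 norm_triangle_ineq2[of x y] by simp
  have pot: "\<bar>potential f x\<bar> * norm x \<le> 2 * ?w * ?I" if x: "norm x \<ge> 2 * \<rho>" for x :: 'a
  proof -
    have "norm (LBINT y. norm x * (f y * newton (x - y))) \<le> (LBINT y. norm (norm x * (f y * newton (x - y))))"
      by (rule integral_norm_bound)
    also have "\<dots> \<le> (LBINT y. 2 * ?w * \<bar>f y\<bar>)"
    proof (rule integral_mono)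
      show "integrable lborel (\<lambda>y. norm (norm x * (f y * newton (x - y))))"
        by (intro integrable_norm integrable_mult_right integrable_potential[OF f])
      show "integrable lborel (\<lambda>y. 2 * ?w * \<bar>f y\<bar>)" using fi by simp
      fix y
      show "norm (norm x * (f y * newton (x - y))) \<le> 2 * ?w * \<bar>f y\<bar>"
      proof (cases "norm y > \<rho>")
        case False
        let ?d = "norm (x - y)"
        have d: "?d \<ge> norm x / 2" "?d \<ge> 1" using near[OF x] False by auto
        have "norm x * newton (x - y) \<le> (2 * ?d) * (?w * (?d * riesz (x - y)))"
          using d newton_le[of "x - y"] newton_nonneg[of "x - y"] by (intro mult_mono) auto
        also have "?d \<noteq> 0" using d by auto
        then have "(2 * ?d) * (?w * (?d * riesz (x - y))) = 2 * ?w * inverse (?d ^ n)"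
          by (simp add: riesz_def n field_simps)
        also have "\<dots> \<le> 2 * ?w * 1"
          using d w by (intro mult_left_mono) (auto simp: inverse_le_1_iff one_le_power)
        finally have "\<bar>f y\<bar> * (norm x * newton (x - y)) \<le> \<bar>f y\<bar> * (2 * ?w)"
          by (intro mult_left_mono) auto
        then show ?thesis using newton_nonneg[of "x - y"] by (simp add: abs_mult mult_ac)
      qed (simp add: f0)
    qed
    finally show ?thesis by (simp add: potential_def abs_mult mult.commute[of "norm x"])
  qed
  have "\<bar>potential f x\<bar> * norm x \<le> max (2 * ?w * ?I) (B * (2 * \<rho>))" for x :: 'a
  proof (cases "norm x \<ge> 2 * \<rho>")
    case False
    then have "\<bar>potential f x\<bar> * norm x \<le> B * (2 * \<rho>)" using B(1)[of x] B0 by (intro mult_mono) auto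
    then show ?thesis by simp
  qed (use pot in \<open>simp add: le_max_iff_disj\<close>)
  then show "\<exists>C. \<forall>x::'a. \<bar>potential f x\<bar> * norm x \<le> C" by blast
  let ?m = "DIM('a) - 1"
  have grad: "norm (potential_grad f x) \<le> (?w * 2 ^ ?m * ?I) * riesz x" if x: "norm x \<ge> 2 * \<rho>" for x :: 'a
  proof -
    have x0: "norm x > 0" using x \<rho>1 by linarith
    have "norm (potential_grad f x) \<le> (LBINT y. norm (f y *\<^sub>R newton_grad (x - y)))"
      unfolding potential_grad_def by (rule integral_norm_bound)
    also have "\<dots> \<le> (LBINT y. (?w * 2 ^ ?m * riesz x) * \<bar>f y\<bar>)"
    proof (rule integral_mono)
      show "integrable lborel (\<lambda>y. norm (f y *\<^sub>R newton_grad (x - y)))"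
        by (intro integrable_norm integrable_potential_grad[OF f])
      show "integrable lborel (\<lambda>y. (?w * 2 ^ ?m * riesz x) * \<bar>f y\<bar>)" using fi by simp
      fix y
      show "norm (f y *\<^sub>R newton_grad (x - y)) \<le> (?w * 2 ^ ?m * riesz x) * \<bar>f y\<bar>"
      proof (cases "norm y > \<rho>")
        case False
        then have "norm x / 2 \<le> norm (x - y)" using near[OF x] by auto
        then have "inverse (norm (x - y) ^ ?m) \<le> inverse ((norm x / 2) ^ ?m)"
          using x0 by (intro le_imp_inverse_le power_mono) auto
        also have "\<dots> = 2 ^ ?m * riesz x" by (simp add: riesz_def power_divide field_simps)
        finally have "?w * riesz (x - y) \<le> ?w * (2 ^ ?m * riesz x)"
          using w unfolding riesz_def by (intro mult_left_mono) auto
        then have "\<bar>f y\<bar> * (?w * riesz (x - y)) \<le> \<bar>f y\<bar> * (?w * (2 ^ ?m * riesz x))" by (rule mult_left_mono) simp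
        then show ?thesis by (simp only: norm_scaleR norm_newton_grad mult_ac)
      qed (simp add: f0)
    qed
    finally show ?thesis by (simp add: mult_ac)
  qed
  have "norm (potential_grad f x) \<le> max (?w * 2 ^ ?m * ?I) (B * (2 * \<rho>) ^ ?m) * riesz x" if "x \<noteq> 0" for x :: 'a
  proof (cases "norm x \<ge> 2 * \<rho>")
    case True
    show ?thesis by (rule order_trans[OF grad[OF True] mult_right_mono]) auto
  next
    case False
    then have "norm x ^ ?m \<le> (2 * \<rho>) ^ ?m" by (intro power_mono) auto
    then have "B * (norm x ^ ?m * riesz x) \<le> B * ((2 * \<rho>) ^ ?m * riesz x)"
      using B0 by (intro mult_left_mono mult_right_mono) auto
    also have "norm x ^ ?m * riesz x = 1" using that by (simp add: riesz_def)
    finally have "norm (potential_grad f x) \<le> (B * (2 * \<rho>) ^ ?m) * riesz x"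
      using B(2)[of x] by (simp add: mult.assoc)
    also have "\<dots> \<le> max (?w * 2 ^ ?m * ?I) (B * (2 * \<rho>) ^ ?m) * riesz x"
      by (intro mult_right_mono) auto
    finally show ?thesis .
  qed
  then show "\<exists>C. \<forall>x::'a. x \<noteq> 0 \<longrightarrow> norm (potential_grad f x) \<le> C * riesz x" by blast
qed

end

section \<open>Positivity of the energy\<close>

text \<open>
  The terms of the Neumann series decay geometrically in \<open>N\<close>, hence in norm. In the application \<open>N\<close> is
  the sup norm plus a multiple of an \<open>L\<^sup>2\<close> norm.
\<close>
lemma neumann_series_solution:
  fixes S :: "'b::banach \<Rightarrow> 'b" and N :: "'b \<Rightarrow> real"
  assumes S: "bounded_linear S" and N: "\<And>\<psi>. norm \<psi> \<le> N \<psi>" and NS: "\<And>\<psi>. N (S \<psi>) \<le> q * N \<psi>"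
    and q: "0 \<le> q" "q < 1"
  shows "\<exists>\<phi>. \<phi> = S \<phi> + g"
proof -
  define s where "s n = (S ^^ n) g" for n
  have "N (s n) \<le> q ^ n * N g" for n
  proof (induction n)
    case (Suc n)
    have "N (s (Suc n)) \<le> q * N (s n)" using NS by (simp add: s_def)
    also have "\<dots> \<le> q * (q ^ n * N g)" using Suc q by (intro mult_left_mono) auto
    finally show ?case by (simp add: mult.assoc)
  qed (simp add: s_def)
  then have bd: "norm (s n) \<le> q ^ n * N g" for n using N order_trans by blast
  have "summable s"
    by (rule summable_comparison_test'[where N = 0, OF summable_mult2[OF summable_geometric]])
       (use q bd in auto)
  then have "suminf s = suminf (\<lambda>n. s (Suc n)) + s 0"
    using suminf_split_head by force
  also have "suminf (\<lambda>n. s (Suc n)) = S (suminf s)"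
    using bounded_linear.suminf[OF S \<open>summable s\<close>] by (simp add: s_def[abs_def])
  also have "s 0 = g" by (simp add: s_def)
  finally show ?thesis by blast
qed

text \<open>
  The quadratic polynomial \<open>a \<mapsto> \<integral> k (f - a)\<^sup>2\<close> is nonnegative.
\<close>
lemma weighted_Cauchy_Schwarz:
  fixes k f :: "'a \<Rightarrow> real"
  assumes k: "\<And>x. 0 \<le> k x" and i: "integrable M k" "integrable M (\<lambda>x. k x * f x)" "integrable M (\<lambda>x. k x * (f x)\<^sup>2)"
  shows "(\<integral>x. k x * f x \<partial>M)\<^sup>2 \<le> (\<integral>x. k x \<partial>M) * (\<integral>x. k x * (f x)\<^sup>2 \<partial>M)"
proof -
  let ?A = "\<integral>x. k x \<partial>M" and ?P = "\<integral>x. k x * f x \<partial>M" and ?Q = "\<integral>x. k x * (f x)\<^sup>2 \<partial>M"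
  have quad: "0 \<le> ?Q - 2 * a * ?P + a\<^sup>2 * ?A" for a
  proof -
    have "0 \<le> (\<integral>x. k x * (f x - a)\<^sup>2 \<partial>M)" using k by (intro integral_nonneg_AE) auto
    also have "(\<lambda>x. k x * (f x - a)\<^sup>2) = (\<lambda>x. k x * (f x)\<^sup>2 - (2 * a) * (k x * f x) + a\<^sup>2 * k x)"
      by (auto simp: power2_eq_square algebra_simps)
    also have "(\<integral>x. k x * (f x)\<^sup>2 - (2 * a) * (k x * f x) + a\<^sup>2 * k x \<partial>M) = ?Q - 2 * a * ?P + a\<^sup>2 * ?A"
      using i by simp
    finally show ?thesis .
  qed
  have A: "?A \<ge> 0" using k by (intro integral_nonneg_AE) auto
  show ?thesis
  proof (cases "?A = 0")
    case True
    have "?P = 0"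
    proof (rule ccontr)
      assume "?P \<noteq> 0"
      then show False using quad[of "(?Q + 1) / (2 * ?P)"] True by simp
    qed
    then show ?thesis using True by simp
  next
    case False
    then have "?A > 0" using A by simp
    have "0 \<le> ?Q - 2 * (?P / ?A) * ?P + (?P / ?A)\<^sup>2 * ?A" by (rule quad)
    also have "\<dots> = ?Q - ?P\<^sup>2 / ?A" using False by (simp add: power2_eq_square field_simps)
    finally show ?thesis using \<open>?A > 0\<close> by (simp add: field_simps)
  qed
qed

lemma bounded_density_lincomb:
  assumes "bounded_density f" "bounded_density g"
  shows "bounded_density (\<lambda>x. a * f x + b * g x)"
proof -
  obtain M \<rho> where f: "f \<in> borel_measurable borel" "M > 0" "\<rho> > 0" "\<And>x. \<bar>f x\<bar> \<le> M" "\<And>x. norm x > \<rho> \<Longrightarrow> f x = 0"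
    using assms(1) by (rule bounded_densityE) blast
  obtain M' \<rho>' where g: "g \<in> borel_measurable borel" "M' > 0" "\<rho>' > 0" "\<And>x. \<bar>g x\<bar> \<le> M'" "\<And>x. norm x > \<rho>' \<Longrightarrow> g x = 0"
    using assms(2) by (rule bounded_densityE) blast
  note [measurable] = f(1) g(1)
  have "\<bar>a * f x + b * g x\<bar> \<le> \<bar>a\<bar> * M + \<bar>b\<bar> * M'" for x
    using f(4)[of x] g(4)[of x]
    by (intro order_trans[OF abs_triangle_ineq] add_mono) (auto simp: abs_mult intro!: mult_left_mono)
  moreover have "a * f x + b * g x = 0" if "norm x > max \<rho> \<rho>'" for x
    using f(5)[of x] g(5)[of x] that by simp
  moreover have "(\<lambda>x. a * f x + b * g x) \<in> borel_measurable borel" by measurable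
  ultimately show ?thesis unfolding bounded_density_def by blast
qed

lemma bounded_density_indicator:
  assumes "D \<in> sets borel" "bounded D" "\<phi> \<in> borel_measurable borel" "\<And>x. x \<in> D \<Longrightarrow> \<bar>\<phi> x\<bar> \<le> M"
  shows "bounded_density (\<lambda>x::'a::euclidean_space. indicator D x * \<phi> x)"
proof -
  note [measurable] = assms(1,3)
  obtain \<rho> where \<rho>: "\<And>x. x \<in> D \<Longrightarrow> norm x \<le> \<rho>" using assms(2) bounded_iff by metis
  have "\<bar>indicator D x * \<phi> x\<bar> \<le> max M 0" for x
    using assms(4)[of x] by (auto simp: indicator_def le_max_iff_disj)
  moreover have "indicator D x * \<phi> x = 0" if "norm x > \<rho>" for x
    using \<rho>[of x] that by (auto simp: indicator_def)
  moreover have "(\<lambda>x. indicator D x * \<phi> x) \<in> borel_measurable borel" by measurable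
  ultimately show ?thesis unfolding bounded_density_def by blast
qed

context dim_ge_3
begin

text \<open>
  Insert \<open>\<zeta> = (T f) \<chi>\<close> into the weak Poisson equation, with \<open>\<chi>\<close> the bump of radius \<open>R\<close>. The term
  \<open>\<chi> |\<nabla>(T f)|\<^sup>2\<close> is nonnegative and the term with \<open>\<nabla>\<chi>\<close> is of order \<open>1 / R\<close> by the decay at
  infinity. As \<open>R\<close> grows, \<open>\<integral> f (T f) \<chi>\<close> tends to the energy.
\<close>
lemma potential_energy_nonneg:
  assumes f: "bounded_density f"
  shows "0 \<le> (LBINT (x::'a). f x * potential f x)"
proof -
  let ?w = "potential f" and ?V = "potential_grad f"
  let ?\<omega> = "unit_sphere_area DIM('a)"
  obtain C1 where C1: "\<And>x::'a. \<bar>?w x\<bar> * norm x \<le> C1" using potential_decay(1)[OF f] by blast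
  have C1': "C1 \<ge> 0" using C1[of 0] by simp
  obtain C0 where C0: "\<And>x::'a. x \<noteq> 0 \<Longrightarrow> norm (?V x) \<le> C0 * riesz x" using potential_decay(2)[OF f] by blast
  define C2 where "C2 = \<bar>C0\<bar>"
  have C2: "norm (?V x) \<le> C2 * riesz x" if "x \<noteq> 0" for x :: 'a
    using C0[OF that] mult_right_mono[OF abs_ge_self[of C0] riesz_nonneg[of x]] by (simp add: C2_def)
  have C2': "C2 \<ge> 0" by (simp add: C2_def)
  have cw: "continuous_on UNIV ?w" by (rule continuous_on_potential[OF f])
  have cV: "continuous_on UNIV ?V" by (rule potential_C1(2)[OF f])
  have fw: "integrable lborel (\<lambda>x::'a. f x * ?w x)"
  proof -
    obtain B where "\<And>x::'a. \<bar>?w x\<bar> \<le> B" using potential_bounded[OF f] by blast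
    then show ?thesis
      by (intro integrable_bounded_density bounded_density_mult[OF f borel_measurable_continuous_onI[OF cw]])
  qed
  have bound: "- (4 * C1 * C2 * ?\<omega>) / R \<le> (LBINT x. f x * (?w x * bump R x))" if R: "R > 0" for R
  proof -
    define Z where "Z x = bump R x *\<^sub>R ?V x + ?w x *\<^sub>R bump_grad R x" for x
    have contZ: "continuous_on UNIV Z"
      unfolding Z_def[abs_def] by (intro continuous_on_add continuous_on_scaleR continuous_on_bump cw cV)
    have Z0: "Z x = 0" if "norm x \<ge> R" for x using bump_outside[OF R that] by (simp add: Z_def)
    have weak: "(LBINT x. ?V x \<bullet> Z x) = (LBINT y. f y * (?w y * bump R y))"
    proof (rule potential_weak[OF f _ contZ])
      fix z :: 'a
      from has_derivative_mult[OF potential_C1(1)[OF f, of z] bump_has_derivative[of R z]]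
      show "((\<lambda>y. ?w y * bump R y) has_derivative (\<lambda>h. Z z \<bullet> h)) (at z)"
        by (simp only: Z_def inner_add_left inner_scaleR_left add.commute mult.commute)
      show "?w z * bump R z = 0" if "norm z > R" using bump_outside[OF R, of z] that by simp
      show "Z z = 0" if "norm z > R" using Z0 that by simp
    qed (rule R)
    have "AE x in lborel. x \<noteq> (0::'a)" by (rule AE_lborel_singleton)
    then have lower: "AE x in lborel. - (4 * C1 * C2 / R\<^sup>2) * (riesz x * indicator (ball 0 R) x) \<le> ?V x \<bullet> Z x"
    proof eventually_elim
      case (elim x)
      show ?case
      proof (cases "norm x < R")
        case True
        have "\<bar>?w x * (?V x \<bullet> bump_grad R x)\<bar> \<le> \<bar>?w x\<bar> * (norm (?V x) * norm (bump_grad R x))"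
          unfolding abs_mult by (intro mult_left_mono Cauchy_Schwarz_ineq2) auto
        also have "\<dots> \<le> \<bar>?w x\<bar> * ((C2 * riesz x) * (4 / R\<^sup>2 * norm x))"
          using C2' by (intro mult_left_mono mult_mono C2[OF elim] norm_bump_grad_le) auto
        also have "\<dots> = (\<bar>?w x\<bar> * norm x) * (C2 * riesz x * (4 / R\<^sup>2))" by simp
        also have "\<dots> \<le> C1 * (C2 * riesz x * (4 / R\<^sup>2))"
          using C2' by (intro mult_right_mono C1) auto
        also have "\<dots> = 4 * C1 * C2 / R\<^sup>2 * riesz x" by simp
        finally have "- (4 * C1 * C2 / R\<^sup>2 * riesz x) \<le> ?w x * (?V x \<bullet> bump_grad R x)" by linarith
        moreover have "0 \<le> bump R x * (?V x \<bullet> ?V x)" using bump_bounds(1)[of R x] by simp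
        moreover have "?V x \<bullet> Z x = bump R x * (?V x \<bullet> ?V x) + ?w x * (?V x \<bullet> bump_grad R x)"
          by (simp add: Z_def inner_add_right)
        ultimately show ?thesis using True by simp
      qed (simp add: Z0)
    qed
    have "- (4 * C1 * C2 / R\<^sup>2) * (LBINT (x::'a). riesz x * indicator (ball 0 R) x)
        = (LBINT (x::'a). - (4 * C1 * C2 / R\<^sup>2) * (riesz x * indicator (ball 0 R) x))"
      by (rule integral_mult_right_zero[symmetric])
    also have "\<dots> \<le> (LBINT x. ?V x \<bullet> Z x)"
    proof (rule integral_mono_AE[OF _ _ lower])
      show "integrable lborel (\<lambda>x::'a. - (4 * C1 * C2 / R\<^sup>2) * (riesz x * indicator (ball 0 R) x))"
        by (intro integrable_mult_right integrable_riesz_ball R)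
      show "integrable lborel (\<lambda>x. ?V x \<bullet> Z x)"
        using Z0 by (intro integrable_bounded_density bounded_density_continuous[of _ R] continuous_on_inner cV contZ) auto
    qed
    finally have "- (4 * C1 * C2 / R\<^sup>2) * (LBINT (x::'a). riesz x * indicator (ball 0 R) x) \<le> (LBINT x. f x * (?w x * bump R x))"
      unfolding weak .
    moreover have "(4 * C1 * C2 / R\<^sup>2) * (LBINT (x::'a). riesz x * indicator (ball 0 R) x) \<le> (4 * C1 * C2 / R\<^sup>2) * (?\<omega> * R)"
      using C1' C2' by (intro mult_left_mono integral_riesz_ball_le R) auto
    moreover have "(4 * C1 * C2 / R\<^sup>2) * (?\<omega> * R) = (4 * C1 * C2 * ?\<omega>) / R"
      using R by (simp add: power2_eq_square field_simps)
    ultimately show ?thesis by simp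
  qed
  define R where "R n = real n + 1" for n :: nat
  have R: "R n > 0" for n by (simp add: R_def)
  have lim1: "(\<lambda>n. - (4 * C1 * C2 * ?\<omega>) / R n) \<longlonglongrightarrow> 0"
    unfolding R_def by real_asymp
  have lim2: "(\<lambda>n. LBINT x. f x * (?w x * bump (R n) x)) \<longlonglongrightarrow> (LBINT x. f x * ?w x)"
  proof (rule integral_dominated_convergence[where w = "\<lambda>x. \<bar>f x * ?w x\<bar>"])
    note [measurable] = bounded_density_measurable[OF f] borel_measurable_continuous_onI[OF cw]
      borel_measurable_continuous_onI[OF continuous_on_bump(1)]
    show "(\<lambda>x. f x * ?w x) \<in> borel_measurable lborel" by measurable
    show "(\<lambda>x. f x * (?w x * bump (R n) x)) \<in> borel_measurable lborel" for n by measurable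
    show "integrable lborel (\<lambda>x. \<bar>f x * ?w x\<bar>)" using fw by simp
    have "(\<lambda>n. f x * (?w x * bump (R n) x)) \<longlonglongrightarrow> f x * (?w x * (max 0 1)\<^sup>2)" for x
    proof -
      have "(\<lambda>n. 1 - (x \<bullet> x) / (R n)\<^sup>2) \<longlonglongrightarrow> 1" unfolding R_def by real_asymp
      then show ?thesis unfolding bump_def by (intro tendsto_intros)
    qed
    then show "AE x in lborel. (\<lambda>n. f x * (?w x * bump (R n) x)) \<longlonglongrightarrow> f x * ?w x" by simp
    have "norm (f x * (?w x * bump (R n) x)) \<le> \<bar>f x * ?w x\<bar>" for x n
      using mult_left_mono[OF bump_bounds(2), of "\<bar>f x * ?w x\<bar>" "R n" x] bump_bounds(1)[of "R n" x]
      by (simp add: abs_mult mult.assoc)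
    then show "AE x in lborel. norm (f x * (?w x * bump (R n) x)) \<le> \<bar>f x * ?w x\<bar>" for n by simp
  qed
  show ?thesis
    by (rule LIMSEQ_le[OF lim1 lim2]) (use bound[OF R] in blast)
qed

lemma potential_lincomb:
  assumes "bounded_density f" "bounded_density g"
  shows "potential (\<lambda>y. a * f y + b * g y) (x::'a) = a * potential f x + b * potential g x"
proof -
  have "potential (\<lambda>y. a * f y + b * g y) x = (LBINT y. a * (f y * newton (x - y)) + b * (g y * newton (x - y)))"
    unfolding potential_def by (simp add: algebra_simps)
  also have "\<dots> = a * potential f x + b * potential g x"
    unfolding potential_def using integrable_potential[OF assms(1), of x] integrable_potential[OF assms(2), of x]
    by (subst Bochner_Integration.integral_add) auto
  finally show ?thesis .
qed

text \<open>
  Stated for an integrable \<open>q\<close>, whose potential need not be finite everywhere.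
\<close>
lemma potential_symmetric:
  fixes p q :: "'a \<Rightarrow> real"
  assumes p: "bounded_density p" and q: "integrable lborel q"
  shows "(LBINT x. p x * (LBINT y. q y * newton (x - y))) = (LBINT y. q y * potential p y)"
proof -
  define H where "H y x = q y * p x * newton (x - y)" for y x
  have iH: "integrable (lborel \<Otimes>\<^sub>M lborel) (case_prod H)"
    using integrable_pair_kernel[OF p q weakly_singular_newton] by (simp add: H_def[abs_def])
  have "(LBINT x. p x * (LBINT y. q y * newton (x - y))) = (LBINT x. (LBINT y. H y x))"
    by (simp add: H_def mult.assoc mult.left_commute[of "q _"])
  also have "\<dots> = (LBINT y. (LBINT x. H y x))"
    by (rule lborel_pair.Fubini_integral[OF iH])
  also have "\<dots> = (LBINT y. q y * potential p y)"
    by (simp add: H_def potential_def mult.assoc newton_def norm_minus_commute)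
  finally show ?thesis .
qed

end

section \<open>Bounded solutions of the integral equation\<close>

instance bcontfun :: (metric_space, banach) banach ..

definition restr :: "'a set \<Rightarrow> ('a \<Rightarrow> real) \<Rightarrow> 'a \<Rightarrow> real" where
  "restr D f y = indicator D y * f y"

definition l2norm :: "('a::euclidean_space \<Rightarrow> real) \<Rightarrow> real" where
  "l2norm f = sqrt (LBINT x. (f x)\<^sup>2)"

lemma l2norm_nonneg [simp]: "0 \<le> l2norm f" by (simp add: l2norm_def)

lemma l2norm_sq: "(l2norm f)\<^sup>2 = (LBINT x. (f x)\<^sup>2)"
  by (simp add: l2norm_def)

lemma bounded_density_prod:
  assumes "bounded_density f" "bounded_density g"
  shows "bounded_density (\<lambda>x. f x * g x)"
proof -
  obtain M \<rho> where "g \<in> borel_measurable borel" "\<And>x. \<bar>g x\<bar> \<le> M"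
    using assms(2) by (rule bounded_densityE) blast
  then show ?thesis by (intro bounded_density_mult[OF assms(1)])
qed

lemma bounded_density_power2: "bounded_density f \<Longrightarrow> bounded_density (\<lambda>x. (f x)\<^sup>2)"
  using bounded_density_prod[of f f] by (simp add: power2_eq_square)

context dim_ge_3
begin

lemma newton_reg_bounded:
  assumes r: "0 < r" "r \<le> 1/2"
  shows "\<exists>C\<ge>0. \<forall>z::'a. newton_reg r z \<le> C"
proof -
  obtain B where B: "\<And>z::'a. z \<in> ball 0 1 \<Longrightarrow> norm (newton_reg r z) \<le> B"
    using continuous_bounded_on_ball[OF continuous_on_newton_reg[OF r(1)]] by metis
  let ?w = "inverse (unit_sphere_area DIM('a))"
  have w: "?w > 0" using sphere_area_pos by simp
  have "newton_reg r z \<le> max B ?w" for z :: 'a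
  proof (cases "norm z < 1")
    case True
    then have "\<bar>newton_reg r z\<bar> \<le> B" using B[of z] by simp
    then show ?thesis by linarith
  next
    case False
    define n where "n = DIM('a) - 2"
    have n: "DIM('a) = Suc (Suc n)" using dim by (simp add: n_def)
    have z: "z \<noteq> 0" using False by auto
    then have e: "norm z * riesz z = inverse (norm z ^ n)" by (simp add: riesz_def n)
    have "newton_reg r z \<le> newton z" by (rule newton_reg_le[OF z r(1)])
    also have "\<dots> \<le> ?w * (norm z * riesz z)" by (rule newton_le)
    also have "\<dots> \<le> ?w * 1"
      unfolding e using False w by (intro mult_left_mono) (auto simp: inverse_le_1_iff one_le_power)
    finally show ?thesis by simp
  qed
  then show ?thesis using w by (intro exI[of _ "max B ?w"]) (auto simp: le_max_iff_disj)
qed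

text \<open>
  Replace \<open>K\<close> by its bounded regularisation: the error is at most \<open>M r\<close>. The factor \<open>r\<close> in front of the
  sup norm can be made as small as we like, at the price of a large factor in front of the
  \<open>L\<^sup>1\<close> norm.
\<close>
lemma potential_sup_bound:
  assumes r: "0 < r" "r \<le> 1/2"
  shows "\<exists>C\<ge>0. \<forall>f M. \<forall>x::'a. bounded_density f \<longrightarrow> (\<forall>x. \<bar>f x\<bar> \<le> M) \<longrightarrow> \<bar>potential f x\<bar> \<le> M * r + C * (LBINT y. \<bar>f y\<bar>)"
proof -
  obtain C where C: "C \<ge> 0" "\<And>z::'a. newton_reg r z \<le> C" using newton_reg_bounded[OF r] by blast
  have "\<bar>potential f x\<bar> \<le> M * r + C * (LBINT y. \<bar>f y\<bar>)"
    if f: "bounded_density f" and M: "\<And>x. \<bar>f x\<bar> \<le> M" for f M and x :: 'a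
  proof -
    have "norm (LBINT y. f y * newton_reg r (x - y)) \<le> (LBINT y. norm (f y * newton_reg r (x - y)))"
      by (rule integral_norm_bound)
    also have "\<dots> \<le> (LBINT y. C * \<bar>f y\<bar>)"
    proof (rule integral_mono)
      show "integrable lborel (\<lambda>y. norm (f y * newton_reg r (x - y)))"
        by (intro integrable_norm conv_newton_reg(5)[OF f r(1)])
      show "integrable lborel (\<lambda>y. C * \<bar>f y\<bar>)" using integrable_bounded_density[OF f] by simp
      fix y
      show "norm (f y * newton_reg r (x - y)) \<le> C * \<bar>f y\<bar>"
        using mult_left_mono[OF C(2)[of "x - y"] abs_ge_zero[of "f y"]] newton_reg_pos[of r "x - y"]
        by (simp add: abs_mult mult.commute[of C])
    qed
    finally show ?thesis using potential_reg_diff(1)[OF f M r, of x] by simp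
  qed
  then show ?thesis using C(1) by blast
qed

text \<open>
  Schur's test: weighted Cauchy-Schwarz with weight \<open>K (x - y)\<close>, then integration in \<open>x\<close> first.
\<close>
lemma potential_L2_bound:
  assumes D: "D \<in> sets borel" "bounded D" and \<kappa>: "\<And>x::'a. potential (indicator D) x \<le> \<kappa>"
    and f: "bounded_density f" and f0: "\<And>x. x \<notin> D \<Longrightarrow> f x = 0"
  shows "(LBINT (x::'a). (restr D (potential f) x)\<^sup>2) \<le> \<kappa>\<^sup>2 * (LBINT x. (f x)\<^sup>2)"
proof -
  note [measurable] = D(1) bounded_density_measurable[OF f] borel_measurable_newton
    borel_measurable_continuous_onI[OF continuous_on_potential[OF f]]
  have ind: "bounded_density (indicator D :: 'a \<Rightarrow> real)"
    using bounded_density_indicator[OF D, of "\<lambda>_. 1" 1] by simp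
  have f2: "bounded_density (\<lambda>x. (f x)\<^sup>2)" by (rule bounded_density_power2[OF f])
  have pos: "0 \<le> potential g x" if "\<And>y. 0 \<le> g y" for g and x :: 'a
    unfolding potential_def using that newton_nonneg by (intro integral_nonneg_AE) auto
  have \<kappa>0: "0 \<le> \<kappa>" using order_trans[OF pos \<kappa>] by simp
  have pt: "(potential f x)\<^sup>2 \<le> \<kappa> * potential (\<lambda>x. (f x)\<^sup>2) x" for x :: 'a
  proof -
    have e1: "indicator D y * newton (x - y) * f y = f y * newton (x - y)" for y
      using f0[of y] by (auto simp: indicator_def)
    have e2: "indicator D y * newton (x - y) * (f y)\<^sup>2 = (f y)\<^sup>2 * newton (x - y)" for y
      using f0[of y] by (auto simp: indicator_def)
    have "(LBINT y. indicator D y * newton (x - y) * f y)\<^sup>2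
        \<le> (LBINT y. indicator D y * newton (x - y)) * (LBINT y. indicator D y * newton (x - y) * (f y)\<^sup>2)"
    proof (rule weighted_Cauchy_Schwarz)
      show "0 \<le> indicator D y * newton (x - y)" for y using newton_nonneg by simp
    qed (use integrable_potential[OF ind] integrable_potential[OF f] integrable_potential[OF f2] in \<open>simp_all add: e1 e2\<close>)
    then have "(potential f x)\<^sup>2 \<le> potential (indicator D) x * potential (\<lambda>x. (f x)\<^sup>2) x"
      unfolding e1 e2 potential_def .
    also have "\<dots> \<le> \<kappa> * potential (\<lambda>x. (f x)\<^sup>2) x"
      by (intro mult_right_mono \<kappa> pos) auto
    finally show ?thesis .
  qed
  have c2: "continuous_on UNIV (potential (\<lambda>x::'a. (f x)\<^sup>2))" by (rule continuous_on_potential[OF f2])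
  obtain B1 where B1: "\<And>x::'a. \<bar>potential f x\<bar> \<le> B1" using potential_bounded[OF f] by blast
  obtain B2 where B2: "\<And>x::'a. \<bar>potential (\<lambda>x. (f x)\<^sup>2) x\<bar> \<le> B2" using potential_bounded[OF f2] by blast
  obtain B3 where B3: "\<And>x::'a. \<bar>potential (indicator D) x\<bar> \<le> B3" using potential_bounded[OF ind] by blast
  have "(LBINT (x::'a). (restr D (potential f) x)\<^sup>2) \<le> (LBINT x. \<kappa> * (indicator D x * potential (\<lambda>x. (f x)\<^sup>2) x))"
  proof (rule integral_mono)
    show "integrable lborel (\<lambda>x. (restr D (potential f) x)\<^sup>2)"
      unfolding restr_def
      by (rule integrable_bounded_density, rule bounded_density_power2, rule bounded_density_indicator[OF D _ B1]) measurable
    show "integrable lborel (\<lambda>x. \<kappa> * (indicator D x * potential (\<lambda>x. (f x)\<^sup>2) x))"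
      by (intro integrable_mult_right integrable_bounded_density
          bounded_density_indicator[OF D borel_measurable_continuous_onI[OF c2] B2])
    show "(restr D (potential f) x)\<^sup>2 \<le> \<kappa> * (indicator D x * potential (\<lambda>x. (f x)\<^sup>2) x)" for x
      using pt[of x] by (simp add: restr_def indicator_def)
  qed
  also have "\<dots> = \<kappa> * (LBINT x. indicator D x * potential (\<lambda>x. (f x)\<^sup>2) x)"
    by (rule integral_mult_right_zero)
  also have "(LBINT x. indicator D x * potential (\<lambda>x. (f x)\<^sup>2) x) = (LBINT y. (f y)\<^sup>2 * potential (indicator D) y)"
    using potential_symmetric[OF ind integrable_bounded_density[OF f2]] by (simp add: potential_def)
  also have "\<kappa> * (LBINT y. (f y)\<^sup>2 * potential (indicator D) y) \<le> \<kappa> * (LBINT y. (f y)\<^sup>2 * \<kappa>)"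
  proof (intro mult_left_mono \<kappa>0 integral_mono)
    show "integrable lborel (\<lambda>y. (f y)\<^sup>2 * potential (indicator D) y)"
      by (rule integrable_bounded_density, rule bounded_density_mult[OF f2 _ B3],
          intro borel_measurable_continuous_onI continuous_on_potential[OF ind])
    show "integrable lborel (\<lambda>y. (f y)\<^sup>2 * \<kappa>)"
      using integrable_bounded_density[OF f2] by simp
  qed (use \<kappa> in \<open>auto intro: mult_left_mono\<close>)
  also have "\<dots> = \<kappa>\<^sup>2 * (LBINT x. (f x)\<^sup>2)"
    by (simp add: power2_eq_square)
  finally show ?thesis .
qed

text \<open>
  Neumann series for \<open>S \<psi> = (1 - \<epsilon>) \<psi> - \<epsilon> lam T \<psi>\<close>, a fixed point of \<open>S \<psi> + \<epsilon> t\<close> being a solution.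
  Positivity of the energy removes the mixed term from the \<open>L\<^sup>2\<close> norm of \<open>S \<psi>\<close>, so \<open>S\<close> contracts that
  norm with a factor \<open>q0\<close>; the sup norm is contracted up to a multiple of the \<open>L\<^sup>2\<close> norm.
\<close>
lemma resolvent_exists:
  assumes D: "D \<in> sets borel" "bounded D" and lam: "lam > 0"
    and t: "continuous_on UNIV t" "\<And>x. \<bar>t x\<bar> \<le> Bt"
  shows "\<exists>\<psi>. continuous_on UNIV \<psi> \<and> (\<exists>B. \<forall>x. \<bar>\<psi> x\<bar> \<le> B) \<and>
     (\<forall>x::'a. \<psi> x + lam * potential (restr D \<psi>) x = t x)"
proof -
  have ind: "bounded_density (indicator D :: 'a \<Rightarrow> real)"
    using bounded_density_indicator[OF D, of "\<lambda>_. 1" 1] by simp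
  obtain \<kappa> where \<kappa>: "\<And>x::'a. potential (indicator D) x \<le> \<kappa>" 
    using potential_bounded[OF ind] abs_le_D1 by meson
  note [measurable] = D(1)
  define dn where "dn \<psi> = restr D (apply_bcontfun \<psi>)" for \<psi> :: "'a \<Rightarrow>\<^sub>C real"
  have dens: "bounded_density (dn \<psi>)" for \<psi>
    unfolding dn_def restr_def
  proof (rule bounded_density_indicator[OF D])
    show "apply_bcontfun \<psi> \<in> borel_measurable borel" by (intro borel_measurable_continuous_onI) simp
    show "\<bar>apply_bcontfun \<psi> x\<bar> \<le> norm \<psi>" for x using norm_bounded[of \<psi> x] by simp
  qed
  have dn_bd: "\<bar>dn \<psi> x\<bar> \<le> norm \<psi>" for \<psi> x
    using norm_bounded[of \<psi> x] by (auto simp: dn_def restr_def indicator_def)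
  have dn0: "dn \<psi> x = 0" if "x \<notin> D" for \<psi> x using that by (simp add: dn_def restr_def)
  define T where "T \<psi> = Bcontfun (potential (dn \<psi>))" for \<psi>
  have T: "apply_bcontfun (T \<psi>) = potential (dn \<psi>)" for \<psi>
  proof -
    obtain B where "\<And>x::'a. \<bar>potential (dn \<psi>) x\<bar> \<le> B" using potential_bounded[OF dens] by blast
    then have "potential (dn \<psi>) \<in> bcontfun"
      by (intro bcontfun_normI[of _ B] continuous_on_potential[OF dens]) auto
    then show ?thesis by (simp add: T_def Bcontfun_inverse)
  qed
  have dn_add: "dn (a + b) = (\<lambda>x. 1 * dn a x + 1 * dn b x)" for a b
    by (auto simp: dn_def restr_def fun_eq_iff algebra_simps)
  have dn_scale: "dn (c *\<^sub>R a) = (\<lambda>x. c * dn a x + 0 * dn a x)" for a c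
    by (auto simp: dn_def restr_def fun_eq_iff algebra_simps)
  have T_add: "T (a + b) = T a + T b" for a b
    by (rule bcontfun_eqI) (simp add: T dn_add potential_lincomb[OF dens dens, of 1 _ 1, simplified])
  have T_scale: "T (c *\<^sub>R a) = c *\<^sub>R T a" for a c
    by (rule bcontfun_eqI) (use potential_lincomb[OF dens dens, of c a 0 a] in \<open>simp add: T dn_scale\<close>)
  let ?V = "measure lborel D"
  have L1: "(LBINT y. \<bar>dn \<psi> y\<bar>) \<le> sqrt ?V * l2norm (dn \<psi>)" for \<psi>
  proof -
    have e: "indicator D y * \<bar>dn \<psi> y\<bar> = \<bar>dn \<psi> y\<bar>" "indicator D y * \<bar>dn \<psi> y\<bar>\<^sup>2 = (dn \<psi> y)\<^sup>2" for y
      using dn0[of y \<psi>] by (auto simp: indicator_def)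
    have "(LBINT y. indicator D y * \<bar>dn \<psi> y\<bar>)\<^sup>2 \<le> (LBINT y. indicator D y) * (LBINT y. indicator D y * \<bar>dn \<psi> y\<bar>\<^sup>2)"
    proof (rule weighted_Cauchy_Schwarz)
      show "integrable lborel (\<lambda>y. indicator D y * \<bar>dn \<psi> y\<bar>)"
        unfolding e using integrable_bounded_density[OF dens] by simp
      show "integrable lborel (\<lambda>y. indicator D y * \<bar>dn \<psi> y\<bar>\<^sup>2)"
        unfolding e by (rule integrable_bounded_density[OF bounded_density_power2[OF dens]])
    qed (use integrable_bounded_density[OF ind] in auto)
    then have "(LBINT y. \<bar>dn \<psi> y\<bar>)\<^sup>2 \<le> ?V * (LBINT y. (dn \<psi> y)\<^sup>2)"
      unfolding e by simp
    then have "sqrt ((LBINT y. \<bar>dn \<psi> y\<bar>)\<^sup>2) \<le> sqrt (?V * (LBINT y. (dn \<psi> y)\<^sup>2))"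
      by (rule real_sqrt_le_mono)
    then show ?thesis by (simp add: real_sqrt_mult l2norm_def)
  qed
  \<comment> \<open>makes lam * T shrink the sup norm by one half, up to the L2 term\<close>
  define r where "r = min (1/2) (1 / (2 * lam))"
  have r: "0 < r" "r \<le> 1/2" "lam * r \<le> 1/2" using lam by (auto simp: r_def min_def field_simps)
  obtain C where C: "C \<ge> 0" "\<And>f M x. bounded_density f \<Longrightarrow> (\<And>x. \<bar>f x\<bar> \<le> M) \<Longrightarrow> \<bar>potential f (x::'a)\<bar> \<le> M * r + C * (LBINT y. \<bar>f y\<bar>)"
    using potential_sup_bound[OF r(1,2)] by blast
  define C' where "C' = C * sqrt ?V"
  have C': "C' \<ge> 0" using C by (simp add: C'_def)
  have T_sup: "\<bar>potential (dn \<psi>) x\<bar> \<le> norm \<psi> * r + C' * l2norm (dn \<psi>)" for \<psi> x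
    using C(2)[OF dens dn_bd, of \<psi> x] mult_left_mono[OF L1 C(1), of \<psi>] by (simp add: C'_def mult.assoc)
  define s where "s = lam\<^sup>2 * \<kappa>\<^sup>2"
  have s: "s \<ge> 0" by (simp add: s_def)
  \<comment> \<open>minimises the factor (1 - eps)^2 + eps^2 * s of the squared L2 norm\<close>
  define \<epsilon> where "\<epsilon> = 1 / (1 + s)"
  have \<epsilon>: "0 < \<epsilon>" "\<epsilon> \<le> 1" using s by (auto simp: \<epsilon>_def)
  define q0 where "q0 = sqrt (s / (1 + s))"
  have q0: "0 \<le> q0" "q0 < 1" using s by (auto simp: q0_def)
  define S where "S \<psi> = (1 - \<epsilon>) *\<^sub>R \<psi> - (\<epsilon> * lam) *\<^sub>R T \<psi>" for \<psi>
  have S_l2: "l2norm (dn (S \<psi>)) \<le> q0 * l2norm (dn \<psi>)" for \<psi>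
  proof -
    let ?f = "dn \<psi>"
    let ?p = "restr D (potential ?f)"
    have pD: "bounded_density ?p"
    proof -
      obtain B where "\<And>x::'a. \<bar>potential ?f x\<bar> \<le> B" using potential_bounded[OF dens] by blast
      then show ?thesis unfolding restr_def[abs_def]
        by (intro bounded_density_indicator[OF D] borel_measurable_continuous_onI continuous_on_potential[OF dens])
    qed
    have fp: "?f x * ?p x = ?f x * potential ?f x" for x
      using dn0[of x \<psi>] by (auto simp: restr_def indicator_def)
    have "(LBINT x. (dn (S \<psi>) x)\<^sup>2) = (LBINT x. (1 - \<epsilon>)\<^sup>2 * (?f x)\<^sup>2 - (2 * (1 - \<epsilon>) * \<epsilon> * lam) * (?f x * potential ?f x) + (\<epsilon>\<^sup>2 * lam\<^sup>2) * (?p x)\<^sup>2)"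
    proof (rule Bochner_Integration.integral_cong[OF refl])
      fix x
      have E: "dn (S \<psi>) x = (1 - \<epsilon>) * ?f x - \<epsilon> * lam * ?p x"
        by (simp add: dn_def restr_def S_def T algebra_simps)
      show "(dn (S \<psi>) x)\<^sup>2 = (1 - \<epsilon>)\<^sup>2 * (?f x)\<^sup>2 - (2 * (1 - \<epsilon>) * \<epsilon> * lam) * (?f x * potential ?f x) + (\<epsilon>\<^sup>2 * lam\<^sup>2) * (?p x)\<^sup>2"
        unfolding E fp[symmetric] by (simp add: power2_eq_square algebra_simps)
    qed
    also have "\<dots> = (1 - \<epsilon>)\<^sup>2 * (LBINT x. (?f x)\<^sup>2) - (2 * (1 - \<epsilon>) * \<epsilon> * lam) * (LBINT x. ?f x * potential ?f x) + (\<epsilon>\<^sup>2 * lam\<^sup>2) * (LBINT x. (?p x)\<^sup>2)"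
    proof -
      have i: "integrable lborel (\<lambda>x. (?f x)\<^sup>2)" "integrable lborel (\<lambda>x. ?f x * potential ?f x)" "integrable lborel (\<lambda>x. (?p x)\<^sup>2)"
        using integrable_bounded_density[OF bounded_density_power2[OF dens]] integrable_bounded_density[OF bounded_density_power2[OF pD]]
          integrable_bounded_density[OF bounded_density_prod[OF dens[of \<psi>] pD], unfolded fp] by simp_all
      show ?thesis using i by simp
    qed
    also have "\<dots> \<le> (1 - \<epsilon>)\<^sup>2 * (l2norm ?f)\<^sup>2 - 0 + (\<epsilon>\<^sup>2 * lam\<^sup>2) * (\<kappa>\<^sup>2 * (l2norm ?f)\<^sup>2)"
      unfolding l2norm_sq
      using potential_L2_bound[OF D \<kappa> dens dn0, of \<psi>] potential_energy_nonneg[OF dens, of \<psi>] \<epsilon> lam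
      by (intro add_mono diff_mono mult_left_mono order_refl mult_nonneg_nonneg) auto
    also have "\<dots> = ((1 - \<epsilon>)\<^sup>2 + \<epsilon>\<^sup>2 * s) * (l2norm ?f)\<^sup>2"
      by (simp add: s_def algebra_simps)
    also have "(1 - \<epsilon>)\<^sup>2 + \<epsilon>\<^sup>2 * s = s / (1 + s)"
    proof -
      have "1 + s \<noteq> 0" using s by simp
      then have "1 - \<epsilon> = s / (1 + s)" by (simp add: \<epsilon>_def field_simps)
      then have "(1 - \<epsilon>)\<^sup>2 + \<epsilon>\<^sup>2 * s = (s * s + s) / ((1 + s) * (1 + s))"
        by (simp add: \<epsilon>_def power2_eq_square add_divide_distrib)
      also have "s * s + s = s * (1 + s)" by (simp add: algebra_simps)
      finally show ?thesis using \<open>1 + s \<noteq> 0\<close> by simp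
    qed
    finally have "sqrt (LBINT x. (dn (S \<psi>) x)\<^sup>2) \<le> sqrt (s / (1 + s) * (l2norm ?f)\<^sup>2)"
      by (rule real_sqrt_le_mono)
    then show ?thesis
      unfolding l2norm_def[of "dn (S \<psi>)"] q0_def real_sqrt_mult
      by (simp only: real_sqrt_abs abs_of_nonneg l2norm_nonneg)
  qed
  have S_sup: "norm (S \<psi>) \<le> (1 - \<epsilon> / 2) * norm \<psi> + \<epsilon> * lam * C' * l2norm (dn \<psi>)" for \<psi>
  proof (rule norm_bound)
    fix x
    have "norm (apply_bcontfun (S \<psi>) x) \<le> (1 - \<epsilon>) * \<bar>apply_bcontfun \<psi> x\<bar> + \<epsilon> * lam * \<bar>potential (dn \<psi>) x\<bar>"
      using \<epsilon> lam abs_triangle_ineq4[of "(1 - \<epsilon>) * apply_bcontfun \<psi> x" "\<epsilon> * lam * potential (dn \<psi>) x"]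
      by (simp add: S_def T abs_mult)
    also have "\<dots> \<le> (1 - \<epsilon>) * norm \<psi> + \<epsilon> * lam * (norm \<psi> * r + C' * l2norm (dn \<psi>))"
      using \<epsilon> lam norm_bounded[of \<psi> x] by (intro add_mono mult_left_mono T_sup) auto
    also have "\<dots> = (1 - \<epsilon>) * norm \<psi> + \<epsilon> * norm \<psi> * (lam * r) + \<epsilon> * lam * C' * l2norm (dn \<psi>)"
      by (simp add: algebra_simps)
    also have "\<dots> \<le> (1 - \<epsilon>) * norm \<psi> + \<epsilon> * norm \<psi> * (1/2) + \<epsilon> * lam * C' * l2norm (dn \<psi>)"
      using \<epsilon> r by (intro add_right_mono add_left_mono mult_left_mono) auto
    finally show "norm (apply_bcontfun (S \<psi>) x) \<le> (1 - \<epsilon> / 2) * norm \<psi> + \<epsilon> * lam * C' * l2norm (dn \<psi>)"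
      by (simp add: algebra_simps)
  qed
  \<comment> \<open>with this weight, half of the gap 1 - q0 pays for the L2 term in the sup norm estimate\<close>
  define A where "A = 2 * (\<epsilon> * lam * C') / (1 - q0)"
  have A: "A \<ge> 0" using \<epsilon> lam C' q0 by (simp add: A_def)
  have A': "\<epsilon> * lam * C' = A * (1 - q0) / 2" using q0 by (simp add: A_def)
  define N where "N \<psi> = norm \<psi> + A * l2norm (dn \<psi>)" for \<psi>
  define q where "q = max (1 - \<epsilon> / 2) ((1 + q0) / 2)"
  have l2bound: "l2norm (dn \<psi>) \<le> sqrt ?V * norm \<psi>" for \<psi>
  proof -
    have "(LBINT x. (dn \<psi> x)\<^sup>2) \<le> (LBINT x. indicator D x * (norm \<psi>)\<^sup>2)"
    proof (rule integral_mono)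
      show "integrable lborel (\<lambda>x. (dn \<psi> x)\<^sup>2)" by (intro integrable_bounded_density bounded_density_power2 dens)
      show "integrable lborel (\<lambda>x::'a. indicator D x * (norm \<psi>)\<^sup>2)"
        using integrable_bounded_density[OF ind] by simp
      show "(dn \<psi> x)\<^sup>2 \<le> indicator D x * (norm \<psi>)\<^sup>2" for x
        using power_mono[OF dn_bd[of \<psi> x] abs_ge_zero, of 2] dn0[of x \<psi>] by (cases "x \<in> D") auto
    qed
    also have "\<dots> = ?V * (norm \<psi>)\<^sup>2" by simp
    finally show ?thesis unfolding l2norm_def using real_sqrt_le_mono by (fastforce simp: real_sqrt_mult)
  qed
  have linS: "S (a + b) = S a + S b" "S (c *\<^sub>R a) = c *\<^sub>R S a" for a b c
    by (simp_all add: S_def T_add T_scale algebra_simps)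
  have "bounded_linear S"
  proof (rule bounded_linear_intro[where K = "(1 - \<epsilon> / 2) + \<epsilon> * lam * C' * sqrt ?V"])
    fix \<psi>
    have "\<epsilon> * lam * C' * l2norm (dn \<psi>) \<le> \<epsilon> * lam * C' * (sqrt ?V * norm \<psi>)"
      using \<epsilon> lam C' by (intro mult_left_mono l2bound) auto
    then show "norm (S \<psi>) \<le> norm \<psi> * ((1 - \<epsilon> / 2) + \<epsilon> * lam * C' * sqrt ?V)"
      using S_sup[of \<psi>] by (simp add: algebra_simps)
  qed (rule linS)+
  moreover have "norm \<psi> \<le> N \<psi>" for \<psi> using A by (simp add: N_def)
  moreover have "N (S \<psi>) \<le> q * N \<psi>" for \<psi>
  proof -
    have "N (S \<psi>) \<le> (1 - \<epsilon> / 2) * norm \<psi> + A * (1 - q0) / 2 * l2norm (dn \<psi>) + A * (q0 * l2norm (dn \<psi>))"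
      unfolding N_def A'[symmetric] using S_sup[of \<psi>] A by (intro add_mono mult_left_mono S_l2) auto
    also have "\<dots> = (1 - \<epsilon> / 2) * norm \<psi> + (1 + q0) / 2 * (A * l2norm (dn \<psi>))"
      by (simp add: field_simps)
    also have "\<dots> \<le> q * norm \<psi> + q * (A * l2norm (dn \<psi>))"
      using A by (intro add_mono mult_right_mono) (auto simp: q_def)
    also have "\<dots> = q * N \<psi>" by (simp add: N_def algebra_simps)
    finally show ?thesis .
  qed
  moreover have "0 \<le> q" "q < 1" using \<epsilon> q0 by (auto simp: q_def le_max_iff_disj)
  moreover have tb: "t \<in> bcontfun" using t by (intro bcontfun_normI[of _ Bt]) auto
  ultimately obtain \<psi> where \<psi>: "\<psi> = S \<psi> + \<epsilon> *\<^sub>R Bcontfun t"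
    using neumann_series_solution[of S N q "\<epsilon> *\<^sub>R Bcontfun t"] by blast
  have "apply_bcontfun \<psi> x + lam * potential (restr D (apply_bcontfun \<psi>)) x = t x" for x
  proof -
    have "apply_bcontfun \<psi> x = apply_bcontfun (S \<psi> + \<epsilon> *\<^sub>R Bcontfun t) x" using \<psi> by simp
    also have "\<dots> = (1 - \<epsilon>) * apply_bcontfun \<psi> x - \<epsilon> * lam * potential (dn \<psi>) x + \<epsilon> * t x"
      using tb by (simp add: S_def T Bcontfun_inverse)
    finally have "\<epsilon> * (apply_bcontfun \<psi> x + lam * potential (dn \<psi>) x) = \<epsilon> * t x"
      by (simp add: algebra_simps)
    then show ?thesis using \<epsilon> by (simp add: dn_def)
  qed
  moreover have "\<bar>apply_bcontfun \<psi> x\<bar> \<le> norm \<psi>" for x using norm_bounded[of \<psi> x] by simp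
  ultimately show ?thesis
    by (intro exI[of _ "apply_bcontfun \<psi>"]) auto
qed

text \<open>
  A solution \<open>\<psi>\<close> for the continuous right-hand side \<open>T g\<close> yields \<open>\<phi> = g - lam \<psi>\<close>, because then
  \<open>T \<phi> = T g - lam T \<psi> = \<psi>\<close>. In this way \<open>g\<close> may be discontinuous, as required by the sign
  function in the uniqueness proof.
\<close>
lemma integral_equation_solvable:
  assumes D: "D \<in> sets borel" "bounded D" and lam: "lam > 0"
    and g: "bounded_density g" and g0: "\<And>x. x \<notin> D \<Longrightarrow> g x = 0"
  shows "\<exists>\<phi>. bounded_density \<phi> \<and> (\<forall>x. x \<notin> D \<longrightarrow> \<phi> x = 0) \<and>
     (\<forall>x::'a. x \<in> D \<longrightarrow> \<phi> x + lam * potential \<phi> x = g x)"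
proof -
  obtain B where "\<And>x::'a. \<bar>potential g x\<bar> \<le> B" using potential_bounded[OF g] by blast
  from resolvent_exists[OF D lam continuous_on_potential[OF g] this]
  obtain \<psi> B' where \<psi>: "continuous_on UNIV \<psi>" "\<And>x. \<bar>\<psi> x\<bar> \<le> B'"
      "\<And>x. \<psi> x + lam * potential (restr D \<psi>) x = potential g x" by blast
  have d: "bounded_density (restr D \<psi>)"
    unfolding restr_def[abs_def] by (rule bounded_density_indicator[OF D borel_measurable_continuous_onI[OF \<psi>(1)] \<psi>(2)])
  define \<phi> where "\<phi> x = 1 * g x + (- lam) * restr D \<psi> x" for x
  have "bounded_density \<phi>" unfolding \<phi>_def[abs_def] by (rule bounded_density_lincomb[OF g d])
  moreover have "\<phi> x = 0" if "x \<notin> D" for x using g0 that by (simp add: \<phi>_def restr_def)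
  moreover have "potential \<phi> x = \<psi> x" for x
    using potential_lincomb[OF g d, of 1 "- lam" x] \<psi>(3)[of x] by (simp add: \<phi>_def[abs_def])
  then have "\<phi> x + lam * potential \<phi> x = g x" if "x \<in> D" for x
    using that by (simp add: \<phi>_def restr_def)
  ultimately show ?thesis by blast
qed

end

section \<open>Second derivatives and the Poisson equation\<close>

context dim_ge_3
begin

text \<open>
  Split \<open>\<nabla>K = \<nabla>K\<^sub>r + (\<nabla>K - \<nabla>K\<^sub>r)\<close>. The first kernel is \<open>C\<^sup>1\<close>, so the derivative falls on it. The
  second is integrable and supported in a small ball, so near \<open>x0\<close> the convolution sees only the
  part of the density where it is \<open>C\<^sup>1\<close>, and the derivative falls on the density.
\<close>
lemma potential_C2:
  fixes f :: "'a \<Rightarrow> real"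
  assumes f: "bounded_density f" and D: "open D" "x0 \<in> D"
    and der: "\<And>x. x \<in> D \<Longrightarrow> (f has_derivative (\<lambda>h. G x \<bullet> h)) (at x)" and G: "continuous_on D G"
  shows "\<exists>s>0. ball x0 s \<subseteq> D \<and> (\<exists>H. \<forall>b\<in>Basis. continuous_on (ball x0 s) (H b) \<and>
     (\<forall>x\<in>ball x0 s. ((\<lambda>x. potential_grad f x \<bullet> b) has_derivative (\<lambda>h. H b x \<bullet> h)) (at x)))"
proof -
  obtain r0 where r0: "r0 > 0" "cball x0 r0 \<subseteq> D" using D open_contains_cball by blast
  \<comment> \<open>small enough for the ball of radius s + r around x0 to remain in D\<close>
  define r where "r = min (r0 / 4) (1 / 2)"
  define s where "s = r0 / 4"
  have r: "0 < r" "r \<le> 1/2" and s: "s > 0" and sr: "s + r \<le> r0" using r0 by (auto simp: r_def s_def)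
  define G' where "G' z = indicator (ball x0 r0) z *\<^sub>R G z" for z
  have sub: "ball x0 r0 \<subseteq> D" using r0 ball_subset_cball by blast
  have G'm: "G' \<in> borel_measurable borel"
    unfolding G'_def[abs_def]
    by (rule borel_measurable_continuous_on_indicator) (use sub in \<open>auto intro: continuous_on_subset[OF G]\<close>)
  have sub': "ball x0 (s + r) \<subseteq> ball x0 r0" using sr by (simp add: subset_ball)
  have cG': "continuous_on (ball x0 (s + r)) G'"
    by (rule continuous_on_cong[THEN iffD1, OF refl _ continuous_on_subset[OF G]])
       (use sub sub' in \<open>auto simp: G'_def indicator_def\<close>)
  obtain B where B: "\<And>z. z \<in> cball x0 r0 \<Longrightarrow> norm (G z) \<le> B"
  proof -
    have "compact (G ` cball x0 r0)"
      using continuous_on_subset[OF G r0(2)] by (intro compact_continuous_image) auto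
    then show thesis using that compact_imp_bounded bounded_iff by (metis imageI)
  qed
  obtain M where M: "\<And>x. \<bar>f x\<bar> \<le> M" using f by (auto simp: bounded_density_def)
  have B': "norm (G' z) \<le> max B M" "\<bar>f z\<bar> \<le> max B M" if "z \<in> ball x0 (s + r)" for z
    using B[of z] M[of z] that sub' by (auto simp: G'_def indicator_def le_max_iff_disj)
  have der': "(f has_derivative (\<lambda>h. G' z \<bullet> h)) (at z)" if "z \<in> ball x0 (s + r)" for z
  proof -
    have "z \<in> ball x0 r0" using that sub' by blast
    then show ?thesis using der[of z] sub by (auto simp: G'_def)
  qed
  define k where "k b z = (newton_grad z - newton_reg_grad r z) \<bullet> b" for b z :: 'a
  have k: "integrable lborel (k b)" "\<And>z. norm z > r \<Longrightarrow> k b z = 0" if "b \<in> Basis" for b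
  proof -
    show k0: "\<And>z. norm z > r \<Longrightarrow> k b z = 0" by (simp add: k_def newton_reg_eq[OF r(1)])
    show "integrable lborel (k b)"
    proof (rule Bochner_Integration.integrable_bound)
      show "integrable lborel (\<lambda>z::'a. 2 * inverse (unit_sphere_area DIM('a)) * (riesz z * indicator (ball 0 r) z))"
        by (intro integrable_mult_right integrable_riesz_ball r)
      show "k b \<in> borel_measurable lborel"
        unfolding k_def using borel_measurable_newton_grad
          borel_measurable_continuous_onI[OF continuous_on_newton_reg_grad[OF r(1)]] by measurable
      have "norm (k b z) \<le> norm (2 * inverse (unit_sphere_area DIM('a)) * (riesz z * indicator (ball 0 r) z))" for z
      proof -
        have "norm (k b z) \<le> norm (newton_grad z - newton_reg_grad r z) * norm b"
          unfolding k_def real_norm_def by (rule Cauchy_Schwarz_ineq2)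
        also have "\<dots> = norm (newton_reg_grad r z - newton_grad z)" using that by (simp add: norm_minus_commute)
        also note newton_reg_grad_diff_le[OF r, of z]
        also note abs_ge_self
        finally show ?thesis by simp
      qed
      then show "AE z in lborel. norm (k b z) \<le> norm (2 * inverse (unit_sphere_area DIM('a)) * (riesz z * indicator (ball 0 r) z))"
        by simp
    qed
  qed
  have split: "potential_grad f x \<bullet> b = conv f (newton_reg_grad r) x \<bullet> b + (LBINT z. k b z * f (x - z))" for x b
  proof -
    have "potential_grad f x - (conv f (newton_reg_grad r) x)
       = (LBINT y. f y *\<^sub>R newton_grad (x - y) - f y *\<^sub>R newton_reg_grad r (x - y))"
      unfolding potential_grad_def
      by (rule Bochner_Integration.integral_diff[symmetric, OF integrable_potential_grad[OF f] conv_newton_reg(6)[OF f r(1)]])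
    then have "(potential_grad f x - conv f (newton_reg_grad r) x) \<bullet> b
       = (LBINT y. (f y *\<^sub>R newton_grad (x - y) - f y *\<^sub>R newton_reg_grad r (x - y)) \<bullet> b)"
      using integral_inner_left[OF Bochner_Integration.integrable_diff[OF integrable_potential_grad[OF f, of x] conv_newton_reg(6)[OF f r(1), of x]], of b]
      by simp
    also have "\<dots> = (LBINT y. k b (x - y) * f y)"
      by (intro Bochner_Integration.integral_cong refl) (simp add: k_def inner_diff_left algebra_simps)
    also have "\<dots> = (LBINT z. k b z * f (x - z))"
      using lborel_integral_reflect[of "\<lambda>z. k b z * f (x - z)" x] by simp
    finally show ?thesis by (simp add: inner_diff_left)
  qed
  define H where "H b x = (conv f (newton_reg_hess r b) x) + (conv (k b) G' x)" for b x
  have "continuous_on (ball x0 s) (H b) \<and>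
     (\<forall>x\<in>ball x0 s. ((\<lambda>x. potential_grad f x \<bullet> b) has_derivative (\<lambda>h. H b x \<bullet> h)) (at x))" if b: "b \<in> Basis" for b
  proof (intro conjI ballI)
    show "continuous_on (ball x0 s) (H b)"
      unfolding H_def[abs_def]
      by (intro continuous_on_add continuous_on_conv[OF k(1)[OF b] G'm k(2)[OF b] B'(1) cG']
           continuous_at_imp_continuous_on ballI conv_newton_reg(4)[OF f r(1)])
    fix x assume x: "x \<in> ball x0 s"
    have 1: "((\<lambda>x. LBINT z. k b z * f (x - z)) has_derivative (\<lambda>h. conv (k b) G' x \<bullet> h)) (at x)"
      by (rule conv_has_gradient[OF k(1)[OF b] bounded_density_measurable[OF f] G'm k(2)[OF b] der' B'(2,1) x])
    from has_derivative_add[OF conv_newton_reg(2)[OF f r(1), of b x] 1]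
    show "((\<lambda>x. potential_grad f x \<bullet> b) has_derivative (\<lambda>h. H b x \<bullet> h)) (at x)"
      unfolding split[abs_def] H_def inner_add_left .
  qed
  moreover have "ball x0 s \<subseteq> D" using sub sub' r s by (auto simp: subset_iff)
  ultimately show ?thesis using s by blast
qed

text \<open>
  If the equation failed at \<open>x0\<close>, the error \<open>e\<close> would have a fixed sign on a small ball. Integrating by
  parts in the weak identity with a bump supported in that ball shows that the integral of the bump
  times \<open>e\<close> vanishes, a contradiction.
\<close>
lemma poisson_equation:
  fixes f :: "'a \<Rightarrow> real"
  assumes f: "bounded_density f" and s: "s > 0" and fc: "continuous_on (ball x0 s) f"
    and Hc: "\<And>b. b \<in> Basis \<Longrightarrow> continuous_on (ball x0 s) (H b)"
    and Hd: "\<And>b x. b \<in> Basis \<Longrightarrow> x \<in> ball x0 s \<Longrightarrow> ((\<lambda>x. potential_grad f x \<bullet> b) has_derivative (\<lambda>h. H b x \<bullet> h)) (at x)"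
  shows "(\<Sum>b\<in>Basis. H b x0 \<bullet> b) = - f x0"
proof (rule ccontr)
  let ?V = "potential_grad f"
  define e where "e x = (\<Sum>b\<in>Basis. H b x \<bullet> b) + f x" for x
  assume "(\<Sum>b\<in>Basis. H b x0 \<bullet> b) \<noteq> - f x0"
  then have e0: "e x0 \<noteq> 0" by (simp add: e_def)
  define \<sigma> where "\<sigma> = sgn (e x0)"
  have ce: "continuous_on (ball x0 s) (\<lambda>x. \<sigma> * e x)"
    unfolding e_def by (intro continuous_on_mult continuous_on_const continuous_on_add continuous_on_sum continuous_on_inner Hc fc)
  have "\<sigma> * e x0 > 0" using e0 by (simp add: \<sigma>_def sgn_if)
  moreover have "isCont (\<lambda>x. \<sigma> * e x) x0" using ce s continuous_on_eq_continuous_at[OF open_ball] by (metis centre_in_ball)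
  ultimately have "\<forall>\<^sub>F x in at x0. \<sigma> * e x > 0"
    unfolding isCont_def by (rule order_tendstoD(1)[rotated])
  then obtain d where d: "d > 0" "\<And>x. x \<noteq> x0 \<Longrightarrow> dist x x0 < d \<Longrightarrow> \<sigma> * e x > 0"
    unfolding eventually_at by blast
  define R where "R = min d (s / 2)"
  have R: "R > 0" "R < s" "R \<le> d" using d s by (auto simp: R_def)
  have epos: "\<sigma> * e x > 0" if "x \<in> ball x0 R" for x
    using d(2)[of x] that R \<open>\<sigma> * e x0 > 0\<close> by (cases "x = x0") (auto simp: dist_commute)
  define \<zeta> where "\<zeta> x = bump R (x - x0)" for x
  define Z where "Z x = bump_grad R (x - x0)" for x
  have der: "(\<zeta> has_derivative (\<lambda>h. Z x \<bullet> h)) (at x)" for x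
  proof -
    have "((\<lambda>x. x - x0) has_derivative (\<lambda>h. h)) (at x)" by (intro derivative_eq_intros) auto
    from has_derivative_compose[OF this bump_has_derivative] show ?thesis
      unfolding \<zeta>_def[abs_def] Z_def .
  qed
  have Zc: "continuous_on UNIV Z" unfolding Z_def[abs_def]
    by (rule continuous_on_compose2[OF continuous_on_bump(2)[of UNIV]]) (auto intro!: continuous_intros)
  have \<zeta>c: "continuous_on UNIV \<zeta>"
    by (intro continuous_at_imp_continuous_on ballI has_derivative_continuous[OF der])
  have out: "\<zeta> x = 0" "Z x = 0" if "x \<notin> ball x0 R" for x
    using bump_outside[OF R(1), of "x - x0"] that by (auto simp: \<zeta>_def Z_def dist_norm norm_minus_commute)
  have far: "x \<notin> ball x0 s" "x \<notin> ball x0 R" if "norm x > norm x0 + s" for x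
    using that norm_triangle_ineq2[of x x0] R by (auto simp: dist_norm norm_minus_commute)
  have S: "norm x0 + s > 0" using s by (simp add: add_nonneg_pos)
  have weak: "(LBINT x. ?V x \<bullet> Z x) = (LBINT y. f y * \<zeta> y)"
    by (rule potential_weak[OF f der Zc _ _ S]) (use out far in auto)
  \<comment> \<open>gradient of the product of a component of the gradient field with the bump, extended by 0\<close>
  define K where "K b x = (if x \<in> ball x0 s then \<zeta> x *\<^sub>R H b x + (?V x \<bullet> b) *\<^sub>R Z x else 0)" for b x
  have Vc: "continuous_on UNIV ?V" by (rule potential_C1(2)[OF f])
  have cover: "x \<in> ball x0 s \<or> x \<in> - cball x0 R" for x using R by auto
  have Kzero: "K b x = 0" if "x \<in> - cball x0 R" for b x using out[of x] that by (auto simp: K_def)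
  have Kd: "((\<lambda>x. (?V x \<bullet> b) * \<zeta> x) has_derivative (\<lambda>h. K b x \<bullet> h)) (at x)" if b: "b \<in> Basis" for b x
  proof (cases "x \<in> ball x0 s")
    case True
    from has_derivative_mult[OF Hd[OF b True] der[of x]]
    show ?thesis using True by (simp add: K_def inner_add_left add.commute mult.commute)
  next
    case False
    then have x: "x \<in> - cball x0 R" using cover by blast
    have "((\<lambda>x. (?V x \<bullet> b) * \<zeta> x) has_derivative (\<lambda>h. 0)) (at x)"
      by (rule has_derivative_transform_within_open[OF has_derivative_const[of 0] open_Compl[OF closed_cball] x])
         (use out in auto)
    then show ?thesis using Kzero[OF x] by simp
  qed
  have Kc: "continuous_on UNIV (K b)" if b: "b \<in> Basis" for b
  proof -
    have "continuous_on (ball x0 s) (K b)"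
    proof (rule continuous_on_cong[THEN iffD1, OF refl])
      show "continuous_on (ball x0 s) (\<lambda>x. \<zeta> x *\<^sub>R H b x + (?V x \<bullet> b) *\<^sub>R Z x)"
        using continuous_on_subset[OF \<zeta>c] continuous_on_subset[OF Vc] continuous_on_subset[OF Zc]
        by (intro continuous_on_add continuous_on_scaleR continuous_on_inner continuous_on_const Hc[OF b]) auto
    qed (simp add: K_def)
    moreover have "continuous_on (- cball x0 R) (K b)"
      by (rule continuous_on_cong[THEN iffD1, OF refl _ continuous_on_const[of _ 0]]) (simp add: Kzero)
    ultimately have "continuous_on (ball x0 s \<union> - cball x0 R) (K b)"
      by (intro continuous_on_open_Un) auto
    moreover have "ball x0 s \<union> - cball x0 R = UNIV"
      by (rule UNIV_eq_I[symmetric]) (use cover in blast)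
    ultimately show ?thesis by simp
  qed
  have Kfar: "K b x = 0" if "norm x > norm x0 + s" for b x using far[OF that] by (simp add: K_def)
  have Kint: "(LBINT x. K b x \<bullet> b) = 0" and Ki: "integrable lborel (\<lambda>x. K b x \<bullet> b)" if b: "b \<in> Basis" for b
  proof -
    have i: "integrable lborel (\<lambda>x. K b x \<bullet> b')" for b'
      by (intro integrable_bounded_density bounded_density_continuous[of _ "norm x0 + s"] continuous_on_inner Kc b continuous_on_const)
         (simp add: Kfar)
    show "integrable lborel (\<lambda>x. K b x \<bullet> b)" by (rule i)
    have "(LBINT x. K b x) = 0"
      by (rule integral_gradient_eq_0[OF Kd[OF b] Kc[OF b] _ Kfar S]) (use out far in auto)
    moreover have "integrable lborel (K b)"
    proof -
      have "integrable lborel (\<lambda>x. \<Sum>b'\<in>Basis. (K b x \<bullet> b') *\<^sub>R b')"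
        by (intro Bochner_Integration.integrable_sum integrable_scaleR_left i)
      then show ?thesis by (simp add: euclidean_representation)
    qed
    ultimately show "(LBINT x. K b x \<bullet> b) = 0"
      using integral_inner_left[of b lborel "K b"] by simp
  qed
  \<comment> \<open>equals the bump times e, written as a sum of globally integrable terms\<close>
  define E where "E x = (\<Sum>b\<in>Basis. K b x \<bullet> b) - ?V x \<bullet> Z x + f x * \<zeta> x" for x
  have iVZ: "integrable lborel (\<lambda>x. ?V x \<bullet> Z x)"
    by (intro integrable_bounded_density bounded_density_continuous[of _ "norm x0 + s"] continuous_on_inner Vc Zc)
       (use out far in auto)
  have if\<zeta>: "integrable lborel (\<lambda>x. f x * \<zeta> x)"
    by (intro integrable_bounded_density bounded_density_prod f bounded_density_continuous[OF \<zeta>c, of "norm x0 + s"])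
       (use out far in auto)
  have iE: "integrable lborel E"
    unfolding E_def[abs_def] by (intro Bochner_Integration.integrable_add Bochner_Integration.integrable_diff iVZ if\<zeta> Bochner_Integration.integrable_sum Ki)
  have "(LBINT x. E x) = 0"
  proof -
    have "(LBINT x. E x) = (\<Sum>b\<in>Basis. (LBINT x. K b x \<bullet> b)) - (LBINT x. ?V x \<bullet> Z x) + (LBINT x. f x * \<zeta> x)"
      unfolding E_def using Ki iVZ if\<zeta>
      by (subst Bochner_Integration.integral_add Bochner_Integration.integral_diff Bochner_Integration.integral_sum; auto)+
    then show ?thesis using Kint weak by simp
  qed
  then have "(LBINT x. \<sigma> * E x) = 0" by simp
  have Eeq: "E x = \<zeta> x * e x" if "x \<in> ball x0 s" for x
  proof -
    have "(\<Sum>b\<in>Basis. K b x \<bullet> b) = \<zeta> x * (\<Sum>b\<in>Basis. H b x \<bullet> b) + (\<Sum>b\<in>Basis. (?V x \<bullet> b) * (Z x \<bullet> b))"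
      using that by (simp add: K_def inner_add_left sum.distrib sum_distrib_left)
    also have "(\<Sum>b\<in>Basis. (?V x \<bullet> b) * (Z x \<bullet> b)) = ?V x \<bullet> Z x" by (rule euclidean_inner[symmetric])
    finally show ?thesis by (simp add: E_def e_def algebra_simps)
  qed
  have E0: "E x = 0" if "x \<notin> ball x0 R" for x
  proof (cases "x \<in> ball x0 s")
    case False then show ?thesis using out[OF that] by (simp add: E_def K_def)
  qed (use out[OF that] Eeq in simp)
  have Epos: "\<sigma> * E x > 0" if "x \<in> ball x0 R" for x
  proof -
    have "x \<in> ball x0 s" using that R by auto
    moreover have "\<zeta> x > 0" unfolding \<zeta>_def
      using that by (intro bump_pos R) (auto simp: dist_norm norm_minus_commute)
    ultimately show ?thesis using Eeq[of x] mult_pos_pos[OF _ epos[OF that], of "\<zeta> x"] by (simp add: mult.left_commute)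
  qed
  have "AE x in lborel. \<sigma> * E x = 0"
  proof (rule integral_nonneg_eq_0_iff_AE[THEN iffD1])
    show "integrable lborel (\<lambda>x. \<sigma> * E x)" using iE by simp
    have "0 \<le> \<sigma> * E x" for x using Epos[of x] E0[of x] by (cases "x \<in> ball x0 R") auto
    then show "AE x in lborel. 0 \<le> \<sigma> * E x" by simp
  qed fact
  then have "AE x in lborel. x \<notin> ball x0 R" by eventually_elim (use Epos in force)
  then have "ball x0 R \<in> null_sets lborel" by (subst AE_iff_null_sets) auto
  then have "emeasure lborel (ball x0 R) = 0" by auto
  moreover have "unit_ball_vol (real DIM('a)) \<noteq> 0"
    using unit_ball_vol_pos[of "real DIM('a)"] by (metis of_nat_0_le_iff order_less_irrefl)
  ultimately show False using R by (simp add: emeasure_ball)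
qed

end

section \<open>Square integrable solutions and the regularity theorem\<close>

lemma lebesgue_on_borel_iff:
  fixes f :: "'a::euclidean_space \<Rightarrow> real"
  assumes [measurable]: "D \<in> sets borel" "f \<in> borel_measurable borel"
  shows "integrable (lebesgue_on D) f \<longleftrightarrow> integrable lborel (\<lambda>x. indicator D x * f x)"
    and "(\<integral>x. f x \<partial>lebesgue_on D) = (LBINT x. indicator D x * f x)"
    and "f \<in> borel_measurable (lebesgue_on D)"
proof -
  have m: "(\<lambda>x. indicator D x *\<^sub>R f x) \<in> borel_measurable lborel" by measurable
  have D: "D \<inter> space lebesgue \<in> sets lebesgue" using assms by simp
  show "integrable (lebesgue_on D) f \<longleftrightarrow> integrable lborel (\<lambda>x. indicator D x * f x)"
    unfolding integrable_restrict_space[OF D] integrable_completion[OF m] by simp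
  show "(\<integral>x. f x \<partial>lebesgue_on D) = (LBINT x. indicator D x * f x)"
    unfolding integral_restrict_space[OF D] integral_completion[OF m] by simp
  have "f \<in> borel_measurable lebesgue" using assms(2) by (simp add: measurable_completion)
  then show "f \<in> borel_measurable (lebesgue_on D)" by (rule measurable_restrict_space1)
qed

lemma AE_lebesgue_on_iff:
  assumes "D \<in> sets borel"
  shows "(AE x in lebesgue_on D. P x) \<longleftrightarrow> (AE x in lborel. x \<in> D \<longrightarrow> P x)"
  using assms by (subst AE_restrict_space_iff) (auto simp: AE_completion_iff)

lemma fundamental_solution_eq: "fundamental_solution (z::'a::euclidean_space) = - newton z"
proof -
  have "2 - real DIM('a) = - (real DIM('a) - 2)" by simp
  then show ?thesis
    unfolding fundamental_solution_def newton_def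
    by (simp only: mult_minus_left inverse_minus_eq inverse_mult_distrib)
qed

lemma partial_deriv_eq:
  "(f has_derivative f') (at x) \<Longrightarrow> partial_deriv b f x = f' b"
  unfolding partial_deriv_def using frechet_derivative_at by metis

lemma has_derivative_partial_derivs:
  assumes "f differentiable (at x)"
  shows "(f has_derivative (\<lambda>h. (\<Sum>b\<in>Basis. partial_deriv b f x *\<^sub>R b) \<bullet> h)) (at (x::'a::euclidean_space))"
proof -
  obtain f' where f': "(f has_derivative f') (at x)" using assms differentiable_def by blast
  then interpret bounded_linear f' by (rule has_derivative_bounded_linear)
  have "f' = (\<lambda>h. (\<Sum>b\<in>Basis. partial_deriv b f x *\<^sub>R b) \<bullet> h)"
  proof
    fix h :: 'a
    have "f' h = f' (\<Sum>b\<in>Basis. (h \<bullet> b) *\<^sub>R b)" by (simp add: euclidean_representation)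
    also have "\<dots> = (\<Sum>b\<in>Basis. (h \<bullet> b) * f' b)" by (simp add: sum scaleR)
    also have "\<dots> = (\<Sum>b\<in>Basis. partial_deriv b f x *\<^sub>R b) \<bullet> h"
      by (simp add: inner_sum_left partial_deriv_eq[OF f'] inner_commute[of h] mult.commute)
    finally show "f' h = (\<Sum>b\<in>Basis. partial_deriv b f x *\<^sub>R b) \<bullet> h" .
  qed
  with f' show ?thesis by simp
qed

lemma lipschitz_imp_hoelder:
  assumes "bounded S" "B \<ge> 0" "0 < \<alpha>" "\<alpha> < 1" "\<And>x y. x \<in> S \<Longrightarrow> y \<in> S \<Longrightarrow> \<bar>f x - f y\<bar> \<le> B * dist x y"
  shows "f \<in> hoelder_space \<alpha> S"
proof -
  obtain d0 where d0: "\<And>x y. x \<in> S \<Longrightarrow> y \<in> S \<Longrightarrow> dist x y \<le> d0" using assms(1) bounded_two_points by metis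
  define d where "d = max d0 0"
  have d: "dist x y \<le> d" if "x \<in> S" "y \<in> S" for x y using d0[OF that] by (simp add: d_def)
  have "\<bar>f x - f y\<bar> \<le> (B * d powr (1 - \<alpha>)) * dist x y powr \<alpha>" if "x \<in> S" "y \<in> S" for x y
  proof (cases "dist x y = 0")
    case False
    then have "dist x y = dist x y powr (1 - \<alpha>) * dist x y powr \<alpha>"
      by (subst powr_add[symmetric]) simp
    also have "\<dots> \<le> d powr (1 - \<alpha>) * dist x y powr \<alpha>"
      using assms d[OF that] by (intro mult_right_mono powr_mono2) auto
    finally have "B * dist x y \<le> B * (d powr (1 - \<alpha>) * dist x y powr \<alpha>)"
      using assms(2) by (intro mult_left_mono)
    then show ?thesis using assms(5)[OF that] by (simp add: mult.assoc)
  qed simp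
  then show ?thesis unfolding hoelder_space_def by blast
qed

lemma hoelder_space_diff_cmult:
  assumes "f \<in> hoelder_space \<alpha> S" "g \<in> hoelder_space \<alpha> S"
  shows "(\<lambda>x. f x - c * g x) \<in> hoelder_space \<alpha> S"
proof -
  obtain C1 where C1: "\<And>x y. x \<in> S \<Longrightarrow> y \<in> S \<Longrightarrow> \<bar>f x - f y\<bar> \<le> C1 * dist x y powr \<alpha>"
    using assms(1) unfolding hoelder_space_def by blast
  obtain C2 where C2: "\<And>x y. x \<in> S \<Longrightarrow> y \<in> S \<Longrightarrow> \<bar>g x - g y\<bar> \<le> C2 * dist x y powr \<alpha>"
    using assms(2) unfolding hoelder_space_def by blast
  have "\<bar>(f x - c * g x) - (f y - c * g y)\<bar> \<le> (C1 + \<bar>c\<bar> * C2) * dist x y powr \<alpha>" if "x \<in> S" "y \<in> S" for x y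
  proof -
    have "(f x - c * g x) - (f y - c * g y) = (f x - f y) - c * (g x - g y)" by (simp add: algebra_simps)
    also have "\<bar>\<dots>\<bar> \<le> \<bar>f x - f y\<bar> + \<bar>c\<bar> * \<bar>g x - g y\<bar>"
      using abs_triangle_ineq4[of "f x - f y" "c * (g x - g y)"] by (simp add: abs_mult)
    also have "\<dots> \<le> C1 * dist x y powr \<alpha> + \<bar>c\<bar> * (C2 * dist x y powr \<alpha>)"
      by (intro add_mono mult_left_mono C1 C2 that) auto
    finally show ?thesis by (simp add: algebra_simps)
  qed
  then show ?thesis unfolding hoelder_space_def by blast
qed

lemma hoelder_space_bounded:
  assumes "f \<in> hoelder_space \<alpha> S" "bounded S" "0 < \<alpha>"
  shows "\<exists>M. \<forall>x\<in>S. \<bar>f x\<bar> \<le> M"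
proof (cases "S = {}")
  case False
  then obtain p where p: "p \<in> S" by blast
  obtain C where C: "\<And>x y. x \<in> S \<Longrightarrow> y \<in> S \<Longrightarrow> \<bar>f x - f y\<bar> \<le> C * dist x y powr \<alpha>"
    using assms(1) unfolding hoelder_space_def by blast
  obtain d where d: "\<And>x y. x \<in> S \<Longrightarrow> y \<in> S \<Longrightarrow> dist x y \<le> d" using assms(2) bounded_two_points by metis
  have "\<bar>f x\<bar> \<le> \<bar>f p\<bar> + \<bar>C\<bar> * d powr \<alpha>" if x: "x \<in> S" for x
  proof -
    have "\<bar>f x - f p\<bar> \<le> \<bar>C\<bar> * dist x p powr \<alpha>"
      using C[OF x p] mult_right_mono[OF abs_ge_self[of C], of "dist x p powr \<alpha>"] by simp
    also have "\<dots> \<le> \<bar>C\<bar> * d powr \<alpha>"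
      using assms(3) d[OF x p] by (intro mult_left_mono powr_mono2) auto
    finally show ?thesis by linarith
  qed
  then show ?thesis by blast
qed auto

context dim_ge_3
begin

text \<open>
  Passes from a Lebesgue measurable function to a Borel representative. It holds for every \<open>x\<close>, whether
  or not the integral converges, because both sides are then 0.
\<close>
lemma lebesgue_on_newton_integral:
  fixes u u' :: "'a \<Rightarrow> real"
  assumes D: "D \<in> sets borel" and u: "u \<in> borel_measurable (lebesgue_on D)"
    and u': "u' \<in> borel_measurable borel" and eq: "AE x in lborel. indicator D x * u x = u' x"
  shows "(\<integral>y. fundamental_solution (x - y) * u y \<partial>lebesgue_on D) = - (LBINT y. u' y * newton (x - y))"
proof -
  note [measurable] = D u' borel_measurable_newton
  have Ds: "D \<inter> space lebesgue \<in> sets lebesgue" using D by simp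
  have m1: "(\<lambda>y. newton (x - y)) \<in> borel_measurable lebesgue"
    by (intro measurable_completion) measurable
  have m2: "(\<lambda>y. indicator D y * u y) \<in> borel_measurable lebesgue"
    using u borel_measurable_restrict_space_iff[OF Ds, of u] by simp
  have m3: "(\<lambda>y. u' y * newton (x - y)) \<in> borel_measurable lborel" by measurable
  have "(\<integral>y. fundamental_solution (x - y) * u y \<partial>lebesgue_on D)
      = (\<integral>y. - (newton (x - y) * (indicator D y * u y)) \<partial>lebesgue)"
    unfolding integral_restrict_space[OF Ds] fundamental_solution_eq
    by (simp add: mult_ac)
  also have "\<dots> = (\<integral>y. - (u' y * newton (x - y)) \<partial>lebesgue)"
  proof (rule integral_cong_AE)
    have "AE y in lebesgue. indicator D y * u y = u' y" using eq by (rule AE_completion)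
    then show "AE y in lebesgue. - (newton (x - y) * (indicator D y * u y)) = - (u' y * newton (x - y))"
      by eventually_elim simp
    show "(\<lambda>y. - (newton (x - y) * (indicator D y * u y))) \<in> borel_measurable lebesgue"
      by (intro borel_measurable_uminus borel_measurable_times m1 m2)
    show "(\<lambda>y. - (u' y * newton (x - y))) \<in> borel_measurable lebesgue"
      by (intro borel_measurable_uminus measurable_completion m3)
  qed
  also have "\<dots> = - (LBINT y. u' y * newton (x - y))"
    using integral_completion[OF m3] by simp
  finally show ?thesis .
qed

text \<open>
  Duality: the difference \<open>d\<close> is tested with the bounded solution \<open>\<theta>\<close> for the right-hand side \<open>sgn d\<close>.
\<close>
lemma L2_solution_unique:
  fixes D :: "'a set"
  assumes D: "D \<in> sets borel" "bounded D" and \<mu>: "\<mu>\<^sup>2 > 0"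
    and \<phi>: "bounded_density \<phi>" "\<And>x. x \<notin> D \<Longrightarrow> \<phi> x = 0" "\<And>x. x \<in> D \<Longrightarrow> \<phi> x + \<mu>\<^sup>2 * potential \<phi> x = h x"
    and sol: "L2_solution \<mu> D h u"
  shows "AE x in lebesgue_on D. u x = \<phi> x"
proof -
  note [measurable] = D(1) bounded_density_measurable[OF \<phi>(1)] borel_measurable_newton
  have Ds: "D \<inter> space lebesgue \<in> sets lebesgue" using D by simp
  have um: "u \<in> borel_measurable (lebesgue_on D)" and u2: "integrable (lebesgue_on D) (\<lambda>x. (u x)\<^sup>2)"
    and ueq: "AE x in lebesgue_on D. u x - \<mu>\<^sup>2 * (\<integral>y. fundamental_solution (x - y) * u y \<partial>lebesgue_on D) = h x"
    using sol by (auto simp: L2_solution_def L2_space_def)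
  have uml: "(\<lambda>y. indicator D y * u y) \<in> borel_measurable lebesgue"
    using um borel_measurable_restrict_space_iff[OF Ds, of u] by simp
  \<comment> \<open>Fubini needs a Borel representative of u\<close>
  obtain w where w[measurable]: "w \<in> borel_measurable borel" and weq: "AE x in lborel. indicator D x * u x = w x"
    using completion_ex_borel_measurable_real[OF uml] by auto
  define u' where "u' x = indicator D x * w x" for x
  have u'm[measurable]: "u' \<in> borel_measurable borel" unfolding u'_def by measurable
  have u'eq: "AE x in lborel. indicator D x * u x = u' x"
    using weq by eventually_elim (auto simp: u'_def indicator_def split: if_splits)
  have ind: "bounded_density (indicator D :: 'a \<Rightarrow> real)"
    using bounded_density_indicator[OF D, of "\<lambda>_. 1" 1] by simp
  have u'2: "integrable lborel (\<lambda>x. (u' x)\<^sup>2)"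
  proof -
    have "integrable lebesgue (\<lambda>x. indicator D x * (u x)\<^sup>2)"
      using u2 unfolding integrable_restrict_space[OF Ds] by simp
    moreover have "AE x in lebesgue. indicator D x * (u x)\<^sup>2 = (u' x)\<^sup>2"
      using AE_completion[OF u'eq] by eventually_elim (auto simp: indicator_def split: if_splits)
    moreover have m: "(\<lambda>x. (u' x)\<^sup>2) \<in> borel_measurable lborel" by measurable
    ultimately have "integrable lebesgue (\<lambda>x. (u' x)\<^sup>2)"
      by (intro integrable_cong_AE_imp[OF _ measurable_completion[OF m]])
    then show ?thesis using integrable_completion[OF m] by simp
  qed
  have u'i: "integrable lborel u'"
  proof (rule Bochner_Integration.integrable_bound)
    show "integrable lborel (\<lambda>x. indicator D x + (u' x)\<^sup>2)"
      using integrable_bounded_density[OF ind] u'2 by simp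
    have "\<bar>u' x\<bar> \<le> indicator D x + (u' x)\<^sup>2" for x
    proof (cases "x \<in> D")
      case True
      have "0 \<le> (\<bar>u' x\<bar> - 1)\<^sup>2" by simp
      then have "2 * \<bar>u' x\<bar> \<le> 1 + (u' x)\<^sup>2" by (simp add: power2_diff)
      then show ?thesis using True by simp
    qed (simp add: u'_def)
    then have "norm (u' x) \<le> norm (indicator D x + (u' x)\<^sup>2)" for x
      unfolding real_norm_def using abs_ge_self order_trans by blast
    then show "AE x in lborel. norm (u' x) \<le> norm (indicator D x + (u' x)\<^sup>2)" by simp
  qed measurable
  define d where "d x = u' x - \<phi> x" for x
  have di: "integrable lborel d" unfolding d_def[abs_def]
    using u'i integrable_bounded_density[OF \<phi>(1)] by simp
  then have [measurable]: "d \<in> borel_measurable borel" by auto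
  have d0: "d x = 0" if "x \<notin> D" for x using that \<phi>(2) by (simp add: d_def u'_def)
  have "AE x in lborel. x \<in> D \<longrightarrow> u x - \<mu>\<^sup>2 * (\<integral>y. fundamental_solution (x - y) * u y \<partial>lebesgue_on D) = h x"
    using ueq by (simp add: AE_lebesgue_on_iff[OF D(1)])
  moreover have "AE x in lborel. integrable lborel (\<lambda>y. u' y * indicator D x * newton (x - y))"
    using lborel_pair.AE_integrable_snd[OF integrable_pair_kernel[OF ind u'i weakly_singular_newton]] .
  ultimately have deq: "AE x in lborel. x \<in> D \<longrightarrow> d x + \<mu>\<^sup>2 * (LBINT y. d y * newton (x - y)) = 0"
    using u'eq
  proof eventually_elim
    case (elim x)
    show ?case
    proof
      assume x: "x \<in> D"
      have i: "integrable lborel (\<lambda>y. u' y * newton (x - y))" using elim(2) x by simp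
      have "(LBINT y. d y * newton (x - y)) = (LBINT y. u' y * newton (x - y) - \<phi> y * newton (x - y))"
        by (simp add: d_def left_diff_distrib)
      also have "\<dots> = (LBINT y. u' y * newton (x - y)) - potential \<phi> x"
        unfolding potential_def by (rule Bochner_Integration.integral_diff[OF i integrable_potential[OF \<phi>(1)]])
      finally have e: "(LBINT y. d y * newton (x - y)) = \<dots>" .
      have "u' x + \<mu>\<^sup>2 * (LBINT y. u' y * newton (x - y)) = h x"
        using elim(1,3) x lebesgue_on_newton_integral[OF D(1) um u'm u'eq, of x] by simp
      then show "d x + \<mu>\<^sup>2 * (LBINT y. d y * newton (x - y)) = 0"
        unfolding e using \<phi>(3)[OF x] by (simp add: d_def algebra_simps)
    qed
  qed
  define g where "g x = indicator D x * sgn (d x)" for x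
  have gd: "bounded_density g"
    unfolding g_def[abs_def] by (rule bounded_density_indicator[OF D, of _ 1]) (auto simp: sgn_if)
  obtain \<theta> where \<theta>: "bounded_density \<theta>" "\<And>x. x \<notin> D \<Longrightarrow> \<theta> x = 0" "\<And>x. x \<in> D \<Longrightarrow> \<theta> x + \<mu>\<^sup>2 * potential \<theta> x = g x"
    using integral_equation_solvable[OF D \<mu> gd] by (force simp: g_def)
  note [measurable] = bounded_density_measurable[OF \<theta>(1)]
    borel_measurable_continuous_onI[OF continuous_on_potential[OF \<theta>(1)]]
  obtain B1 where B1: "\<And>x. \<bar>\<theta> x\<bar> \<le> B1" using \<theta>(1) by (auto simp: bounded_density_def)
  obtain B2 where B2: "\<And>x::'a. \<bar>potential \<theta> x\<bar> \<le> B2" using potential_bounded[OF \<theta>(1)] by blast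
  have bi: "integrable lborel (\<lambda>x. d x * k x)" if [measurable]: "k \<in> borel_measurable borel" and B: "\<And>x. \<bar>k x\<bar> \<le> B" for k B
  proof (rule Bochner_Integration.integrable_bound[OF integrable_mult_right[OF di, of B]])
    have "norm (d x * k x) \<le> norm (B * d x)" for x
      using mult_left_mono[OF order_trans[OF B[of x] abs_ge_self] abs_ge_zero[of "d x"]]
      by (simp add: abs_mult mult.commute)
    then show "AE x in lborel. norm (d x * k x) \<le> norm (B * d x)" by simp
  qed measurable
  have i1: "integrable lborel (\<lambda>x. d x * \<theta> x)" by (rule bi[OF _ B1]) measurable
  have i2: "integrable lborel (\<lambda>x. d x * potential \<theta> x)" by (rule bi[OF _ B2]) measurable
  have "(LBINT x. \<bar>d x\<bar>) = (LBINT x. d x * \<theta> x + \<mu>\<^sup>2 * (d x * potential \<theta> x))"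
  proof (rule Bochner_Integration.integral_cong[OF refl])
    fix x
    show "\<bar>d x\<bar> = d x * \<theta> x + \<mu>\<^sup>2 * (d x * potential \<theta> x)"
    proof (cases "x \<in> D")
      case True
      have "\<bar>d x\<bar> = d x * g x" using True by (simp add: g_def abs_sgn)
      also have "\<dots> = d x * (\<theta> x + \<mu>\<^sup>2 * potential \<theta> x)" using \<theta>(3)[OF True] by simp
      finally show ?thesis by (simp add: algebra_simps)
    qed (simp add: d0)
  qed
  also have "\<dots> = (LBINT x. d x * \<theta> x) + \<mu>\<^sup>2 * (LBINT x. d x * potential \<theta> x)"
    using i1 i2 by simp
  also have "(LBINT x. d x * potential \<theta> x) = (LBINT x. \<theta> x * (LBINT y. d y * newton (x - y)))"
    by (rule potential_symmetric[OF \<theta>(1) di, symmetric])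
  also have "\<mu>\<^sup>2 * \<dots> = (LBINT x. \<mu>\<^sup>2 * (\<theta> x * (LBINT y. d y * newton (x - y))))"
    by (rule integral_mult_right_zero[symmetric])
  also have "\<dots> = (LBINT x. - (d x * \<theta> x))"
  proof (rule integral_cong_AE)
    show "AE x in lborel. \<mu>\<^sup>2 * (\<theta> x * (LBINT y. d y * newton (x - y))) = - (d x * \<theta> x)"
      using deq
    proof eventually_elim
      case (elim x)
      show ?case
      proof (cases "x \<in> D")
        case True
        then have e: "\<mu>\<^sup>2 * (LBINT y. d y * newton (x - y)) = - d x" using elim by simp
        have "\<mu>\<^sup>2 * (\<theta> x * (LBINT y. d y * newton (x - y))) = \<theta> x * (\<mu>\<^sup>2 * (LBINT y. d y * newton (x - y)))"
          by (rule mult.left_commute)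
        then show ?thesis unfolding e by simp
      qed (simp add: \<theta>(2))
    qed
  qed measurable
  also have "(LBINT x. d x * \<theta> x) + (LBINT x. - (d x * \<theta> x)) = 0" by simp
  finally have "(LBINT x. \<bar>d x\<bar>) = 0" .
  then have "AE x in lborel. \<bar>d x\<bar> = 0"
    using integral_nonneg_eq_0_iff_AE[of lborel "\<lambda>x. \<bar>d x\<bar>"] di by simp
  with u'eq have "AE x in lborel. x \<in> D \<longrightarrow> u x = \<phi> x"
    by eventually_elim (auto simp: d_def)
  then show ?thesis by (simp add: AE_lebesgue_on_iff[OF D(1)])
qed

lemma L2_solution_density:
  fixes D :: "'a set"
  assumes D: "D \<in> sets borel"
    and \<phi>: "bounded_density \<phi>" "\<And>x. x \<notin> D \<Longrightarrow> \<phi> x = 0" "\<And>x. x \<in> D \<Longrightarrow> \<phi> x + \<mu>\<^sup>2 * potential \<phi> x = h x"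
  shows "L2_solution \<mu> D h \<phi>"
  unfolding L2_solution_def L2_space_def mem_Collect_eq
proof (intro conjI)
  note m[measurable] = bounded_density_measurable[OF \<phi>(1)]
  show pm: "\<phi> \<in> borel_measurable (lebesgue_on D)" by (rule lebesgue_on_borel_iff(3)[OF D m])
  have e: "indicator D x * (\<phi> x)\<^sup>2 = (\<phi> x)\<^sup>2" "indicator D x * \<phi> x = \<phi> x" for x
    using \<phi>(2)[of x] by (auto simp: indicator_def)
  have m2: "(\<lambda>x. (\<phi> x)\<^sup>2) \<in> borel_measurable borel" by measurable
  show "integrable (lebesgue_on D) (\<lambda>x. (\<phi> x)\<^sup>2)"
    unfolding lebesgue_on_borel_iff(1)[OF D m2] e
    by (rule integrable_bounded_density[OF bounded_density_power2[OF \<phi>(1)]])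
  have "\<phi> x - \<mu>\<^sup>2 * (\<integral>y. fundamental_solution (x - y) * \<phi> y \<partial>lebesgue_on D) = h x" if "x \<in> D" for x
    using lebesgue_on_newton_integral[OF D pm m, of x] \<phi>(3)[OF that] by (simp add: e potential_def)
  then show "AE x in lebesgue_on D. \<phi> x - \<mu>\<^sup>2 * (\<integral>y. fundamental_solution (x - y) * \<phi> y \<partial>lebesgue_on D) = h x"
    by (simp add: AE_lebesgue_on_iff[OF D])
qed

text \<open>
  Bootstrapping: \<open>\<phi>\<close> coincides in \<open>D\<close> with \<open>h - \<mu>\<^sup>2 T \<phi>\<close>, which is \<open>C\<^sup>1\<close> as \<open>\<phi>\<close> is bounded, and therefore
  \<open>T \<phi>\<close> is \<open>C\<^sup>2\<close>.
\<close>
lemma density_panharmonic: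
  fixes D :: "'a set"
  assumes D: "open D" and h: "harmonic_in D h"
    and \<phi>: "bounded_density \<phi>" "\<And>x. x \<in> D \<Longrightarrow> \<phi> x + \<mu>\<^sup>2 * potential \<phi> x = h x"
  shows "panharmonic_in \<mu> D (\<lambda>x. h x - \<mu>\<^sup>2 * potential \<phi> x)"
proof -
  let ?v = "\<lambda>x. h x - \<mu>\<^sup>2 * potential \<phi> x"
  let ?V = "potential_grad \<phi>"
  have hC2: "h differentiable_on D" "\<And>b. b \<in> Basis \<Longrightarrow> partial_deriv b h differentiable_on D"
     "\<And>b c. b \<in> Basis \<Longrightarrow> c \<in> Basis \<Longrightarrow> continuous_on D (partial_deriv c (partial_deriv b h))"
     "\<And>x. x \<in> D \<Longrightarrow> laplacian h x = 0"
    using h by (auto simp: harmonic_in_def C2_on_def)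
  have dat: "f differentiable (at x)" if "f differentiable_on D" "x \<in> D" for f :: "'a \<Rightarrow> real" and x
    using that D by (simp add: differentiable_on_eq_differentiable_at)
  define Gh where "Gh x = (\<Sum>b\<in>Basis. partial_deriv b h x *\<^sub>R b)" for x
  define G where "G x = Gh x - \<mu>\<^sup>2 *\<^sub>R ?V x" for x
  have Ghb: "Gh x \<bullet> b = partial_deriv b h x" if "b \<in> Basis" for x b
    using that by (simp add: Gh_def inner_sum_left inner_Basis if_distrib cong: if_cong)
  have vd: "(?v has_derivative (\<lambda>t. G x \<bullet> t)) (at x)" if x: "x \<in> D" for x
  proof -
    have "(h has_derivative (\<lambda>t. Gh x \<bullet> t)) (at x)"
      unfolding Gh_def by (rule has_derivative_partial_derivs[OF dat[OF hC2(1) x]])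
    moreover have "((\<lambda>x. \<mu>\<^sup>2 * potential \<phi> x) has_derivative (\<lambda>t. \<mu>\<^sup>2 * (?V x \<bullet> t))) (at x)"
      by (rule has_derivative_mult_right[OF potential_C1(1)[OF \<phi>(1)]])
    ultimately have "(?v has_derivative (\<lambda>t. Gh x \<bullet> t - \<mu>\<^sup>2 * (?V x \<bullet> t))) (at x)"
      by (rule has_derivative_diff)
    then show ?thesis by (simp add: G_def inner_diff_left)
  qed
  have Gc: "continuous_on D G"
    unfolding G_def[abs_def] Gh_def
    by (intro continuous_on_diff continuous_on_sum continuous_on_scaleR continuous_on_const
        differentiable_imp_continuous_on hC2(2) continuous_on_subset[OF potential_C1(2)[OF \<phi>(1)]]) auto
  have veq: "?v x = \<phi> x" if "x \<in> D" for x using \<phi>(2)[OF that] by simp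
  have \<phi>d: "(\<phi> has_derivative (\<lambda>t. G x \<bullet> t)) (at x)" if x: "x \<in> D" for x
    by (rule has_derivative_transform_within_open[OF vd[OF x] D x veq])
  have pv: "partial_deriv b ?v x = partial_deriv b h x - \<mu>\<^sup>2 * (?V x \<bullet> b)" if "b \<in> Basis" "x \<in> D" for b x
    using partial_deriv_eq[OF vd[OF that(2)], of b] Ghb[OF that(1), of x] by (simp add: G_def inner_diff_left)
  have local: "\<exists>s>0. ball x0 s \<subseteq> D \<and> (\<exists>H. (\<forall>b\<in>Basis. continuous_on (ball x0 s) (H b)) \<and>
     (\<forall>b\<in>Basis. \<forall>x\<in>ball x0 s. ((\<lambda>x. ?V x \<bullet> b) has_derivative (\<lambda>t. H b x \<bullet> t)) (at x)))" if "x0 \<in> D" for x0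
    using potential_C2[OF \<phi>(1) D that \<phi>d Gc] by blast
  have second: "(partial_deriv b ?v has_derivative (\<lambda>t. partial_deriv t (partial_deriv b h) x - \<mu>\<^sup>2 * (Hb \<bullet> t))) (at x)"
    if b: "b \<in> Basis" and x: "x \<in> D" and Hb: "((\<lambda>x. ?V x \<bullet> b) has_derivative (\<lambda>t. Hb \<bullet> t)) (at x)" for b x Hb
  proof -
    obtain f' where f': "(partial_deriv b h has_derivative f') (at x)"
      using dat[OF hC2(2)[OF b] x] differentiable_def by blast
    have f'eq: "f' = (\<lambda>t. partial_deriv t (partial_deriv b h) x)" using partial_deriv_eq[OF f'] by auto
    have "((\<lambda>x. partial_deriv b h x - \<mu>\<^sup>2 * (?V x \<bullet> b)) has_derivative (\<lambda>t. f' t - \<mu>\<^sup>2 * (Hb \<bullet> t))) (at x)"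
      by (rule has_derivative_diff[OF f' has_derivative_mult_right[OF Hb]])
    then have "(partial_deriv b ?v has_derivative (\<lambda>t. f' t - \<mu>\<^sup>2 * (Hb \<bullet> t))) (at x)"
      by (rule has_derivative_transform_within_open[OF _ D x]) (simp add: pv[OF b])
    then show ?thesis unfolding f'eq .
  qed
  have C2: "C2_on D ?v"
    unfolding C2_on_def
  proof (intro conjI ballI)
    show "?v differentiable_on D"
      using vd D by (auto simp: differentiable_on_eq_differentiable_at differentiable_def)
    fix b :: 'a assume b: "b \<in> Basis"
    show "partial_deriv b ?v differentiable_on D"
      unfolding differentiable_on_eq_differentiable_at[OF D]
    proof
      fix x assume x: "x \<in> D"
      obtain s H where "s > 0" "ball x s \<subseteq> D" "\<And>b y. b \<in> Basis \<Longrightarrow> y \<in> ball x s \<Longrightarrow> ((\<lambda>x. ?V x \<bullet> b) has_derivative (\<lambda>t. H b y \<bullet> t)) (at y)"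
        using local[OF x] by metis
      then show "partial_deriv b ?v differentiable at x"
        using second[OF b x, of "H b x"] b unfolding differentiable_def by (metis centre_in_ball)
    qed
    fix c :: 'a assume c: "c \<in> Basis"
    show "continuous_on D (partial_deriv c (partial_deriv b ?v))"
    proof (intro continuous_at_imp_continuous_on ballI)
      fix x assume x: "x \<in> D"
      obtain s H where s: "s > 0" "ball x s \<subseteq> D" and Hc: "\<And>b. b \<in> Basis \<Longrightarrow> continuous_on (ball x s) (H b)"
        and H: "\<And>b y. b \<in> Basis \<Longrightarrow> y \<in> ball x s \<Longrightarrow> ((\<lambda>x. ?V x \<bullet> b) has_derivative (\<lambda>t. H b y \<bullet> t)) (at y)"
        using local[OF x] by metis
      have eq: "partial_deriv c (partial_deriv b ?v) y = partial_deriv c (partial_deriv b h) y - \<mu>\<^sup>2 * (H b y \<bullet> c)" if "y \<in> ball x s" for y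
        using partial_deriv_eq[OF second[OF b _ H[OF b that]], of c] s that by auto
      have "continuous_on (ball x s) (\<lambda>y. partial_deriv c (partial_deriv b h) y - \<mu>\<^sup>2 * (H b y \<bullet> c))"
        by (intro continuous_on_diff continuous_on_mult continuous_on_inner continuous_on_const
             continuous_on_subset[OF hC2(3)[OF b c] s(2)] Hc b)
      then have "continuous_on (ball x s) (partial_deriv c (partial_deriv b ?v))"
        by (rule continuous_on_cong[THEN iffD1, OF refl, rotated]) (simp add: eq)
      then show "isCont (partial_deriv c (partial_deriv b ?v)) x"
        using s continuous_on_eq_continuous_at[OF open_ball] by (metis centre_in_ball)
    qed
  qed
  have "laplacian ?v x - \<mu>\<^sup>2 * ?v x = 0" if x: "x \<in> D" for x
  proof -
    obtain s H where s: "s > 0" "ball x s \<subseteq> D" and Hc: "\<And>b. b \<in> Basis \<Longrightarrow> continuous_on (ball x s) (H b)"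
      and H: "\<And>b y. b \<in> Basis \<Longrightarrow> y \<in> ball x s \<Longrightarrow> ((\<lambda>x. ?V x \<bullet> b) has_derivative (\<lambda>t. H b y \<bullet> t)) (at y)"
      using local[OF x] by metis
    have \<phi>c: "continuous_on (ball x s) \<phi>"
      using \<phi>d s by (intro continuous_at_imp_continuous_on ballI has_derivative_continuous) blast
    have xs: "x \<in> ball x s" using s by simp
    have "laplacian ?v x = (\<Sum>b\<in>Basis. partial_deriv b (partial_deriv b h) x - \<mu>\<^sup>2 * (H b x \<bullet> b))"
      unfolding laplacian_def
      by (intro sum.cong refl) (rule partial_deriv_eq[OF second[OF _ x H[OF _ xs]]])
    also have "\<dots> = laplacian h x - \<mu>\<^sup>2 * (\<Sum>b\<in>Basis. H b x \<bullet> b)"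
      by (simp add: laplacian_def sum_subtractf sum_distrib_left)
    also have "\<dots> = \<mu>\<^sup>2 * \<phi> x"
      using poisson_equation[OF \<phi>(1) s(1) \<phi>c Hc H] hC2(4)[OF x] by simp
    finally show ?thesis using veq[OF x] by simp
  qed
  with C2 show ?thesis by (simp add: panharmonic_in_def)
qed

end

theorem theorem5p4:
  fixes D :: "(real ^ 'n) set" and \<mu> \<alpha> :: real and h :: "real ^ 'n \<Rightarrow> real"
  assumes "CARD('n) \<ge> 3"
    and "bounded_lipschitz_domain D"
    and "\<mu>\<^sup>2 > 0"
    and "0 < \<alpha>" and "\<alpha> < 1"
    and "h \<in> hoelder_space \<alpha> (closure D)"
    and "harmonic_in D h"
  shows "(\<exists>u. L2_solution \<mu> D h u) \<and>
    (\<forall>u w. L2_solution \<mu> D h u \<and> L2_solution \<mu> D h w \<longrightarrow>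
       (AE x in lebesgue_on D. u x = w x)) \<and>
    (\<forall>u. L2_solution \<mu> D h u \<longrightarrow>
       (\<exists>v. (AE x in lebesgue_on D. v x = u x) \<and>
            v \<in> hoelder_space \<alpha> (closure D) \<and> panharmonic_in \<mu> D v))"
proof -
  interpret dim_ge_3 "TYPE(real ^ 'n)"
    by standard (use assms(1) in simp)
  have D: "open D" "bounded D" using assms(2) by (auto simp: bounded_lipschitz_domain_def)
  then have DB: "D \<in> sets borel" by simp
  obtain M where M: "\<And>x. x \<in> closure D \<Longrightarrow> \<bar>h x\<bar> \<le> M"
    using hoelder_space_bounded[OF assms(6) bounded_closure[OF D(2)] assms(4)] by blast
  \<comment> \<open>the inner indicator provides a Borel function, h being continuous only on the closure of D\<close>
  define g where "g x = indicator D x * (indicator D x * h x)" for x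
  have "h differentiable_on D" using assms(7) by (simp add: harmonic_in_def C2_on_def)
  then have "(\<lambda>x. indicator D x *\<^sub>R h x) \<in> borel_measurable borel"
    by (intro borel_measurable_continuous_on_indicator DB differentiable_imp_continuous_on)
  then have gd: "bounded_density g"
    unfolding g_def[abs_def] using M closure_subset[of D]
    by (intro bounded_density_indicator[OF DB D(2), of _ M]) (auto simp: subset_iff)
  obtain \<phi> where \<phi>: "bounded_density \<phi>" "\<And>x. x \<notin> D \<Longrightarrow> \<phi> x = 0" "\<And>x. x \<in> D \<Longrightarrow> \<phi> x + \<mu>\<^sup>2 * potential \<phi> x = g x"
    using integral_equation_solvable[OF DB D(2) assms(3) gd] by (force simp: g_def)
  then have \<phi>h: "\<phi> x + \<mu>\<^sup>2 * potential \<phi> x = h x" if "x \<in> D" for x using that by (simp add: g_def)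
  have uniq: "AE x in lebesgue_on D. u x = \<phi> x" if "L2_solution \<mu> D h u" for u
    by (rule L2_solution_unique[OF DB D(2) assms(3) \<phi>(1,2) \<phi>h that])
  define v where "v x = h x - \<mu>\<^sup>2 * potential \<phi> x" for x
  have v\<phi>: "v x = \<phi> x" if "x \<in> D" for x using \<phi>h[OF that] by (simp add: v_def)
  have ex: "L2_solution \<mu> D h \<phi>" by (rule L2_solution_density[OF DB \<phi>(1,2) \<phi>h])
  have pan: "panharmonic_in \<mu> D v"
    unfolding v_def[abs_def] by (rule density_panharmonic[OF D(1) assms(7) \<phi>(1) \<phi>h])
  obtain B where "B \<ge> 0" "\<And>x y. \<bar>potential \<phi> x - potential \<phi> y\<bar> \<le> B * norm (x - y)"
    using potential_lipschitz[OF \<phi>(1)] by blast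
  then have "potential \<phi> \<in> hoelder_space \<alpha> (closure D)"
    by (intro lipschitz_imp_hoelder[OF bounded_closure[OF D(2)] _ assms(4,5), of B]) (auto simp: dist_norm)
  then have hol: "v \<in> hoelder_space \<alpha> (closure D)"
    unfolding v_def[abs_def] by (rule hoelder_space_diff_cmult[OF assms(6)])
  show ?thesis
  proof (intro conjI allI impI)
    show "\<exists>u. L2_solution \<mu> D h u" using ex by blast
    fix u w assume "L2_solution \<mu> D h u \<and> L2_solution \<mu> D h w"
    then show "AE x in lebesgue_on D. u x = w x"
      using uniq[of u] uniq[of w] by (auto elim: eventually_elim2)
  next
    fix u assume u: "L2_solution \<mu> D h u"
    have "AE x in lebesgue_on D. x \<in> D" by (simp add: AE_lebesgue_on_iff[OF DB])
    with uniq[OF u] have "AE x in lebesgue_on D. v x = u x"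
      by eventually_elim (simp add: v\<phi>)
    then show "\<exists>v. (AE x in lebesgue_on D. v x = u x) \<and> v \<in> hoelder_space \<alpha> (closure D) \<and> panharmonic_in \<mu> D v"
      using hol pan by blast
  qed
qed

end
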